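(* Let $T>0$ and $R>0$, let $F:H\to H$ be Lipschitz continuous and bounded, and let $g,h\in C_b(H)$. Let $u$ be the unique function in $C^1_\gamma(H)$ satisfying $$u(t,x)=P_th(x)+\int_0^t P_{t-s}\big[\mathcal H(\cdot,Du(s,\cdot))\big](x)\,ds,\qquad t\in[0,T],\ x\in H.$$ Then, for every $\theta\in(0,1)$ such that $\gamma+\theta\gamma<1$, $$u(t,\cdot)\in C^{1,\theta}_b(H),\qquad t\in(0,T],$$ that is, the Fréchet derivative $Du(t,\cdot)$ is $\theta$-Hölder continuous from $H$ into $H$. Furthermore, there exists a constant $\tilde L>0$ (independent of $t$) such that $$[Du(t,\cdot)]_\theta\le\tilde L\,\frac1{t^{\gamma+\gamma\theta}},\qquad t\in(0,T].$$
   Context: Setting. $H$ is a real separable (infinite-dimensional) Hilbert space with inner product $\langle\cdot,\cdot\rangle$ and norm $|\cdot|$, and $(e_n)_{n\ge1}$ is a fixed orthonormal basis of $H$. Let $\alpha\in(1,2)$ and $(\beta_n)_n\subset(0,\infty)$. On a stochastic basis $(\Omega,\mathcal F,(\mathcal F_t),\mathbb P)$ satisfying the usual assumptions, $(Z^n)_n$ is a sequence of independent one-dimensional $\alpha$-stable Lévy processes with $\mathbb E[e^{i\xi Z^n_t}]=e^{-t|\xi|^\alpha}$ for $\xi\in\mathbb R$, $t\ge0$, $n\in\mathbb N$. Standing hypothesis. $A:D(A)\subset H\to H$ is a self-adjoint operator such that: (i) $(e_n)_n\subset D(A)$ and there is a sequence $(\gamma_n)_n\subset(0,\infty)$ with $\gamma_n\to\infty$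 as $n\to\infty$ and $Ae_n=-\gamma_ne_n$ for all $n\in\mathbb N$; (ii) there exist $\gamma\in[1/\alpha,1)$ and $\bar C>0$ such that $\beta_n\ge\bar C\,\gamma_n^{\frac1\alpha-\gamma}$ for all $n\in\mathbb N$; (iii) $\sum_{n\ge1}\beta_n^\alpha\gamma_n^{-1}<\infty$. The number $\gamma$ is fixed as in (ii). $(e^{tA})_{t\ge0}$ is the semigroup generated by $A$, i.e. $e^{tA}e_n=e^{-\gamma_nt}e_n$. Ornstein-Uhlenbeck process and semigroup. For $x\in H$, $Z^x_{A,t}=e^{tA}x+\sum_{n=1}^\infty\beta_n\int_0^te^{-\gamma_n(t-s)}dZ^n_s\,e_n$, $t\ge0$, which under the standing hypothesis is a well-defined $H$-valued process. For bounded Borel measurable $\phi:H\to\mathbb R$, $P_t\phi(x)=\mathbb E[\phi(Z^x_{A,t})]$, $t\ge0$, $x\in H$. Function spaces. $C_b(H)$ is the space of bounded continuous functions $H\to\mathbb R$ with the sup norm $\|\cdot\|_0$. $C^1_b(H)$ is the space of bounded continuous Fréchet differentiable functions $H\to\mathbb R$ with bounded continuous Fréchet derivative $D\phi:H\to H$ (and $\|D\phi\|_0=\sup_{x}|D\phi(x)|$). $C^1_\gamma(H)$ is the space of continuous bounded functions $u:[0,T]\times H\to\mathbb R$ such that $u(t,\cdot)\in C^1_b(H)$ for every $t\in(0,T]$ and $\sup_{t\in(0,T]}t^\gamma\|Du(t,\cdot)\|_0<\infty$, where $D$ denotes the Fréchet derivative in the space variable. For a function $l$ on $H$ with values in $\mathbb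 R$ or $H$ and $\theta\in(0,1]$, $[l]_\theta=\sup_{x,y\in H,\,x\ne y}\frac{|l(x)-l(y)|}{|x-y|^\theta}$; $l$ is $\theta$-Hölder continuous if $[l]_\theta<\infty$. $C^{1,\theta}_b(H)$ is the space of $f\in C^1_b(H)$ such that $Df:H\to H$ is $\theta$-Hölder continuous. Hamiltonian. $\mathcal H:H\times H\to\mathbb R$ is defined by $$\mathcal H(x,p)=\inf_{\lambda\in H,\,|\lambda|\le R}\Big[\langle\lambda,p\rangle+\tfrac12|\lambda|^2\Big]+\langle F(x),p\rangle+g(x).$$ The expression $\mathcal H(\cdot,Du(s,\cdot))$ denotes the function $y\mapsto\mathcal H(y,Du(s,y))$, $s\in(0,T]$. Existence and uniqueness in $C^1_\gamma(H)$ of the solution $u$ of the integral equation in the claim is known. *)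

theory Defs
  imports "HOL-Probability.Probability"
begin

section \<open>Bases, unbounded operators and semigroups in a Hilbert space\<close>

definition orthonormal_basis :: "(nat \<Rightarrow> 'h::real_inner) \<Rightarrow> bool" where
  "orthonormal_basis e \<longleftrightarrow>
     (\<forall>m n. e m \<bullet> e n = (if m = n then 1 else 0)) \<and> closure (span (range e)) = UNIV"

text \<open>An unbounded operator is a pair of a domain \<open>D\<close> and a total function \<open>A\<close> of which only the
  values on \<open>D\<close> matter. The third line below says that \<open>D\<close> is the domain of the Hilbert space adjoint
  \<open>A*\<close>, the last one that \<open>A*\<close> agrees with \<open>A\<close> there.\<close>

definition self_adjoint_operator :: "'h::real_inner set \<Rightarrow> ('h \<Rightarrow> 'h) \<Rightarrow> bool" where
  "self_adjoint_operator D A \<longleftrightarrow>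
     subspace D \<and> closure D = UNIV \<and>
     (\<forall>x\<in>D. \<forall>y\<in>D. A (x + y) = A x + A y) \<and> (\<forall>c. \<forall>x\<in>D. A (c *\<^sub>R x) = c *\<^sub>R A x) \<and>
     {y. \<exists>z. \<forall>x\<in>D. A x \<bullet> y = x \<bullet> z} = D \<and>
     (\<forall>x\<in>D. \<forall>y\<in>D. A x \<bullet> y = x \<bullet> A y)"

definition C0_semigroup :: "(real \<Rightarrow> 'h::real_normed_vector \<Rightarrow> 'h) \<Rightarrow> bool" where
  "C0_semigroup S \<longleftrightarrow>
     (\<forall>t\<ge>0. bounded_linear (S t)) \<and> (\<forall>x. S 0 x = x) \<and>
     (\<forall>s\<ge>0. \<forall>t\<ge>0. \<forall>x. S (s + t) x = S s (S t x)) \<and>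
     (\<forall>x. ((\<lambda>t. S t x) \<longlongrightarrow> x) (at_right 0))"

definition semigroup_generated_by ::
    "(real \<Rightarrow> 'h::real_normed_vector \<Rightarrow> 'h) \<Rightarrow> 'h set \<Rightarrow> ('h \<Rightarrow> 'h) \<Rightarrow> bool" where
  "semigroup_generated_by S D A \<longleftrightarrow>
     C0_semigroup S \<and>
     D = {x. \<exists>y. ((\<lambda>t. (S t x - x) /\<^sub>R t) \<longlongrightarrow> y) (at_right 0)} \<and>
     (\<forall>x\<in>D. ((\<lambda>t. (S t x - x) /\<^sub>R t) \<longlongrightarrow> A x) (at_right 0))"

section \<open>Stochastic bases and Levy processes\<close>

text \<open>Time is \<open>[0,\<infinity>)\<close>; values of filtrations and processes at negative times are irrelevant.\<close>

definition stochastic_basis :: "'w measure \<Rightarrow> (real \<Rightarrow> 'w measure) \<Rightarrow> bool" where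
  "stochastic_basis M \<F> \<longleftrightarrow>
     prob_space M \<and> complete_measure M \<and>
     (\<forall>t\<ge>0. subalgebra M (\<F> t)) \<and>
     (\<forall>s\<ge>0. \<forall>t\<ge>s. sets (\<F> s) \<subseteq> sets (\<F> t)) \<and>
     (\<forall>t\<ge>0. sets (\<F> t) = (\<Inter>s\<in>{t<..}. sets (\<F> s))) \<and>
     null_sets M \<subseteq> sets (\<F> 0)"

definition cadlag :: "(real \<Rightarrow> real) \<Rightarrow> bool" where
  "cadlag f \<longleftrightarrow>
     (\<forall>t\<ge>0. (f \<longlongrightarrow> f t) (at_right t)) \<and> (\<forall>t>0. \<exists>l. (f \<longlongrightarrow> l) (at_left t))"

definition levy_process ::
    "'w measure \<Rightarrow> (real \<Rightarrow> 'w measure) \<Rightarrow> (real \<Rightarrow> 'w \<Rightarrow> real) \<Rightarrow> bool" where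
  "levy_process M \<F> Z \<longleftrightarrow>
     (\<forall>t\<ge>0. Z t \<in> borel_measurable (\<F> t)) \<and>
     (AE \<omega> in M. Z 0 \<omega> = 0) \<and>
     (\<forall>s\<ge>0. \<forall>t\<ge>s. prob_space.indep_set M (sets (\<F> s))
        (sets (vimage_algebra (space M) (\<lambda>\<omega>. Z t \<omega> - Z s \<omega>) borel))) \<and>
     (\<forall>s\<ge>0. \<forall>t\<ge>s. distr M borel (\<lambda>\<omega>. Z t \<omega> - Z s \<omega>) = distr M borel (Z (t - s))) \<and>
     (AE \<omega> in M. cadlag (\<lambda>t. Z t \<omega>))"

definition stable_levy_process ::
    "'w measure \<Rightarrow> (real \<Rightarrow> 'w measure) \<Rightarrow> real \<Rightarrow> (real \<Rightarrow> 'w \<Rightarrow> real) \<Rightarrow> bool" where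
  "stable_levy_process M \<F> \<alpha> Z \<longleftrightarrow>
     levy_process M \<F> Z \<and>
     (\<forall>t\<ge>0. \<forall>\<xi>. char (distr M borel (Z t)) \<xi> = of_real (exp (- t * \<bar>\<xi>\<bar> powr \<alpha>)))"

definition independent_processes ::
    "'w measure \<Rightarrow> (nat \<Rightarrow> real \<Rightarrow> 'w \<Rightarrow> real) \<Rightarrow> bool" where
  "independent_processes M Z \<longleftrightarrow>
     prob_space.indep_vars M (\<lambda>n. \<Pi>\<^sub>M t\<in>{0::real..}. (borel :: real measure))
       (\<lambda>n \<omega>. \<lambda>t\<in>{0..}. Z n t \<omega>) UNIV"

section \<open>The stochastic integral of a continuous deterministic integrand\<close>

definition tendsto_in_probability ::
    "'w measure \<Rightarrow> (nat \<Rightarrow> 'w \<Rightarrow> real) \<Rightarrow> ('w \<Rightarrow> real) \<Rightarrow> bool" where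
  "tendsto_in_probability M X Y \<longleftrightarrow>
     (\<forall>\<epsilon>>0. (\<lambda>k. measure M {\<omega> \<in> space M. \<bar>X k \<omega> - Y \<omega>\<bar> > \<epsilon>}) \<longlonglongrightarrow> 0)"

text \<open>\<open>p 0 \<le> p 1 \<le> \<dots> \<le> p N\<close> is a subdivision of \<open>[0,t]\<close>.\<close>

definition subdivision :: "real \<Rightarrow> nat \<Rightarrow> (nat \<Rightarrow> real) \<Rightarrow> bool" where
  "subdivision t N p \<longleftrightarrow> p 0 = 0 \<and> p N = t \<and> (\<forall>i<N. p i \<le> p (Suc i))"

text \<open>\<open>I\<close> is a version of the integral of \<open>f\<close> against \<open>dZ\<close> over \<open>[0,t]\<close>: the limit in probability of
  the left-endpoint sums along every sequence of subdivisions with mesh tending to \<open>0\<close>. This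
  determines \<open>I\<close> up to null sets; for continuous \<open>f\<close> and a semimartingale \<open>Z\<close> it exists and is
  the Ito integral.\<close>

definition is_stochastic_integral ::
    "'w measure \<Rightarrow> (real \<Rightarrow> real) \<Rightarrow> (real \<Rightarrow> 'w \<Rightarrow> real) \<Rightarrow> real \<Rightarrow> ('w \<Rightarrow> real) \<Rightarrow> bool" where
  "is_stochastic_integral M f Z t I \<longleftrightarrow>
     I \<in> borel_measurable M \<and>
     (\<forall>N p. (\<forall>k. subdivision t (N k) (p k)) \<and>
        (\<forall>\<delta>>0. \<forall>\<^sub>F k in sequentially. \<forall>i<N k. p k (Suc i) - p k i < \<delta>) \<longrightarrow>
        tendsto_in_probability M
          (\<lambda>k \<omega>. \<Sum>i<N k. f (p k i) * (Z (p k (Suc i)) \<omega> - Z (p k i) \<omega>)) I)"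

definition stochastic_integral ::
    "'w measure \<Rightarrow> (real \<Rightarrow> real) \<Rightarrow> (real \<Rightarrow> 'w \<Rightarrow> real) \<Rightarrow> real \<Rightarrow> 'w \<Rightarrow> real" where
  "stochastic_integral M f Z t = (SOME I. is_stochastic_integral M f Z t I)"

section \<open>Ornstein--Uhlenbeck process and semigroup\<close>

text \<open>\<open>S\<close> is the semigroup generated by \<open>A\<close> and \<open>- \<gamma> n\<close> are the eigenvalues of \<open>A\<close>.\<close>

definition OU_process ::
    "'w measure \<Rightarrow> (real \<Rightarrow> 'h \<Rightarrow> 'h) \<Rightarrow> (nat \<Rightarrow> 'h) \<Rightarrow> (nat \<Rightarrow> real) \<Rightarrow> (nat \<Rightarrow> real) \<Rightarrow>
     (nat \<Rightarrow> real \<Rightarrow> 'w \<Rightarrow> real) \<Rightarrow> real \<Rightarrow> 'h \<Rightarrow> 'w \<Rightarrow> 'h::real_normed_vector" where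
  "OU_process M S e \<beta> \<gamma> Z t x \<omega> =
     S t x + (\<Sum>n. (\<beta> n * stochastic_integral M (\<lambda>s. exp (- \<gamma> n * (t - s))) (Z n) t \<omega>) *\<^sub>R e n)"

definition transition_semigroup ::
    "'w measure \<Rightarrow> (real \<Rightarrow> 'h \<Rightarrow> 'w \<Rightarrow> 'h) \<Rightarrow> real \<Rightarrow> ('h \<Rightarrow> real) \<Rightarrow> 'h \<Rightarrow> real" where
  "transition_semigroup M X t \<phi> x = (\<integral>\<omega>. \<phi> (X t x \<omega>) \<partial>M)"

section \<open>Function spaces\<close>

definition sup_norm :: "('h \<Rightarrow> 'b::real_normed_vector) \<Rightarrow> real" where
  "sup_norm f = (SUP x. norm (f x))"

definition Cb :: "('h::topological_space \<Rightarrow> 'b::real_normed_vector) set" where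
  "Cb = {f. continuous_on UNIV f \<and> bounded (range f)}"

text \<open>The Frechet derivative of a real function, identified with an element of the Hilbert space
  by the Riesz isomorphism.\<close>

definition grad :: "('h::real_inner \<Rightarrow> real) \<Rightarrow> 'h \<Rightarrow> 'h" where
  "grad f x = (THE d. GDERIV f x :> d)"

definition C1b :: "('h::real_inner \<Rightarrow> real) set" where
  "C1b = {f \<in> Cb. (\<forall>x. \<exists>d. GDERIV f x :> d) \<and> grad f \<in> Cb}"

definition C1_gamma :: "real \<Rightarrow> real \<Rightarrow> (real \<Rightarrow> 'h::real_inner \<Rightarrow> real) set" where
  "C1_gamma T \<gamma> =
     {u. continuous_on ({0..T} \<times> UNIV) (\<lambda>(t, x). u t x) \<and>
         bounded ((\<lambda>(t, x). u t x) ` ({0..T} \<times> UNIV)) \<and>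
         (\<forall>t\<in>{0<..T}. u t \<in> C1b) \<and>
         bdd_above ((\<lambda>t. t powr \<gamma> * sup_norm (grad (u t))) ` {0<..T})}"

text \<open>Values in \<^typ>\<open>ennreal\<close>, so that the supremum is always meaningful.\<close>

definition holder_seminorm ::
    "real \<Rightarrow> ('h::real_normed_vector \<Rightarrow> 'b::real_normed_vector) \<Rightarrow> ennreal" where
  "holder_seminorm \<theta> l =
     (SUP (x, y)\<in>{(x, y). x \<noteq> y}. ennreal (norm (l x - l y) / norm (x - y) powr \<theta>))"

definition C1b_holder :: "real \<Rightarrow> ('h::real_inner \<Rightarrow> real) set" where
  "C1b_holder \<theta> = {f \<in> C1b. holder_seminorm \<theta> (grad f) < \<infinity>}"

section \<open>Hamiltonian and the integral equation\<close>

definition hamiltonian ::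
    "real \<Rightarrow> ('h \<Rightarrow> 'h) \<Rightarrow> ('h \<Rightarrow> real) \<Rightarrow> 'h \<Rightarrow> 'h::real_inner \<Rightarrow> real" where
  "hamiltonian R F g x p =
     (INF l\<in>{l. norm l \<le> R}. l \<bullet> p + (norm l)\<^sup>2 / 2) + F x \<bullet> p + g x"

text \<open>\<open>P\<close> is the transition semigroup, \<open>H\<close> the Hamiltonian and \<open>h\<close> the initial datum. That the time
  integral exists is part of satisfying the equation (a non-existent Bochner integral is \<open>0\<close>
  in the library).\<close>

definition solves_integral_equation ::
    "(real \<Rightarrow> ('h \<Rightarrow> real) \<Rightarrow> 'h \<Rightarrow> real) \<Rightarrow> real \<Rightarrow> ('h \<Rightarrow> 'h \<Rightarrow> real) \<Rightarrow> ('h \<Rightarrow> real) \<Rightarrow>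
     (real \<Rightarrow> 'h::real_inner \<Rightarrow> real) \<Rightarrow> bool" where
  "solves_integral_equation P T H h u \<longleftrightarrow>
     (\<forall>t\<in>{0..T}. \<forall>x.
        set_integrable lborel {0..t} (\<lambda>s. P (t - s) (\<lambda>y. H y (grad (u s) y)) x) \<and>
        u t x = P t h x + (LBINT s:{0..t}. P (t - s) (\<lambda>y. H y (grad (u s) y)) x))"

end

theory Submission
  imports Defs
begin

text \<open>The gradient \<open>Du(t,\<cdot>)\<close> exists by hypothesis, so it suffices to bound second differences of
  \<open>u(t,\<cdot>)\<close>, and by the integral equation those of \<open>P\<^sub>t \<phi>\<close>; no differentiation under the integral sign is
  needed. The bound rests on a factorisation of the stable law: its Levy density
  \<open>c \<bar>x\<bar>\<^sup>-\<^sup>1\<^sup>-\<^sup>\<alpha>\<close> dominates that of two Laplace laws of small scale, so an \<open>\<alpha>\<close>-stable variable is a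
  sum of two independent Laplace variables and an independent rest. For a product of Laplace laws, the
  chi-square distance between the law and its shift tensorises and gives, uniformly in the dimension,
  \<open>\<bar>P\<^sub>t \<phi>(x + a) - P\<^sub>t \<phi>(x)\<bar> \<le> c t\<^sup>-\<^sup>\<gamma> \<parallel>\<phi>\<parallel>\<^sub>0 \<bar>a\<bar>\<close>; using the two Laplace factors one after the other gives
  the second difference bound \<open>c\<^sup>2 t\<^sup>-\<^sup>2\<^sup>\<gamma> \<parallel>\<phi>\<parallel>\<^sub>0 \<bar>a\<bar> \<bar>b\<bar>\<close>. Interpolating between the two and integrating
  \<open>(t - s)\<^sup>-\<^sup>\<gamma>\<^sup>-\<^sup>\<gamma>\<^sup>\<theta> s\<^sup>-\<^sup>\<gamma>\<close> yields the claim.\<close>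

section \<open>Orthonormal bases and the semigroup of a diagonal operator\<close>

text \<open>Two obstacles shape the argument. In infinite dimension a coordinatewise estimate must
  add up to the Hilbert norm: bounds on total variation add up like the sum of |h_n|, whereas
  chi-square factors 1 + O(h_n^2) multiply and yield the root of the sum of h_n^2. The stable
  density has no closed form, while the Laplace density has, and its ratio to a copy shifted by h is
  at most exp |h|. Moreover the objects are given indirectly: the semigroup through its generator,
  so that its action on e_n must be derived, and the stochastic integrals up to null sets, so that
  law and independence are read off from limits of sums along paths.

  The power t^-gamma compares drift and noise: coordinate n of the noise is stable with scale beta_n
  ((1 - exp(-alpha gamma_n t)) / (alpha gamma_n))^(1/alpha), and the lower bound on beta_n makes
  exp(-gamma_n t) divided by this scale at most c t^-gamma for all n. The factor s^-gamma in the
  time integral is the growth of Du(s) inside the Hamiltonian, and gamma + gamma theta < 1 is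
  integrability at s = t.\<close>

lemma orthonormal_basisD:
  assumes "orthonormal_basis e"
  shows "e m \<bullet> e n = (if m = n then 1 else 0)" "closure (span (range e)) = UNIV"
  using assms unfolding orthonormal_basis_def by auto

definition basis_proj :: "(nat \<Rightarrow> 'h::real_inner) \<Rightarrow> nat \<Rightarrow> 'h \<Rightarrow> 'h" where
  "basis_proj e N x = (\<Sum>n<N. (x \<bullet> e n) *\<^sub>R e n)"

lemma norm_sum_orthonormal:
  assumes "orthonormal_basis e" "finite I"
  shows "(norm (\<Sum>n\<in>I. c n *\<^sub>R e n))\<^sup>2 = (\<Sum>n\<in>I. (c n)\<^sup>2)"
proof -
  have "(norm (\<Sum>n\<in>I. c n *\<^sub>R e n))\<^sup>2 = (\<Sum>n\<in>I. \<Sum>m\<in>I. if m = n then c n * c m else 0)"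
    unfolding power2_norm_eq_inner inner_sum_left inner_sum_right
    by (intro sum.cong refl) (auto simp: orthonormal_basisD[OF assms(1)])
  then show ?thesis using assms(2) by (simp add: power2_eq_square)
qed

lemma bessel_inequality:
  assumes "orthonormal_basis e"
  shows "(\<Sum>n<N. (x \<bullet> e n)\<^sup>2) \<le> (norm x)\<^sup>2"
proof -
  let ?p = "basis_proj e N x"
  have n: "(norm ?p)\<^sup>2 = (\<Sum>n<N. (x \<bullet> e n)\<^sup>2)"
    unfolding basis_proj_def by (rule norm_sum_orthonormal[OF assms]) simp
  have "x \<bullet> ?p = (\<Sum>n<N. (x \<bullet> e n)\<^sup>2)"
    unfolding basis_proj_def by (simp add: inner_sum_right power2_eq_square)
  with n have "(norm (x - ?p))\<^sup>2 = (norm x)\<^sup>2 - (\<Sum>n<N. (x \<bullet> e n)\<^sup>2)"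
    by (simp add: power2_norm_eq_inner inner_diff inner_commute)
  then show ?thesis by (smt (verit) zero_le_power2)
qed

lemma norm_basis_proj_le:
  assumes "orthonormal_basis e"
  shows "norm (basis_proj e N x) \<le> norm x"
  using bessel_inequality[OF assms, where N=N and x=x] norm_sum_orthonormal[OF assms, of "{..<N}" "\<lambda>n. x \<bullet> e n"]
  unfolding basis_proj_def by (simp add: power2_le_imp_le)

lemma basis_proj_diff: "basis_proj e N (x - y) = basis_proj e N x - basis_proj e N y"
  unfolding basis_proj_def by (simp add: inner_diff_left scaleR_diff_left sum_subtractf)

lemma basis_proj_eventually_id:
  assumes "orthonormal_basis e" "y \<in> span (range e)"
  shows "\<forall>\<^sub>F N in sequentially. basis_proj e N y = y"
  using assms(2)
proof (induction rule: span_induct_alt)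
  case base
  then show ?case by (simp add: basis_proj_def)
next
  case (step c x y)
  then obtain m where m: "x = e m" by auto
  have "\<forall>\<^sub>F N in sequentially. m < N" by (rule eventually_gt_at_top)
  with step(2) show ?case
  proof eventually_elim
    case (elim N)
    have "basis_proj e N (c *\<^sub>R x + y) = c *\<^sub>R basis_proj e N x + basis_proj e N y"
      unfolding basis_proj_def
      by (simp add: inner_add_left scaleR_add_left sum.distrib scaleR_sum_right)
    moreover have "basis_proj e N x = x"
    proof -
      have "basis_proj e N x = (\<Sum>n<N. if n = m then e n else 0)"
        unfolding basis_proj_def m by (intro sum.cong refl) (auto simp: orthonormal_basisD[OF assms(1)])
      then show ?thesis using elim(2) m by simp
    qed
    ultimately show ?case using elim by simp
  qed
qed

lemma basis_proj_tendsto: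
  assumes "orthonormal_basis e"
  shows "(\<lambda>N. basis_proj e N x) \<longlonglongrightarrow> x"
proof (rule LIMSEQ_I)
  fix r :: real assume "r > 0"
  have "x \<in> closure (span (range e))" using orthonormal_basisD[OF assms] by simp
  then obtain y where y: "y \<in> span (range e)" "dist y x < r / 2"
    unfolding closure_approachable using \<open>r > 0\<close> by (meson half_gt_zero)
  obtain N0 where N0: "\<And>N. N \<ge> N0 \<Longrightarrow> basis_proj e N y = y"
    using basis_proj_eventually_id[OF assms y(1)] unfolding eventually_sequentially by auto
  have "norm (basis_proj e N x - x) < r" if "N \<ge> N0" for N
  proof -
    have "basis_proj e N x - x = basis_proj e N (x - y) + (y - x)"
      by (simp add: basis_proj_diff N0[OF that])
    also have "norm \<dots> \<le> norm (x - y) + norm (y - x)"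
      by (rule norm_triangle_le) (simp add: norm_basis_proj_le[OF assms])
    also have "\<dots> < r" using y(2) by (simp add: dist_norm norm_minus_commute)
    finally show ?thesis .
  qed
  then show "\<exists>no. \<forall>n\<ge>no. norm (basis_proj e n x - x) < r" by blast
qed

lemma orthonormal_basis_eqI:
  assumes "orthonormal_basis e" "\<And>n. x \<bullet> e n = y \<bullet> e n"
  shows "x = y"
proof -
  have "basis_proj e N x = basis_proj e N y" for N
    unfolding basis_proj_def assms(2) ..
  then show ?thesis
    using basis_proj_tendsto[OF assms(1)] LIMSEQ_unique by (metis (no_types, lifting) ext)
qed

lemma summable_orthonormal:
  fixes e :: "nat \<Rightarrow> 'h::{real_inner, complete_space}"
  assumes "orthonormal_basis e" "summable (\<lambda>n. (c n)\<^sup>2)"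
  shows "summable (\<lambda>n. c n *\<^sub>R e n)"
proof -
  let ?s = "\<lambda>N. \<Sum>n<N. c n *\<^sub>R e n"
  have "Cauchy ?s"
  proof (rule metric_CauchyI)
    fix r :: real assume r: "r > 0"
    from assms(2) have "Cauchy (\<lambda>N. \<Sum>n<N. (c n)\<^sup>2)"
      by (simp add: summable_iff_convergent convergent_Cauchy)
    from metric_CauchyD[OF this, of "r\<^sup>2"] r obtain M where
      M: "\<And>m n. m \<ge> M \<Longrightarrow> n \<ge> M \<Longrightarrow> \<bar>(\<Sum>n<m. (c n)\<^sup>2) - (\<Sum>n<n. (c n)\<^sup>2)\<bar> < r\<^sup>2"
      by (auto simp: dist_real_def)
    have *: "dist (?s m) (?s n) < r" if "M \<le> m" "m \<le> n" for m n
    proof -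
      have "?s n - ?s m = (\<Sum>k\<in>{m..<n}. c k *\<^sub>R e k)"
        by (metis lessThan_atLeast0 sum_diff_nat_ivl that(2) zero_le)
      then have "(dist (?s m) (?s n))\<^sup>2 = (\<Sum>k\<in>{m..<n}. (c k)\<^sup>2)"
        using norm_sum_orthonormal[OF assms(1), of "{m..<n}" c]
        by (subst dist_commute) (simp add: dist_norm)
      also have "\<dots> = (\<Sum>n<n. (c n)\<^sup>2) - (\<Sum>n<m. (c n)\<^sup>2)"
        by (metis lessThan_atLeast0 sum_diff_nat_ivl that(2) zero_le)
      also have "\<dots> < r\<^sup>2" using M[of n m] that by auto
      finally show ?thesis using r by (simp add: power2_less_imp_less)
    qed
    show "\<exists>M. \<forall>m\<ge>M. \<forall>n\<ge>M. dist (?s m) (?s n) < r"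
      using * by (metis dist_commute nle_le)
  qed
  then show ?thesis
    by (simp add: summable_iff_convergent Cauchy_convergent)
qed

section \<open>The semigroup on the eigenvectors of its generator\<close>

lemma C0_semigroupD:
  assumes "C0_semigroup S"
  shows "0 \<le> t \<Longrightarrow> bounded_linear (S t)" "S 0 x = x"
    "0 \<le> s \<Longrightarrow> 0 \<le> t \<Longrightarrow> S (s + t) x = S s (S t x)"
    "((\<lambda>t. S t x) \<longlongrightarrow> x) (at_right 0)"
  using assms unfolding C0_semigroup_def by auto

lemma C0_semigroup_funpow:
  assumes "C0_semigroup S" "0 \<le> s"
  shows "S (real k * s) x = (S s ^^ k) x"
proof (induction k)
  case (Suc k)
  have "S (real (Suc k) * s) x = S (s + real k * s) x" by (simp add: algebra_simps)
  then show ?case using Suc C0_semigroupD(3)[OF assms(1), of s "real k * s"] assms(2) by simp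
qed (simp add: C0_semigroupD(2)[OF assms(1)])

text \<open>\<open>S t\<close> is bounded and commutes with the difference quotients of
  \<open>S\<close> at 0, so it maps the limit defining \<open>A v\<close> to the one defining
  \<open>A (S t v)\<close>. This keeps orbits of eigenvectors inside the eigenspace, where the
  semigroup will be shown to be bounded near 0.\<close>

lemma eigenspace_semigroup:
  assumes gen: "semigroup_generated_by S D A" and sa: "self_adjoint_operator D A"
    and v: "v \<in> D" "A v = c *\<^sub>R v" and t: "0 \<le> t"
  shows "S t v \<in> D" "A (S t v) = c *\<^sub>R S t v"
proof -
  have C0: "C0_semigroup S" and D: "D = {x. \<exists>y. ((\<lambda>t. (S t x - x) /\<^sub>R t) \<longlongrightarrow> y) (at_right 0)}"
    and lim: "\<And>x. x \<in> D \<Longrightarrow> ((\<lambda>t. (S t x - x) /\<^sub>R t) \<longlongrightarrow> A x) (at_right 0)"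
    using gen unfolding semigroup_generated_by_def by auto
  interpret St: bounded_linear "S t" by (rule C0_semigroupD(1)[OF C0 t])
  have "((\<lambda>h. S t ((S h v - v) /\<^sub>R h)) \<longlongrightarrow> S t (A v)) (at_right 0)"
    by (rule St.tendsto[OF lim[OF v(1)]])
  moreover have "\<forall>\<^sub>F h in at_right 0. S t ((S h v - v) /\<^sub>R h) = (S h (S t v) - S t v) /\<^sub>R h"
  proof -
    have "S t ((S h v - v) /\<^sub>R h) = (S h (S t v) - S t v) /\<^sub>R h" if "h > 0" for h
      using C0_semigroupD(3)[OF C0, of h t v] C0_semigroupD(3)[OF C0, of t h v] that t
      by (simp add: St.scale St.diff add.commute)
    then show ?thesis by (auto simp: eventually_at_filter)
  qed
  ultimately have *: "((\<lambda>h. (S h (S t v) - S t v) /\<^sub>R h) \<longlongrightarrow> S t (A v)) (at_right 0)"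
    by (simp add: filterlim_cong)
  then show 1: "S t v \<in> D" unfolding D by blast
  have "A (S t v) = S t (A v)"
    by (rule tendsto_unique[OF _ lim[OF 1] *]) simp
  then show "A (S t v) = c *\<^sub>R S t v" by (simp add: v(2) St.scale)
qed

locale diagonal_semigroup =
  fixes e :: "nat \<Rightarrow> 'h::real_inner" and D A S and \<gamma> :: "nat \<Rightarrow> real"
  assumes basis: "orthonormal_basis e"
    and sa: "self_adjoint_operator D A"
    and eD: "range e \<subseteq> D"
    and lim: "filterlim \<gamma> at_top sequentially"
    and eig: "\<And>n. A (e n) = - \<gamma> n *\<^sub>R e n"
    and gen: "semigroup_generated_by S D A"
begin

lemma C0: "C0_semigroup S"
  using gen unfolding semigroup_generated_by_def by auto

lemma finite_level: "finite {m. \<gamma> m = c}"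
proof -
  obtain N where "\<And>m. m \<ge> N \<Longrightarrow> c + 1 \<le> \<gamma> m"
    using lim unfolding filterlim_at_top eventually_sequentially by meson
  then have "{m. \<gamma> m = c} \<subseteq> {..<N}"
    by (smt (verit) lessThan_iff linorder_not_less mem_Collect_eq subsetI)
  then show ?thesis by (rule finite_subset) simp
qed

text \<open>Symmetry of \<open>A\<close> makes \<open>v\<close> orthogonal to every
  \<open>e n\<close> with another eigenvalue. Together with \<open>finite_level\<close> this shows
  the eigenspace to be finite-dimensional.\<close>

lemma eigenvector_expansion:
  assumes "v \<in> D" "A v = - c *\<^sub>R v"
  shows "v = (\<Sum>m\<in>{m. \<gamma> m = c}. (v \<bullet> e m) *\<^sub>R e m)"
proof (rule orthonormal_basis_eqI[OF basis])
  fix n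
  have "- c * (v \<bullet> e n) = A v \<bullet> e n" using assms by simp
  also have "\<dots> = v \<bullet> A (e n)"
    using sa assms(1) eD unfolding self_adjoint_operator_def by blast
  also have "\<dots> = - \<gamma> n * (v \<bullet> e n)" by (simp add: eig)
  finally have *: "\<gamma> n = c \<or> v \<bullet> e n = 0" by auto
  have "(\<Sum>m\<in>{m. \<gamma> m = c}. (v \<bullet> e m) *\<^sub>R e m) \<bullet> e n
      = (\<Sum>m\<in>{m. \<gamma> m = c}. if m = n then v \<bullet> e n else 0)"
    unfolding inner_sum_left by (intro sum.cong refl) (auto simp: orthonormal_basisD[OF basis])
  then show "v \<bullet> e n = (\<Sum>m\<in>{m. \<gamma> m = c}. (v \<bullet> e m) *\<^sub>R e m) \<bullet> e n"
    using * finite_level[of c] by auto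
qed

text \<open>Local boundedness of the semigroup near \<open>0\<close> is only needed on the eigenspaces of \<open>A\<close>, which
  have finite dimension because \<open>\<gamma> n \<longrightarrow> \<infinity>\<close>; this replaces the uniform boundedness principle.\<close>

lemma eigenspace_bounded:
  obtains \<delta> K where "0 < \<delta>" "0 < K"
    "\<And>v s. v \<in> D \<Longrightarrow> A v = - c *\<^sub>R v \<Longrightarrow> 0 \<le> s \<Longrightarrow> s \<le> \<delta> \<Longrightarrow> norm (S s v) \<le> K * norm v"
proof -
  let ?F = "{m. \<gamma> m = c}"
  have "\<forall>\<^sub>F s in at_right 0. \<forall>m\<in>?F. norm (S s (e m)) < 2"
  proof (rule eventually_ball_finite[OF finite_level], rule ballI)
    fix m
    have "((\<lambda>t. norm (S t (e m))) \<longlongrightarrow> norm (e m)) (at_right 0)"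
      by (intro tendsto_norm C0_semigroupD(4)[OF C0])
    moreover have "norm (e m) = 1" by (simp add: norm_eq_sqrt_inner orthonormal_basisD[OF basis])
    ultimately show "\<forall>\<^sub>F s in at_right 0. norm (S s (e m)) < 2"
      by (intro order_tendstoD(2)) auto
  qed
  then obtain b where b: "b > 0" "\<And>s. 0 < s \<Longrightarrow> s < b \<Longrightarrow> \<forall>m\<in>?F. norm (S s (e m)) < 2"
    unfolding eventually_at_right_field by auto
  \<comment> \<open>2 bounds each \<open>S s (e m)\<close>; the summand 1 handles
    \<open>s = 0\<close> and keeps the constant positive when \<open>?F\<close> is empty.\<close>
  have "norm (S s v) \<le> (1 + 2 * real (card ?F)) * norm v"
    if v: "v \<in> D" "A v = - c *\<^sub>R v" and s: "0 \<le> s" "s \<le> b / 2" for v s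
  proof (cases "s = 0")
    case True
    have "norm v \<le> (1 + 2 * real (card ?F)) * norm v" by (simp add: algebra_simps)
    then show ?thesis using True C0_semigroupD(2)[OF C0] by simp
  next
    case False
    interpret bounded_linear "S s" by (rule C0_semigroupD(1)[OF C0 s(1)])
    have "S s v = S s (\<Sum>m\<in>?F. (v \<bullet> e m) *\<^sub>R e m)"
      using eigenvector_expansion[OF v] by simp
    also have "\<dots> = (\<Sum>m\<in>?F. (v \<bullet> e m) *\<^sub>R S s (e m))"
      by (simp add: sum scale)
    also have "norm \<dots> \<le> (\<Sum>m\<in>?F. 2 * norm v)"
    proof (rule sum_norm_le)
      fix m assume m: "m \<in> ?F"
      have "\<bar>v \<bullet> e m\<bar> \<le> norm v" using Cauchy_Schwarz_ineq2[of v "e m"]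
        by (simp add: norm_eq_sqrt_inner orthonormal_basisD[OF basis])
      moreover have "norm (S s (e m)) \<le> 2" using b(2)[of s] s False b(1) m by (auto intro: less_imp_le)
      ultimately have "\<bar>v \<bullet> e m\<bar> * norm (S s (e m)) \<le> norm v * 2"
        by (intro mult_mono) auto
      then show "norm ((v \<bullet> e m) *\<^sub>R S s (e m)) \<le> 2 * norm v" by simp
    qed
    also have "\<dots> \<le> (1 + 2 * real (card ?F)) * norm v" by (simp add: algebra_simps)
    finally show ?thesis .
  qed
  then show ?thesis using that[of "b / 2" "1 + 2 * real (card ?F)"] b(1) by auto
qed

text \<open>Only a right derivative at 0 is known. With \<open>r s = exp (c s) S s v - v\<close>, a
  step of length \<open>s\<close> from \<open>k s\<close> adds
  \<open>exp (c k s) S (k s) (r s)\<close>, so \<open>N\<close> steps of length \<open>t / N\<close>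
  bound \<open>norm (r t)\<close> by a constant times \<open>N * norm (r (t / N))\<close>, and
  \<open>r s / s\<close> tends to 0. The restriction to \<open>t \<le> \<delta>\<close> is that of
  \<open>eigenspace_bounded\<close>.\<close>

lemma semigroup_basis_local:
  obtains \<delta> where "0 < \<delta>" "\<And>t. 0 \<le> t \<Longrightarrow> t \<le> \<delta> \<Longrightarrow> S t (e n) = exp (- \<gamma> n * t) *\<^sub>R e n"
proof -
  let ?c = "\<gamma> n" and ?v = "e n"
  obtain \<delta> K where d: "0 < \<delta>" "0 < K"
    and K: "\<And>v s. v \<in> D \<Longrightarrow> A v = - ?c *\<^sub>R v \<Longrightarrow> 0 \<le> s \<Longrightarrow> s \<le> \<delta> \<Longrightarrow> norm (S s v) \<le> K * norm v"
    using eigenspace_bounded by blast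
  have vD: "?v \<in> D" and Av: "A ?v = - ?c *\<^sub>R ?v" using eD eig by auto
  have deriv: "((\<lambda>t. (S t ?v - ?v) /\<^sub>R t) \<longlongrightarrow> - ?c *\<^sub>R ?v) (at_right 0)"
    using gen vD Av unfolding semigroup_generated_by_def by metis
  have subD: "\<And>a x. x \<in> D \<Longrightarrow> a *\<^sub>R x \<in> D" "\<And>x y. x \<in> D \<Longrightarrow> y \<in> D \<Longrightarrow> x - y \<in> D"
    using sa unfolding self_adjoint_operator_def by (auto simp: subspace_scale subspace_diff)
  have linA: "\<And>a x. x \<in> D \<Longrightarrow> A (a *\<^sub>R x) = a *\<^sub>R A x"
    "\<And>x y. x \<in> D \<Longrightarrow> y \<in> D \<Longrightarrow> A (x + y) = A x + A y"
    using sa unfolding self_adjoint_operator_def by auto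
  have eq: "S t ?v = exp (- ?c * t) *\<^sub>R ?v" if t: "0 < t" "t \<le> \<delta>" for t
  proof -
    define E where "E s = exp (?c * s)" for s
    define r where "r s = E s *\<^sub>R S s ?v - ?v" for s
    have bound: "norm (r t) \<le> real N * (exp (\<bar>?c\<bar> * t) * K * norm (r (t / real N)))" if N: "N > 0" for N
    proof -
      define s where "s = t / real N"
      have s: "0 < s" "real N * s = t" using N t by (auto simp: s_def)
      \<comment> \<open>\<open>r s\<close> lies in the eigenspace again, so the bound
        \<open>K\<close> for \<open>S (k s)\<close> applies to it below.\<close>
      have rD: "r s \<in> D" and Ar: "A (r s) = - ?c *\<^sub>R r s"
      proof -
        have 1: "S s ?v \<in> D" "A (S s ?v) = - ?c *\<^sub>R S s ?v"
          using eigenspace_semigroup[OF gen sa vD, of "- ?c" s] Av s(1) by auto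
        then show "r s \<in> D" unfolding r_def using subD vD by blast
        have "A (r s) = A (E s *\<^sub>R S s ?v + (- 1) *\<^sub>R ?v)" unfolding r_def by simp
        also have "\<dots> = E s *\<^sub>R A (S s ?v) + (- 1) *\<^sub>R A ?v"
          using 1 vD subD linA by metis
        finally show "A (r s) = - ?c *\<^sub>R r s"
          unfolding 1(2) Av r_def by (simp add: scaleR_right_diff_distrib algebra_simps)
      qed
      have "norm (r (real k * s)) \<le> real k * (exp (\<bar>?c\<bar> * t) * K * norm (r s))" if "k \<le> N" for k
        using that
      proof (induction k)
        case 0
        then show ?case by (simp add: r_def E_def C0_semigroupD(2)[OF C0])
      next
        case (Suc k)
        have ks: "0 \<le> real k * s" "real k * s \<le> t"
          using s Suc.prems by (auto intro!: mult_nonneg_nonneg simp flip: s(2))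
        interpret bounded_linear "S (real k * s)" by (rule C0_semigroupD(1)[OF C0 ks(1)])
        have "r (real (Suc k) * s) = E (real k * s) *\<^sub>R S (real k * s) (r s) + r (real k * s)"
        proof -
          have "S (real (Suc k) * s) ?v = S (real k * s) (S s ?v)"
            using C0_semigroupD(3)[OF C0, of "real k * s" s ?v] ks s by (simp add: algebra_simps)
          moreover have "E (real (Suc k) * s) = E (real k * s) * E s"
            by (simp add: E_def algebra_simps flip: exp_add)
          ultimately show ?thesis unfolding r_def by (simp add: diff scale scaleR_diff_right)
        qed
        also have "norm \<dots> \<le> E (real k * s) * (K * norm (r s)) + norm (r (real k * s))"
          using K[OF rD Ar ks(1)] ks(2) t(2)
          by (intro norm_triangle_le add_mono) (auto simp: E_def)
        also have "E (real k * s) * (K * norm (r s)) \<le> exp (\<bar>?c\<bar> * t) * (K * norm (r s))"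
        proof (rule mult_right_mono)
          have "?c * (real k * s) \<le> \<bar>?c\<bar> * t" using ks by (intro mult_mono) auto
          then show "E (real k * s) \<le> exp (\<bar>?c\<bar> * t)" by (simp add: E_def)
        qed (use d in auto)
        finally show ?case using Suc by (simp add: algebra_simps)
      qed
      from this[of N] show ?thesis using s by (simp add: s_def)
    qed
    have lim_r: "((\<lambda>s. norm (r s) / s) \<longlongrightarrow> 0) (at_right 0)"
    proof -
      \<comment> \<open>\<open>r s / s\<close> split as in the product rule; the two limits
        \<open>- c v\<close> and \<open>c v\<close> cancel.\<close>
      have "((\<lambda>s. E s *\<^sub>R ((S s ?v - ?v) /\<^sub>R s) + ((E s - 1) / s) *\<^sub>R ?v) \<longlongrightarrow> 1 *\<^sub>R (- ?c *\<^sub>R ?v) + ?c *\<^sub>R ?v) (at_right 0)"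
      proof (intro tendsto_add tendsto_scaleR[OF _ deriv] tendsto_scaleR[OF _ tendsto_const])
        have "((\<lambda>s. exp (?c * s)) \<longlongrightarrow> exp (?c * 0)) (at_right 0)" by (intro tendsto_intros)
        then show "(E \<longlongrightarrow> 1) (at_right 0)" unfolding E_def by simp
        have "((\<lambda>s. exp (?c * s)) has_real_derivative ?c * exp (?c * 0)) (at 0)"
          by (auto intro!: derivative_eq_intros)
        then show "((\<lambda>s. (E s - 1) / s) \<longlongrightarrow> ?c) (at_right 0)"
          unfolding has_field_derivative_iff E_def
          by (auto intro: filterlim_mono[OF _ order_refl at_le])
      qed
      then have "((\<lambda>s. norm (E s *\<^sub>R ((S s ?v - ?v) /\<^sub>R s) + ((E s - 1) / s) *\<^sub>R ?v)) \<longlongrightarrow> 0) (at_right 0)"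
        by (intro tendsto_norm_zero) simp
      moreover have "\<forall>\<^sub>F s in at_right 0. norm (E s *\<^sub>R ((S s ?v - ?v) /\<^sub>R s) + ((E s - 1) / s) *\<^sub>R ?v) = norm (r s) / s"
      proof -
        have "norm (E s *\<^sub>R ((S s ?v - ?v) /\<^sub>R s) + ((E s - 1) / s) *\<^sub>R ?v) = norm (r s) / s" if "s > 0" for s
        proof -
          have "E s *\<^sub>R ((S s ?v - ?v) /\<^sub>R s) + ((E s - 1) / s) *\<^sub>R ?v = (1 / s) *\<^sub>R r s"
            unfolding r_def by (simp add: algebra_simps divide_inverse)
          then show ?thesis using that by simp
        qed
        then show ?thesis by (auto simp: eventually_at_filter)
      qed
      ultimately show ?thesis by (simp add: filterlim_cong)
    qed
    have "filterlim (\<lambda>N. t / real (Suc N)) (at_right 0) sequentially"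
      using t unfolding filterlim_at by (auto intro!: tendsto_divide_0[OF tendsto_const] filterlim_compose[OF filterlim_real_sequentially filterlim_Suc]
        filterlim_at_top_imp_at_infinity simp del: of_nat_Suc)
    from filterlim_compose[OF lim_r this]
    have "(\<lambda>N. exp (\<bar>?c\<bar> * t) * K * t * (norm (r (t / real (Suc N))) / (t / real (Suc N)))) \<longlonglongrightarrow> exp (\<bar>?c\<bar> * t) * K * t * 0"
      by (intro tendsto_mult tendsto_const)
    moreover have "norm (r t) \<le> exp (\<bar>?c\<bar> * t) * K * t * (norm (r (t / real (Suc N))) / (t / real (Suc N)))" for N
      using bound[of "Suc N"] t by (simp add: field_simps del: of_nat_Suc)
    ultimately have "norm (r t) \<le> exp (\<bar>?c\<bar> * t) * K * t * 0"
      by (intro LIMSEQ_le_const) auto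
    then have "E t *\<^sub>R S t ?v = ?v" by (simp add: r_def)
    then have "exp (- ?c * t) *\<^sub>R ?v = (exp (- ?c * t) * E t) *\<^sub>R S t ?v" by (metis scaleR_scaleR)
    then show ?thesis by (simp add: E_def flip: exp_add)
  qed
  show ?thesis
    using that[of \<delta>] eq d(1) C0_semigroupD(2)[OF C0]
    by (metis exp_zero less_eq_real_def mult_zero_right scaleR_one)
qed

text \<open>Composing \<open>N\<close> steps of length \<open>t / N \<le> \<delta>\<close> extends
  the local formula to all times.\<close>

lemma semigroup_basis:
  assumes "0 \<le> t"
  shows "S t (e n) = exp (- \<gamma> n * t) *\<^sub>R e n"
proof -
  obtain \<delta> where d: "0 < \<delta>" "\<And>t. 0 \<le> t \<Longrightarrow> t \<le> \<delta> \<Longrightarrow> S t (e n) = exp (- \<gamma> n * t) *\<^sub>R e n"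
    using semigroup_basis_local by blast
  obtain N :: nat where N: "t / \<delta> < real N" using reals_Archimedean2 by blast
  then have N0: "N > 0" using assms d(1) by (cases N) (auto simp: field_simps)
  let ?s = "t / real N"
  have s: "0 \<le> ?s" "?s \<le> \<delta>" using N N0 assms d(1) by (auto simp: field_simps)
  interpret bounded_linear "S ?s" by (rule C0_semigroupD(1)[OF C0 s(1)])
  have "(S ?s ^^ k) (e n) = exp (- \<gamma> n * (real k * ?s)) *\<^sub>R e n" for k
    by (induction k) (auto simp: scale d(2)[OF s] algebra_simps add_divide_distrib diff_divide_distrib simp flip: exp_add)
  from this[of N] show ?thesis
    using C0_semigroup_funpow[OF C0 s(1), of N "e n"] N0 by simp
qed

text \<open>The formula passes from the basis to all of the space by continuity of
  \<open>S t\<close> along the projections; this decay of coordinates is how \<open>A\<close> enters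
  the smoothing estimate.\<close>

lemma inner_semigroup:
  assumes "0 \<le> t"
  shows "S t x \<bullet> e n = exp (- \<gamma> n * t) * (x \<bullet> e n)"
proof -
  interpret bounded_linear "S t" by (rule C0_semigroupD(1)[OF C0 assms])
  have "(\<lambda>N. S t (basis_proj e N x) \<bullet> e n) \<longlonglongrightarrow> S t x \<bullet> e n"
    by (intro tendsto_inner tendsto basis_proj_tendsto[OF basis] tendsto_const)
  moreover have "S t (basis_proj e N x) \<bullet> e n = exp (- \<gamma> n * t) * (basis_proj e N x \<bullet> e n)" for N
  proof -
    have "S t (basis_proj e N x) \<bullet> e n = (\<Sum>m<N. (x \<bullet> e m) * (exp (- \<gamma> m * t) * (e m \<bullet> e n)))"
      unfolding basis_proj_def by (simp add: sum scale semigroup_basis[OF assms] inner_sum_left mult.assoc)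
    also have "\<dots> = exp (- \<gamma> n * t) * (\<Sum>m<N. (x \<bullet> e m) * (e m \<bullet> e n))"
      unfolding sum_distrib_left by (intro sum.cong) (auto simp: orthonormal_basisD[OF basis])
    finally show ?thesis unfolding basis_proj_def by (simp add: inner_sum_left)
  qed
  moreover have "(\<lambda>N. exp (- \<gamma> n * t) * (basis_proj e N x \<bullet> e n)) \<longlonglongrightarrow> exp (- \<gamma> n * t) * (x \<bullet> e n)"
    by (intro tendsto_intros basis_proj_tendsto[OF basis])
  ultimately show ?thesis by (simp add: LIMSEQ_unique)
qed

end

section \<open>The Laplace factor of a stable law\<close>

lemma has_bochner_integral_of_has_integral:
  fixes f :: "real \<Rightarrow> real"
  assumes "(\<lambda>x. indicator A x * f x) \<in> borel_measurable borel" "\<And>x. x \<in> A \<Longrightarrow> 0 \<le> f x" "(f has_integral I) A"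
  shows "has_bochner_integral lborel (\<lambda>x. indicator A x * f x) I"
proof -
  have hi: "((\<lambda>x. indicator A x * f x) has_integral I) UNIV"
  proof -
    have "(\<lambda>x. indicator A x * f x) = (\<lambda>x. if x \<in> A then f x else 0)" by (auto simp: indicator_def)
    then show ?thesis using has_integral_restrict_UNIV[of A f I] assms(3) by simp
  qed
  have nn: "\<And>x. 0 \<le> indicator A x * f x" using assms(2) by (auto simp: indicator_def)
  have "I \<ge> 0" using has_integral_nonneg[OF assms(3)] assms(2) by auto
  moreover have "(\<integral>\<^sup>+x. ennreal (indicator A x * f x) \<partial>lborel) = ennreal I"
    by (rule nn_integral_has_integral_lborel[OF assms(1) nn hi])
  ultimately show ?thesis
    using assms(1) nn by (intro has_bochner_integral_nn_integral) auto
qed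

definition laplace :: "real measure" where
  "laplace = density lborel (\<lambda>x. ennreal (exp (- \<bar>x\<bar>) / 2))"

lemma sets_laplace[simp, measurable_cong]: "sets laplace = sets borel" and space_laplace[simp]: "space laplace = UNIV"
  by (simp_all add: laplace_def)

lemma has_bochner_integral_exp_cos:
  fixes \<xi> :: real
  shows
  "has_bochner_integral lborel (\<lambda>x. indicator {0..} x * (exp (- x) * cos (\<xi> * x))) (1 / (1 + \<xi>\<^sup>2))"
proof -
  have e: "has_bochner_integral lborel (\<lambda>x::real. indicator {0..} x * exp (- x)) 1"
  proof (rule has_bochner_integral_of_has_integral)
    show "((\<lambda>x::real. exp (- x)) has_integral 1) {0..}"
      using has_integral_exp_minus_to_infinity[of 1 0] by simp
  qed auto
  have int: "set_integrable lborel {0..} (\<lambda>x. exp (- x) * cos (\<xi> * x))"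
    unfolding set_integrable_def
    by (rule Bochner_Integration.integrable_bound[OF integrable.intros[OF e]])
      (auto simp: indicator_def abs_mult)
  \<comment> \<open>The real part of \<open>exp ((-1 + i \<xi>) x) / (-1 + i \<xi>)\<close>.\<close>
  define F where "F x = exp (- x) * (\<xi> * sin (\<xi> * x) - cos (\<xi> * x)) / (1 + \<xi>\<^sup>2)" for x :: real
  have D: "(F has_real_derivative exp (- x) * cos (\<xi> * x)) (at x)" for x
  proof -
    have nz: "1 + \<xi>\<^sup>2 \<noteq> 0" by (metis add_pos_nonneg less_irrefl zero_le_power2 zero_less_one)
    have "((\<lambda>x. exp (- x) * (\<xi> * sin (\<xi> * x) - cos (\<xi> * x))) has_real_derivative
        (1 + \<xi>\<^sup>2) * (exp (- x) * cos (\<xi> * x))) (at x)"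
      by (auto intro!: derivative_eq_intros simp: algebra_simps power2_eq_square)
    from DERIV_cdivide[OF this, of "1 + \<xi>\<^sup>2"] show ?thesis
      unfolding F_def using nz by simp
  qed
  have "(LBINT x=0..\<infinity>. exp (- x) * cos (\<xi> * x)) = 0 - F 0"
  proof (rule interval_integral_FTC_integrable)
    show "(F has_vector_derivative exp (- x) * cos (\<xi> * x)) (at x)" for x
      using D by (simp add: has_real_derivative_iff_has_vector_derivative)
    show "set_integrable lborel (einterval 0 \<infinity>) (\<lambda>x. exp (- x) * cos (\<xi> * x))"
      by (rule set_integrable_subset[OF int]) (auto simp: einterval_def)
    have "isCont F 0" using D DERIV_isCont by blast
    then show "((F \<circ> real_of_ereal) \<longlongrightarrow> F 0) (at_right 0)"
      by (simp add: zero_ereal_def ereal_tendsto_simps1 isCont_def filterlim_at_split)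
    have "((\<lambda>x. exp (- x) * ((\<bar>\<xi>\<bar> + 1) / (1 + \<xi>\<^sup>2))) \<longlongrightarrow> 0 * ((\<bar>\<xi>\<bar> + 1) / (1 + \<xi>\<^sup>2))) at_top"
      by (intro tendsto_mult tendsto_const filterlim_compose[OF exp_at_bot] filterlim_uminus_at_bot_at_top)
    moreover have bnd: "norm (F x) \<le> exp (- x) * ((\<bar>\<xi>\<bar> + 1) / (1 + \<xi>\<^sup>2))" for x
    proof -
      have "\<bar>\<xi> * sin (\<xi> * x) - cos (\<xi> * x)\<bar> \<le> \<bar>\<xi>\<bar> * \<bar>sin (\<xi> * x)\<bar> + \<bar>cos (\<xi> * x)\<bar>"
        by (metis abs_mult abs_triangle_ineq4)
      also have "\<dots> \<le> \<bar>\<xi>\<bar> + 1"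
        by (intro add_mono mult_left_le) auto
      finally show ?thesis unfolding F_def
        by (simp add: abs_mult divide_right_mono abs_of_nonneg)
    qed
    ultimately have "(F \<longlongrightarrow> 0) at_top"
      by (intro Lim_null_comparison[OF always_eventually[OF allI[OF bnd]]]) simp
    then show "((F \<circ> real_of_ereal) \<longlongrightarrow> 0) (at_left \<infinity>)"
      by (simp add: ereal_tendsto_simps1)
    show "isCont (\<lambda>x. exp (- x) * cos (\<xi> * x)) x" for x by simp
  qed simp
  then have "(LBINT x:{0<..}. exp (- x) * cos (\<xi> * x)) = 1 / (1 + \<xi>\<^sup>2)"
    unfolding zero_ereal_def interval_integral_to_infinity_eq by (simp add: F_def)
  moreover have "(LBINT x:{0..}. exp (- x) * cos (\<xi> * x)) = (LBINT x:{0<..}. exp (- x) * cos (\<xi> * x))"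
    unfolding set_lebesgue_integral_def
  proof (rule integral_cong_AE)
    show "AE x in lborel. indicator {0..} x *\<^sub>R (exp (- x) * cos (\<xi> * x)) = indicator {0<..} x *\<^sub>R (exp (- x) * cos (\<xi> * x))"
      using AE_lborel_singleton[of "0::real"] by eventually_elim (simp add: indicator_def)
  qed auto
  ultimately have "(LBINT x:{0..}. exp (- x) * cos (\<xi> * x)) = 1 / (1 + \<xi>\<^sup>2)" by simp
  then show ?thesis
    using int unfolding has_bochner_integral_iff set_integrable_def set_lebesgue_integral_def by simp
qed

lemma prob_space_laplace: "prob_space laplace"
  and char_laplace: "char laplace \<xi> = of_real (1 / (1 + \<xi>\<^sup>2))"
proof -
  \<comment> \<open>Stated for every frequency: the instance at 0 is the total mass and also
    dominates the oscillating integrands below.\<close>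
  have c: "has_bochner_integral lborel (\<lambda>x. exp (- \<bar>x\<bar>) / 2 * cos (\<xi> * x)) (1 / (1 + \<xi>\<^sup>2))" for \<xi> :: real
  proof -
    have "has_bochner_integral lborel (\<lambda>x. exp (- \<bar>x\<bar>) / 2 * cos (\<xi> * x)) (2 *\<^sub>R (1 / (1 + \<xi>\<^sup>2) / 2))"
    proof (rule has_bochner_integral_even_function)
      have "has_bochner_integral lborel (\<lambda>x. indicator {0..} x * (exp (- x) * cos (\<xi> * x)) / 2) (1 / (1 + \<xi>\<^sup>2) / 2)"
        by (intro has_bochner_integral_divide_zero has_bochner_integral_exp_cos)
      then show "has_bochner_integral lborel (\<lambda>x. indicator {0..} x *\<^sub>R (exp (- \<bar>x\<bar>) / 2 * cos (\<xi> * x))) (1 / (1 + \<xi>\<^sup>2) / 2)"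
        by (rule has_bochner_integral_cong[THEN iffD1, rotated -1]) (auto simp: indicator_def)
    qed simp
    also have "2 *\<^sub>R (1 / (1 + \<xi>\<^sup>2) / 2) = 1 / (1 + \<xi>\<^sup>2)" 
      by (metis scaleR_half_double scaleR_2 real_scaleR_def field_sum_of_halves)
    finally show ?thesis .
  qed
  have "(\<integral>\<^sup>+x. ennreal (exp (- \<bar>x\<bar>) / 2) \<partial>lborel) = 1"
    using c[of 0] has_bochner_integral_iff[of lborel "\<lambda>x. exp (- \<bar>x\<bar>) / 2" 1]
    by (subst nn_integral_eq_integral) auto
  then show "prob_space laplace"
    by (intro prob_spaceI) (simp add: laplace_def emeasure_density)
  have i0: "integrable lborel (\<lambda>x::real. exp (- \<bar>x\<bar>) / 2)"
    using c[of 0] by (simp add: has_bochner_integral_iff)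
  have int: "integrable lborel (\<lambda>x. (exp (- \<bar>x\<bar>) / 2) *\<^sub>R iexp (\<xi> * x))"
    by (rule Bochner_Integration.integrable_bound[OF i0]) (auto simp: norm_mult)
  have "char laplace \<xi> = (\<integral>x. (exp (- \<bar>x\<bar>) / 2) *\<^sub>R iexp (\<xi> * x) \<partial>lborel)"
    unfolding char_def laplace_def by (subst integral_density) auto
  also have "\<dots> = of_real (1 / (1 + \<xi>\<^sup>2))"
  proof (rule complex_eqI)
    have "Re (\<integral>x. (exp (- \<bar>x\<bar>) / 2) *\<^sub>R iexp (\<xi> * x) \<partial>lborel) = (\<integral>x. exp (- \<bar>x\<bar>) / 2 * cos (\<xi> * x) \<partial>lborel)"
      by (subst integral_Re[OF int, symmetric]) (simp add: Re_exp)
    then show "Re (\<integral>x. (exp (- \<bar>x\<bar>) / 2) *\<^sub>R iexp (\<xi> * x) \<partial>lborel) = Re (of_real (1 / (1 + \<xi>\<^sup>2)))"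
      using c[of \<xi>] by (simp add: has_bochner_integral_iff)
    have "has_bochner_integral lborel (\<lambda>x. exp (- \<bar>x\<bar>) / 2 * sin (\<xi> * x)) 0"
    proof (rule has_bochner_integral_odd_function)
      have "integrable lborel (\<lambda>x. indicator {0..} x *\<^sub>R (exp (- \<bar>x\<bar>) / 2 * sin (\<xi> * x)))"
        by (rule Bochner_Integration.integrable_bound[OF i0]) (auto simp: abs_mult indicator_def)
      then show "has_bochner_integral lborel (\<lambda>x. indicator {0..} x *\<^sub>R (exp (- \<bar>x\<bar>) / 2 * sin (\<xi> * x)))
          (\<integral>x. indicator {0..} x *\<^sub>R (exp (- \<bar>x\<bar>) / 2 * sin (\<xi> * x)) \<partial>lborel)"
        by (simp add: has_bochner_integral_iff)
    qed simp
    moreover have "Im (\<integral>x. (exp (- \<bar>x\<bar>) / 2) *\<^sub>R iexp (\<xi> * x) \<partial>lborel) = (\<integral>x. exp (- \<bar>x\<bar>) / 2 * sin (\<xi> * x) \<partial>lborel)"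
      by (subst integral_Im[OF int, symmetric]) (simp add: Im_exp)
    ultimately show "Im (\<integral>x. (exp (- \<bar>x\<bar>) / 2) *\<^sub>R iexp (\<xi> * x) \<partial>lborel) = Im (of_real (1 / (1 + \<xi>\<^sup>2)))"
      by (simp add: has_bochner_integral_iff)
  qed
  finally show "char laplace \<xi> = of_real (1 / (1 + \<xi>\<^sup>2))" .
qed

section \<open>Characteristic functions: scaling, convolution, mixtures and limits\<close>

lemma real_distribution_laplace: "real_distribution laplace"
  using prob_space_laplace by (simp add: real_distribution_def real_distribution_axioms_def)

lemma char_distr_scale:
  assumes "real_distribution \<mu>"
  shows "real_distribution (distr \<mu> borel (\<lambda>x. c * x))" "char (distr \<mu> borel (\<lambda>x. c * x)) \<xi> = char \<mu> (c * \<xi>)"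
proof -
  interpret real_distribution \<mu> by fact
  show "real_distribution (distr \<mu> borel (\<lambda>x. c * x))" by (rule real_distribution_distr) simp
  show "char (distr \<mu> borel (\<lambda>x. c * x)) \<xi> = char \<mu> (c * \<xi>)"
    unfolding char_def by (subst integral_distr) (auto simp: ac_simps)
qed

lemma char_convolution:
  assumes "real_distribution \<mu>" "real_distribution \<nu>"
  shows "real_distribution (\<mu> \<star> \<nu>)" "char (\<mu> \<star> \<nu>) \<xi> = char \<mu> \<xi> * char \<nu> \<xi>"
proof -
  interpret \<mu>: real_distribution \<mu> by fact
  interpret \<nu>: real_distribution \<nu> by fact
  interpret pair_prob_space \<mu> \<nu> ..
  have m[measurable]: "(\<lambda>(x, y). x + y) \<in> borel_measurable (\<mu> \<Otimes>\<^sub>M \<nu>)" by measurable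
  show "real_distribution (\<mu> \<star> \<nu>)"
    unfolding convolution_def by (rule real_distribution_distr) measurable
  have "char (\<mu> \<star> \<nu>) \<xi> = (\<integral>z. iexp (\<xi> * fst z) * iexp (\<xi> * snd z) \<partial>(\<mu> \<Otimes>\<^sub>M \<nu>))"
    unfolding char_def convolution_def
    by (subst integral_distr) (auto simp: case_prod_beta distrib_left exp_add)
  also have "\<dots> = (\<integral>x. \<integral>y. iexp (\<xi> * x) * iexp (\<xi> * y) \<partial>\<nu> \<partial>\<mu>)"
    by (subst integral_fst'[symmetric]) (auto intro!: integrable_const_bound[where B=1] simp: norm_mult)
  also have "\<dots> = char \<mu> \<xi> * char \<nu> \<xi>"
    unfolding char_def by simp
  finally show "char (\<mu> \<star> \<nu>) \<xi> = char \<mu> \<xi> * char \<nu> \<xi>" .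
qed

lemma char_power_exists:
  assumes "real_distribution \<mu>"
  shows "\<exists>\<nu>. real_distribution \<nu> \<and> (\<forall>\<xi>. char \<nu> \<xi> = char \<mu> \<xi> ^ N)"
proof (induction N)
  case 0
  interpret \<mu>: real_distribution \<mu> by fact
  \<comment> \<open>Multiplying by 0 gives the Dirac law at 0, the empty convolution.\<close>
  have "real_distribution (distr \<mu> borel (\<lambda>x. 0 * x))" using char_distr_scale[OF assms] by blast
  moreover have "char (distr \<mu> borel (\<lambda>x. 0 * x)) \<xi> = 1" for \<xi>
    using char_distr_scale(2)[OF assms, of 0 \<xi>] \<mu>.char_zero by simp
  ultimately show ?case by auto
next
  case (Suc N)
  then show ?case using char_convolution[OF assms] by (metis power_Suc)
qed

text \<open>A random scale averages the characteristic functions. Points with \<open>V s = 0\<close>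
  contribute an atom at 0, which later absorbs the mass missing from a subprobability
  density.\<close>

lemma char_laplace_mixture:
  assumes "prob_space N" and [measurable]: "V \<in> borel_measurable N"
  shows "\<exists>\<mu>. real_distribution \<mu> \<and> (\<forall>\<xi>. char \<mu> \<xi> = of_real (\<integral>s. 1 / (1 + (\<xi> * V s)\<^sup>2) \<partial>N))"
proof -
  interpret N: prob_space N by fact
  interpret L: prob_space laplace by (rule prob_space_laplace)
  interpret pair_prob_space N laplace ..
  define \<mu> where "\<mu> = distr (N \<Otimes>\<^sub>M laplace) borel (\<lambda>z. V (fst z) * snd z)"
  have "real_distribution \<mu>"
    unfolding \<mu>_def by (rule real_distribution_distr) measurable
  moreover have "char \<mu> \<xi> = of_real (\<integral>s. 1 / (1 + (\<xi> * V s)\<^sup>2) \<partial>N)" for \<xi>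
  proof -
    have "char \<mu> \<xi> = (\<integral>z. iexp (\<xi> * (V (fst z) * snd z)) \<partial>(N \<Otimes>\<^sub>M laplace))"
      unfolding char_def \<mu>_def by (subst integral_distr) auto
    also have "\<dots> = (\<integral>s. \<integral>x. iexp ((\<xi> * V s) * x) \<partial>laplace \<partial>N)"
      by (subst integral_fst'[symmetric]) (auto intro!: integrable_const_bound[where B=1] simp: ac_simps)
    also have "\<dots> = (\<integral>s. of_real (1 / (1 + (\<xi> * V s)\<^sup>2)) \<partial>N)"
      by (simp only: char_laplace[unfolded char_def])
    finally show ?thesis by (simp only: integral_complex_of_real)
  qed
  ultimately show ?thesis by blast
qed

text \<open>\<open>exp (- (c * x)^2 / 2)\<close> is the characteristic function of a standard normal
  \<open>y\<close> at \<open>c * x\<close>, so Fubini exchanges the average over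
  \<open>\<mu>\<close> for one of \<open>char \<mu> (c * y)\<close> over \<open>y\<close>. The
  factor 2 is the Gaussian mean of \<open>1 + y^2\<close>, a majorant of
  \<open>\<bar>y\<bar> powr \<alpha>\<close>. The estimate serves twice: for tightness, and in place
  of second moments for the noise series.\<close>

lemma gaussian_average_bound:
  assumes "real_distribution \<mu>" and \<alpha>: "0 \<le> \<alpha>" "\<alpha> \<le> 2" and B: "0 \<le> B" and c: "0 \<le> c"
    and bnd: "\<And>\<xi>. 1 - Re (char \<mu> \<xi>) \<le> B * \<bar>\<xi>\<bar> powr \<alpha>"
  shows "(\<integral>x. 1 - exp (- (c * x)\<^sup>2 / 2) \<partial>\<mu>) \<le> 2 * B * c powr \<alpha>"
proof -
  interpret \<mu>: real_distribution \<mu> by fact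
  let ?N = "std_normal_distribution"
  interpret N: real_distribution ?N by (rule real_dist_normal_dist)
  interpret P: pair_prob_space \<mu> ?N ..
  have i: "integrable (\<mu> \<Otimes>\<^sub>M ?N) (\<lambda>(x, y). iexp (c * x * y))"
    by (intro P.integrable_const_bound[where B=1]) (auto simp: norm_mult)
  have "(\<integral>x. of_real (exp (- (c * x)\<^sup>2 / 2)) \<partial>\<mu>) = (\<integral>x. \<integral>y. iexp (c * x * y) \<partial>?N \<partial>\<mu>)"
    using char_std_normal_distribution unfolding char_def by metis
  also have "\<dots> = (\<integral>y. \<integral>x. iexp (c * x * y) \<partial>\<mu> \<partial>?N)"
    using P.Fubini_integral[OF i] by simp
  also have "\<dots> = (\<integral>y. char \<mu> (c * y) \<partial>?N)"
    unfolding char_def by (simp add: ac_simps)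
  finally have eq: "complex_of_real (\<integral>x. exp (- (c * x)\<^sup>2 / 2) \<partial>\<mu>) = (\<integral>y. char \<mu> (c * y) \<partial>?N)"
    by (simp only: integral_complex_of_real)
  have ci: "integrable ?N (\<lambda>y. char \<mu> (c * y))"
    by (intro N.integrable_const_bound[where B=1]) (auto simp: \<mu>.cmod_char_le_1)
  have "(\<integral>x. exp (- (c * x)\<^sup>2 / 2) \<partial>\<mu>) = (\<integral>y. Re (char \<mu> (c * y)) \<partial>?N)"
    using arg_cong[OF eq, of Re] by (simp add: ci)
  moreover have "integrable \<mu> (\<lambda>x. exp (- (c * x)\<^sup>2 / 2))"
    by (intro \<mu>.integrable_const_bound[where B=1]) auto
  ultimately have "(\<integral>x. 1 - exp (- (c * x)\<^sup>2 / 2) \<partial>\<mu>) = (\<integral>y. 1 - Re (char \<mu> (c * y)) \<partial>?N)"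
    using ci \<mu>.prob_space N.prob_space by simp
  also have "\<dots> \<le> (\<integral>y. B * c powr \<alpha> * (1 + y\<^sup>2) \<partial>?N)"
  proof (rule integral_mono)
    show "integrable ?N (\<lambda>y. 1 - Re (char \<mu> (c * y)))" using ci by simp
    show "integrable ?N (\<lambda>y. B * c powr \<alpha> * (1 + y\<^sup>2))"
      using integrable_std_normal_distribution_moment[of 2] by simp
    fix y :: real
    have "\<bar>y\<bar> powr \<alpha> \<le> 1 + y\<^sup>2"
    proof (cases "\<bar>y\<bar> \<le> 1")
      case True
      then have "\<bar>y\<bar> powr \<alpha> \<le> 1" using \<alpha> by (simp add: powr_le1)
      then show ?thesis by (smt (verit) zero_le_power2)
    next
      case False
      then have "\<bar>y\<bar> powr \<alpha> \<le> \<bar>y\<bar> powr 2" using \<alpha> by (intro powr_mono) auto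
      then show ?thesis using False by (simp add: powr_numeral)
    qed
    then have "B * (c powr \<alpha> * \<bar>y\<bar> powr \<alpha>) \<le> B * (c powr \<alpha> * (1 + y\<^sup>2))"
      using B by (intro mult_left_mono) auto
    then show "1 - Re (char \<mu> (c * y)) \<le> B * c powr \<alpha> * (1 + y\<^sup>2)"
      using bnd[of "c * y"] c by (simp add: abs_mult powr_mult mult.assoc)
  qed
  also have "\<dots> = 2 * B * c powr \<alpha>"
    using std_normal_distribution_even_moments[of 1] integrable_std_normal_distribution_moment[of 2]
      N.prob_space by (simp add: has_bochner_integral_iff)
  finally show ?thesis .
qed

text \<open>\<open>f\<close> is not assumed to be a characteristic function. The bound near the
  origin, uniform in \<open>n\<close>, supplies tightness, and a weak limit along a subsequence has
  characteristic function \<open>f\<close> by Levy continuity.\<close>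

lemma char_limit_exists:
  assumes rd: "\<And>n. real_distribution (\<mu> n)" and lim: "\<And>\<xi>. (\<lambda>n. char (\<mu> n) \<xi>) \<longlonglongrightarrow> f \<xi>"
    and \<alpha>: "0 < \<alpha>" "\<alpha> \<le> 2" and bnd: "\<And>n \<xi>. 1 - Re (char (\<mu> n) \<xi>) \<le> \<bar>\<xi>\<bar> powr \<alpha>"
  shows "\<exists>M. real_distribution M \<and> (\<forall>\<xi>. char M \<xi> = f \<xi>)"
proof -
  have "tight \<mu>"
    unfolding tight_def
  proof (intro conjI allI impI rd)
    fix \<epsilon> :: real assume e: "0 < \<epsilon>"
    \<comment> \<open>6 = 3 * 2: \<open>\<bar>x\<bar> \<ge> K\<close> forces
      \<open>1 - exp (- (x / K)^2 / 2) \<ge> 1 / 3\<close>, and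
      \<open>gaussian_average_bound\<close> contributes 2.\<close>
    have "((\<lambda>K. 6 * (1 / K) powr \<alpha>) \<longlongrightarrow> 6 * 0) at_top"
    proof (intro tendsto_mult tendsto_const)
      have "((\<lambda>K. K powr - \<alpha>) \<longlongrightarrow> 0) at_top"
        using \<alpha> by (intro tendsto_neg_powr filterlim_ident) auto
      moreover have "\<forall>\<^sub>F K in at_top. K powr - \<alpha> = (1 / K) powr \<alpha>"
        using eventually_gt_at_top[of "0::real"] by eventually_elim (simp add: powr_minus_divide powr_divide)
      ultimately show "((\<lambda>K. (1 / K) powr \<alpha>) \<longlongrightarrow> 0) at_top"
        by (rule Lim_transform_eventually)
    qed
    then have "\<forall>\<^sub>F K in at_top. 6 * (1 / K) powr \<alpha> < \<epsilon>" using e by (intro order_tendstoD) auto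
    then obtain K where K: "K > 0" "6 * (1 / K) powr \<alpha> < \<epsilon>"
      using eventually_gt_at_top[of "0::real"] by (metis (mono_tags, lifting) eventually_at_top_linorder eventually_gt_at_top linorder_le_cases order.strict_trans2)
    have "measure (\<mu> n) {-K<..K} > 1 - \<epsilon>" for n
    proof -
      interpret real_distribution "\<mu> n" by (rule rd)
      have "measure (\<mu> n) (UNIV - {-K<..K}) = (\<integral>x. indicator (UNIV - {-K<..K}) x \<partial>\<mu> n)" by simp
      also have "\<dots> \<le> (\<integral>x. 3 * (1 - exp (- (1 / K * x)\<^sup>2 / 2)) \<partial>\<mu> n)"
      proof (rule integral_mono)
        show "integrable (\<mu> n) (\<lambda>x. 3 * (1 - exp (- (1 / K * x)\<^sup>2 / 2)))"
          by (intro integrable_const_bound[where B=3]) auto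
        fix x :: real
        have "3 * (1 - exp (- (1 / K * x)\<^sup>2 / 2)) \<ge> 1" if "x \<notin> {-K<..K}"
        proof -
          have "K \<le> \<bar>x\<bar>" using that K(1) by auto
          then have "1 \<le> \<bar>1 / K * x\<bar>" using K(1) by (simp add: abs_mult)
          then have "1 \<le> (1 / K * x)\<^sup>2" using abs_le_square_iff[of 1 "1 / K * x"] by simp
          then have "1 / 2 \<le> (1 / K * x)\<^sup>2 / 2" by simp
          then have "exp (- (1 / K * x)\<^sup>2 / 2) \<le> exp (- (1 / 2))" by simp
          also have "\<dots> \<le> 2 / 3"
            using exp_ge_add_one_self[of "1 / 2 :: real"] by (simp add: exp_minus field_simps)
          finally show ?thesis by simp
        qed
        then show "indicator (UNIV - {-K<..K}) x \<le> 3 * (1 - exp (- (1 / K * x)\<^sup>2 / 2))"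
          by (auto simp: indicator_def)
      qed (auto intro!: integrable_real_indicator simp: emeasure_eq_measure)
      also have "\<dots> = 3 * (\<integral>x. 1 - exp (- (1 / K * x)\<^sup>2 / 2) \<partial>\<mu> n)" by (rule integral_mult_right_zero)
      also have "\<dots> \<le> 3 * (2 * 1 * (1 / K) powr \<alpha>)"
        using gaussian_average_bound[OF rd, of \<alpha> 1 "1 / K" n] \<alpha> bnd K(1) by (intro mult_left_mono) auto
      also have "\<dots> < \<epsilon>" using K(2) by simp
      finally show ?thesis using prob_compl[of "{-K<..K}"] by simp
    qed
    then show "\<exists>a b. a < b \<and> (\<forall>n. 1 - \<epsilon> < measure (\<mu> n) {a<..b})" using K(1) by (intro exI[of _ "-K"] exI[of _ K]) auto
  qed
  then obtain r M where r: "strict_mono r" and M: "real_distribution M" "weak_conv_m (\<mu> \<circ> id \<circ> r) M"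
    using tight_imp_convergent_subsubsequence[of \<mu> id] strict_mono_id by (auto simp: id_def)
  have "char M \<xi> = f \<xi>" for \<xi>
  proof -
    have "(\<lambda>n. char ((\<mu> \<circ> id \<circ> r) n) \<xi>) \<longlonglongrightarrow> char M \<xi>"
      by (rule levy_continuity1[OF _ M]) (simp add: rd)
    moreover have "(\<lambda>n. char ((\<mu> \<circ> id \<circ> r) n) \<xi>) \<longlonglongrightarrow> f \<xi>"
      using LIMSEQ_subseq_LIMSEQ[OF lim r] by (simp add: comp_def)
    ultimately show ?thesis by (rule LIMSEQ_unique)
  qed
  then show ?thesis using M(1) by blast
qed

text \<open>Both sandwich bounds come from \<open>1 + y \<le> exp y\<close>: at
  \<open>y = - x\<close> for the upper one, at \<open>y = x / (1 - x)\<close> for the lower one,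
  with \<open>x = p n / real (N n)\<close> eventually below 1.\<close>

lemma one_minus_power_tendsto_exp:
  fixes p :: "nat \<Rightarrow> real" and N :: "nat \<Rightarrow> nat"
  assumes p: "p \<longlonglongrightarrow> a" and p0: "\<And>n. 0 \<le> p n" and N: "filterlim N at_top sequentially"
  shows "(\<lambda>n. (1 - p n / real (N n)) ^ N n) \<longlonglongrightarrow> exp (- a)"
proof (rule tendsto_sandwich)
  have Nr: "filterlim (\<lambda>n. real (N n)) at_top sequentially"
    by (rule filterlim_compose[OF filterlim_real_sequentially N])
  have q: "(\<lambda>n. p n / real (N n)) \<longlonglongrightarrow> 0"
    by (rule tendsto_divide_0[OF p filterlim_at_top_imp_at_infinity[OF Nr]])
  have ev: "\<forall>\<^sub>F n in sequentially. p n / real (N n) < 1 \<and> 0 < N n"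
    using order_tendstoD(2)[OF q, of 1] eventually_compose_filterlim[OF eventually_gt_at_top N]
    by (auto simp: eventually_conj_iff)
  show "\<forall>\<^sub>F n in sequentially. (1 - p n / real (N n)) ^ N n \<le> exp (- p n)"
    using ev
  proof eventually_elim
    case (elim n)
    have "(1 - p n / real (N n)) ^ N n \<le> exp (- (p n / real (N n))) ^ N n"
      using elim exp_ge_add_one_self[of "- (p n / real (N n))"] by (intro power_mono) auto
    also have "\<dots> = exp (- p n)" using elim by (simp flip: exp_of_nat_mult)
    finally show ?case .
  qed
  show "\<forall>\<^sub>F n in sequentially. exp (- (p n / (1 - p n / real (N n)))) \<le> (1 - p n / real (N n)) ^ N n"
    using ev
  proof eventually_elim
    case (elim n)
    define x where "x = p n / real (N n)"
    have x: "0 \<le> x" "x < 1" using elim p0[of n] by (auto simp: x_def)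
    have "1 + x / (1 - x) \<le> exp (x / (1 - x))" by (rule exp_ge_add_one_self)
    then have "exp (- (x / (1 - x))) \<le> 1 - x"
      using x by (simp add: exp_minus field_simps)
    then have "exp (- (x / (1 - x))) ^ N n \<le> (1 - x) ^ N n" by (intro power_mono) auto
    also have "exp (- (x / (1 - x))) ^ N n = exp (- (p n / (1 - x)))"
      using elim by (simp add: x_def flip: exp_of_nat_mult)
    finally show ?case by (simp add: x_def)
  qed
  show "(\<lambda>n. exp (- p n)) \<longlonglongrightarrow> exp (- a)" by (intro tendsto_intros p)
  have "(\<lambda>n. exp (- (p n / (1 - p n / real (N n))))) \<longlonglongrightarrow> exp (- (a / (1 - 0)))"
    by (intro tendsto_intros p q) simp
  then show "(\<lambda>n. exp (- (p n / (1 - p n / real (N n))))) \<longlonglongrightarrow> exp (- a)" by simp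
qed

text \<open>\<open>1 - lap_defect \<xi> s\<close> is the characteristic function at \<open>\<xi>\<close> of the Laplace law of scale \<open>1 / s\<close>.\<close>

abbreviation lap_defect :: "real \<Rightarrow> real \<Rightarrow> real" where
  "lap_defect \<xi> s \<equiv> \<xi>\<^sup>2 / (s\<^sup>2 + \<xi>\<^sup>2)"

section \<open>Stable and Laplace exponents as mixtures of Laplace defects\<close>

lemma stable_exponent:
  fixes \<alpha> :: real
  assumes \<alpha>: "1 < \<alpha>" "\<alpha> < 2"
  obtains c where "0 < c" "\<And>\<xi>. has_bochner_integral lborel
    (\<lambda>s. indicator {0<..} s * (lap_defect \<xi> s * s powr (\<alpha> - 1))) (c * \<bar>\<xi>\<bar> powr \<alpha>)"
proof -
  \<comment> \<open>The integrand for \<open>\<xi> = 1\<close>; its integral is the constant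
    \<open>c\<close>. It decays like \<open>s powr (\<alpha> - 3)\<close> at infinity, so
    \<open>\<alpha> < 2\<close> makes \<open>c\<close> finite.\<close>
  define f where "f s = indicator {0<..} s * (1 / (s\<^sup>2 + 1) * s powr (\<alpha> - 1))" for s :: real
  have [measurable]: "f \<in> borel_measurable borel" unfolding f_def by measurable
  have f_int: "integrable lborel f"
  proof (rule Bochner_Integration.integrable_bound)
    have 1: "has_bochner_integral lborel (\<lambda>s::real. indicator {0..1} s * s powr (\<alpha> - 1)) (1 powr (\<alpha> - 1 + 1) / (\<alpha> - 1 + 1))"
      using \<alpha> by (intro has_bochner_integral_of_has_integral has_integral_powr_from_0) auto
    have 2: "has_bochner_integral lborel (\<lambda>s::real. indicator {1..} s * s powr (\<alpha> - 3)) (- (1 powr (\<alpha> - 3 + 1)) / (\<alpha> - 3 + 1))"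
      using \<alpha> by (intro has_bochner_integral_of_has_integral has_integral_powr_to_inf) auto
    show "integrable lborel (\<lambda>s::real. indicator {0..1} s * s powr (\<alpha> - 1) + indicator {1..} s * s powr (\<alpha> - 3))"
      by (intro Bochner_Integration.integrable_add integrable.intros[OF 1] integrable.intros[OF 2])
    have le: "f s \<le> indicator {0..1} s * s powr (\<alpha> - 1) + indicator {1..} s * s powr (\<alpha> - 3)" for s
    proof (cases "0 < s \<and> s \<le> 1")
      case True
      then have "f s = 1 / (s\<^sup>2 + 1) * s powr (\<alpha> - 1)" by (simp add: f_def)
      also have "\<dots> \<le> 1 * s powr (\<alpha> - 1)"
      proof (rule mult_right_mono)
        have "0 < s\<^sup>2 + 1" by (rule add_nonneg_pos) auto
        then show "1 / (s\<^sup>2 + 1) \<le> 1" by (simp add: divide_le_eq_1)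
      qed simp
      also have "\<dots> \<le> indicator {0..1} s * s powr (\<alpha> - 1) + indicator {1..} s * s powr (\<alpha> - 3)"
        using True by simp
      finally show ?thesis .
    next
      case False
      show ?thesis
      proof (cases "s > 1")
        case True
        have "1 / (s\<^sup>2 + 1) * s powr (\<alpha> - 1) \<le> (1 / s\<^sup>2) * s powr (\<alpha> - 1)"
          using True by (intro mult_right_mono divide_left_mono) (auto intro!: mult_pos_pos add_nonneg_pos)
        also have "\<dots> = s powr (\<alpha> - 3)"
          using True powr_add[of s "\<alpha> - 3" 2] by (simp add: powr_numeral field_simps)
        finally show ?thesis using True by (simp add: f_def indicator_def)
      qed (use False in \<open>auto simp: f_def indicator_def\<close>)
    qed
    have "0 \<le> f s" for s
      unfolding f_def by (intro mult_nonneg_nonneg divide_nonneg_nonneg add_nonneg_nonneg) auto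
    then show "AE s in lborel. norm (f s) \<le> norm (indicator {0..1} s * s powr (\<alpha> - 1) + indicator {1..} s * s powr (\<alpha> - 3))"
      using le by (intro AE_I2) (simp add: order_trans[OF _ abs_ge_self])
  qed simp
  define c where "c = (\<integral>s. f s \<partial>lborel)"
  \<comment> \<open>Positivity of \<open>c\<close>: on \<open>[1, 2]\<close> the denominator
    \<open>s^2 + 1\<close> is at most 5 and \<open>s powr (\<alpha> - 1)\<close> at least 1.\<close>
  have "(\<integral>s. indicator {1..2::real} s * (1 / 5) \<partial>lborel) \<le> c"
    unfolding c_def
  proof (rule integral_mono[OF _ f_int])
    show "integrable lborel (\<lambda>s::real. indicator {1..2} s * (1 / 5 :: real))" by simp
    fix s :: real
    have "1 / 5 \<le> 1 / (s\<^sup>2 + 1) * s powr (\<alpha> - 1)" if "1 \<le> s" "s \<le> 2"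
    proof -
      have "s\<^sup>2 \<le> 2\<^sup>2" using that by (intro power_mono) auto
      then have "1 / 5 * 1 \<le> 1 / (s\<^sup>2 + 1) * s powr (\<alpha> - 1)"
        using that \<alpha> by (intro mult_mono frac_le) (auto simp: ge_one_powr_ge_zero intro: add_nonneg_pos)
      then show ?thesis by simp
    qed
    then show "indicator {1..2} s * (1 / 5) \<le> f s" by (auto simp: f_def indicator_def)
  qed
  then have "0 < c" by simp
  moreover have "has_bochner_integral lborel
    (\<lambda>s. indicator {0<..} s * (lap_defect \<xi> s * s powr (\<alpha> - 1))) (c * \<bar>\<xi>\<bar> powr \<alpha>)" for \<xi>
  proof (cases "\<xi> = 0")
    case True
    then show ?thesis by (simp add: has_bochner_integral_zero)
  next
    case False
    \<comment> \<open>Replacing \<open>s\<close> by \<open>a * s\<close> reduces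
      \<open>\<xi>\<close> to 1; \<open>a powr (\<alpha> - 1)\<close> and the Jacobian
      \<open>a\<close> make up \<open>\<bar>\<xi>\<bar> powr \<alpha>\<close>. The terms
      \<open>0 + a * s\<close> have the shape of the affine change of variables.\<close>
    define a where "a = \<bar>\<xi>\<bar>"
    have a: "a > 0" "\<xi>\<^sup>2 = a\<^sup>2" using False by (auto simp: a_def)
    have "has_bochner_integral lborel (\<lambda>s. a powr (\<alpha> - 1) * f s) (a powr (\<alpha> - 1) * c)"
      unfolding c_def by (intro has_bochner_integral_mult_right has_bochner_integral_integrable f_int)
    moreover have "a powr (\<alpha> - 1) * f s
      = indicator {0<..} (0 + a * s) * (\<xi>\<^sup>2 / ((0 + a * s)\<^sup>2 + \<xi>\<^sup>2) * (0 + a * s) powr (\<alpha> - 1))" for s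
    proof -
      have "a\<^sup>2 / ((a * s)\<^sup>2 + a\<^sup>2) = 1 / (s\<^sup>2 + 1)"
      proof -
        have "(a * s)\<^sup>2 + a\<^sup>2 = a\<^sup>2 * (s\<^sup>2 + 1)" by (simp add: power_mult_distrib algebra_simps)
        then show ?thesis using a(1) by simp
      qed
      then show ?thesis using a by (auto simp: f_def indicator_def zero_less_mult_iff powr_mult)
    qed
    moreover have "a powr (\<alpha> - 1) * c = (c * \<bar>\<xi>\<bar> powr \<alpha>) /\<^sub>R \<bar>a\<bar>"
      using a by (simp add: a_def powr_diff field_simps)
    ultimately show ?thesis
      using lborel_has_bochner_integral_real_affine_iff[of a
        "\<lambda>s. indicator {0<..} s * (lap_defect \<xi> s * s powr (\<alpha> - 1))" "c * \<bar>\<xi>\<bar> powr \<alpha>" 0] a(1)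
      by simp
  qed
  ultimately show ?thesis using that by blast
qed

text \<open>Twice this integral is minus the logarithm of the characteristic function of the Laplace
  law of scale \<open>1 / \<sigma>\<close>. That law thus has the weight \<open>2 / s\<close> on
  \<open>{\<sigma>..}\<close>, to be compared with the stable weight
  \<open>s powr (\<alpha> - 1) / c\<close> on \<open>{0<..}\<close>.\<close>

lemma log_exponent:
  fixes \<sigma> \<xi> :: real
  assumes "0 < \<sigma>"
  shows "has_bochner_integral lborel (\<lambda>s. indicator {\<sigma>..} s * (lap_defect \<xi> s / s)) (ln (1 + \<xi>\<^sup>2 / \<sigma>\<^sup>2) / 2)"
proof -
  define F where "F s = - ln (1 + \<xi>\<^sup>2 / s\<^sup>2) / 2" for s :: real
  have pos: "0 < 1 + \<xi>\<^sup>2 / s\<^sup>2" for s :: real by (intro add_pos_nonneg) auto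
  have "(\<integral>\<^sup>+s. ennreal (lap_defect \<xi> s / s) * indicator {\<sigma>..} s \<partial>lborel) = ennreal (0 - F \<sigma>)"
  proof (rule nn_integral_FTC_atLeast)
    fix s assume "\<sigma> \<le> s"
    then have s: "s > 0" using assms by simp
    have eq: "(- ((0 * s\<^sup>2 - \<xi>\<^sup>2 * (2 * s)) / (s\<^sup>2 * s\<^sup>2) / (1 + \<xi>\<^sup>2 / s\<^sup>2))) / 2 = lap_defect \<xi> s / s"
    proof -
      have "(s\<^sup>2 * s\<^sup>2) * (1 + \<xi>\<^sup>2 / s\<^sup>2) = s\<^sup>2 * (s\<^sup>2 + \<xi>\<^sup>2)" using s by (simp add: field_simps)
      then have "(- ((0 * s\<^sup>2 - \<xi>\<^sup>2 * (2 * s)) / (s\<^sup>2 * s\<^sup>2) / (1 + \<xi>\<^sup>2 / s\<^sup>2))) / 2 = (\<xi>\<^sup>2 * s) / (s\<^sup>2 * (s\<^sup>2 + \<xi>\<^sup>2))"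
        by (simp add: divide_divide_eq_left)
      also have "\<dots> = lap_defect \<xi> s / s" using s by (simp add: power2_eq_square)
      finally show ?thesis .
    qed
    show "DERIV F s :> lap_defect \<xi> s / s"
      unfolding F_def eq[symmetric] using s pos[of s]
      by (auto intro!: derivative_eq_intros simp: power2_eq_square)
    show "0 \<le> lap_defect \<xi> s / s" using s by simp
  next
    have "((\<lambda>s. \<xi>\<^sup>2 / s\<^sup>2) \<longlongrightarrow> 0) at_top"
      by (rule tendsto_divide_0[OF tendsto_const])
         (intro filterlim_at_top_imp_at_infinity filterlim_pow_at_top filterlim_ident, simp)
    then have "((\<lambda>s. - ln (1 + \<xi>\<^sup>2 / s\<^sup>2) / 2) \<longlongrightarrow> - ln (1 + 0) / 2) at_top"
      by (intro tendsto_intros) auto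
    then show "(F \<longlongrightarrow> 0) at_top" unfolding F_def by simp
  qed measurable
  then have "(\<integral>\<^sup>+s. ennreal (indicator {\<sigma>..} s * (lap_defect \<xi> s / s)) \<partial>lborel) = ennreal (ln (1 + \<xi>\<^sup>2 / \<sigma>\<^sup>2) / 2)"
  proof -
    have "ennreal (indicator {\<sigma>..} s * (lap_defect \<xi> s / s)) = ennreal (lap_defect \<xi> s / s) * indicator {\<sigma>..} s" for s
      by (simp add: indicator_def)
    then show ?thesis using \<open>(\<integral>\<^sup>+s. _ \<partial>lborel) = _\<close> by (simp only: F_def) simp
  qed
  moreover have "0 \<le> ln (1 + \<xi>\<^sup>2 / \<sigma>\<^sup>2) / 2" by simp
  ultimately show ?thesis
    using assms by (intro has_bochner_integral_nn_integral) (auto simp: indicator_def)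
qed

text \<open>A Levy--Khintchine type construction in which the Levy measure is a mixture, with weight
  \<open>\<kappa>\<close>, of the Levy measures of compound Poisson laws with Laplace jumps of scale \<open>1 / s\<close>.\<close>

lemma infinitely_divisible_exists:
  fixes \<kappa> :: "real \<Rightarrow> real"
  assumes [measurable]: "\<kappa> \<in> borel_measurable borel"
    and \<kappa>0: "\<And>s. 0 \<le> \<kappa> s" "\<And>s. s \<le> 0 \<Longrightarrow> \<kappa> s = 0"
    and int: "\<And>n::nat. integrable lborel (\<lambda>s. indicator {..real n} s * \<kappa> s)"
    and \<psi>: "\<And>\<xi>. has_bochner_integral lborel (\<lambda>s. lap_defect \<xi> s * \<kappa> s) (\<psi> \<xi>)"
    and \<alpha>: "0 < \<alpha>" "\<alpha> \<le> 2" and bnd: "\<And>\<xi>. \<psi> \<xi> \<le> \<bar>\<xi>\<bar> powr \<alpha>"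
  shows "\<exists>M. real_distribution M \<and> (\<forall>\<xi>. char M \<xi> = of_real (exp (- \<psi> \<xi>)))"
proof -
  define h where "h \<xi> s = lap_defect \<xi> s * \<kappa> s" for \<xi> s
  have [measurable]: "h \<xi> \<in> borel_measurable borel" for \<xi> unfolding h_def by measurable
  have h0: "0 \<le> h \<xi> s" for \<xi> s unfolding h_def using \<kappa>0 by simp
  have h_int: "integrable lborel (h \<xi>)" "(\<integral>s. h \<xi> s \<partial>lborel) = \<psi> \<xi>" for \<xi>
    using \<psi>[of \<xi>] unfolding h_def[abs_def] by (auto simp: has_bochner_integral_iff)
  define p where "p \<xi> n = (\<integral>s. indicator {..real n} s * h \<xi> s \<partial>lborel)" for \<xi> n
  have ph: "integrable lborel (\<lambda>s. indicator {..real n} s * h \<xi> s)" for n \<xi>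
    by (rule Bochner_Integration.integrable_bound[OF h_int(1)[of \<xi>]]) (auto simp: indicator_def)
  have p0: "0 \<le> p \<xi> n" for \<xi> n unfolding p_def by (intro integral_nonneg_AE AE_I2) (auto simp: h0)
  have p_le: "p \<xi> n \<le> \<psi> \<xi>" for \<xi> n
    unfolding p_def h_int(2)[symmetric] by (intro integral_mono ph h_int) (auto simp: indicator_def h0)
  have p_lim: "p \<xi> \<longlonglongrightarrow> \<psi> \<xi>" for \<xi>
    unfolding p_def h_int(2)[symmetric]
  proof (rule integral_dominated_convergence[where w="h \<xi>"])
    show "AE s in lborel. (\<lambda>n. indicator {..real n} s * h \<xi> s) \<longlonglongrightarrow> h \<xi> s"
    proof (rule AE_I2, rule tendsto_eventually)
      fix s :: real
      obtain m :: nat where "s \<le> real m" using real_arch_simple by blast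
      then have "indicator {..real n} s * h \<xi> s = h \<xi> s" if "n \<ge> m" for n
        using that by (auto simp: indicator_def)
      then show "\<forall>\<^sub>F n in sequentially. indicator {..real n} s * h \<xi> s = h \<xi> s"
        unfolding eventually_sequentially by blast
    qed
  qed (auto simp: h_int h0 indicator_def)
  define l where "l n = (\<integral>s. indicator {..real n} s * \<kappa> s \<partial>lborel)" for n
  have l0: "0 \<le> l n" for n unfolding l_def by (intro integral_nonneg_AE AE_I2) (auto simp: \<kappa>0)
  \<comment> \<open>\<open>N n \<ge> l n\<close> leaves room for a probability density,
    \<open>N n \<ge> n\<close> sends the exponent to infinity, and the 1 keeps the divisor
    positive.\<close>
  define N where "N n = nat \<lceil>l n\<rceil> + n + 1" for n
  have N: "l n \<le> real (N n)" "0 < N n" "n \<le> N n" for n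
    unfolding N_def by (auto simp: of_nat_add) linarith
  \<comment> \<open>The weight cut off at \<open>n\<close>, divided by \<open>N n\<close>; the
    missing mass goes to \<open>{-1..0}\<close>, where \<open>V\<close> is 0 and the Laplace
    variable degenerates to the constant 0.\<close>
  define w where "w n s = indicator {..real n} s * \<kappa> s / real (N n) + (1 - l n / real (N n)) * indicator {-1..0} s" for n s
  have w[measurable]: "w n \<in> borel_measurable borel" for n unfolding w_def by measurable
  have w0: "0 \<le> w n s" for n s unfolding w_def using \<kappa>0 N[of n] by (intro add_nonneg_nonneg mult_nonneg_nonneg) (auto simp: field_simps)
  have hw: "has_bochner_integral lborel (w n) (l n / real (N n) + (1 - l n / real (N n)) * 1)" for n
  proof -
    have "has_bochner_integral lborel (indicator {-1..0::real} :: real \<Rightarrow> real) 1"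
      using has_bochner_integral_real_indicator[of "{-1..0::real}" lborel] by simp
    then show ?thesis
      unfolding w_def l_def
      by (intro has_bochner_integral_add has_bochner_integral_divide_zero has_bochner_integral_mult_right
          has_bochner_integral_integrable int)
  qed
  define V where "V s = (if 0 < s then 1 / s else 0)" for s :: real
  have V[measurable]: "V \<in> borel_measurable borel" unfolding V_def by measurable
  have char1: "\<exists>\<mu>. real_distribution \<mu> \<and> (\<forall>\<xi>. char \<mu> \<xi> = of_real (1 - p \<xi> n / real (N n)))" for n
  proof -
    let ?W = "density lborel (\<lambda>s. ennreal (w n s))"
    have "prob_space ?W"
    proof (rule prob_spaceI)
      have "(\<integral>\<^sup>+s. ennreal (w n s) \<partial>lborel) = ennreal 1"
        using hw[of n] by (subst nn_integral_eq_integral) (auto simp: w0 has_bochner_integral_iff)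
      then show "emeasure ?W (space ?W) = 1" by (simp add: emeasure_density)
    qed
    from char_laplace_mixture[OF this, of V] obtain \<mu> where
      \<mu>: "real_distribution \<mu>" "\<And>\<xi>. char \<mu> \<xi> = of_real (\<integral>s. 1 / (1 + (\<xi> * V s)\<^sup>2) \<partial>?W)"
      by auto
    have "(\<integral>s. 1 / (1 + (\<xi> * V s)\<^sup>2) \<partial>?W) = 1 - p \<xi> n / real (N n)" for \<xi>
    proof -
      have "(\<integral>s. 1 / (1 + (\<xi> * V s)\<^sup>2) \<partial>?W) = (\<integral>s. w n s * (1 / (1 + (\<xi> * V s)\<^sup>2)) \<partial>lborel)"
        by (subst integral_density) (auto simp: w0)
      also have "\<dots> = (\<integral>s. w n s - indicator {..real n} s * h \<xi> s / real (N n) \<partial>lborel)"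
      proof (rule Bochner_Integration.integral_cong[OF refl])
        fix s :: real
        show "w n s * (1 / (1 + (\<xi> * V s)\<^sup>2)) = w n s - indicator {..real n} s * h \<xi> s / real (N n)"
        proof (cases "0 < s")
          case True
          have "s\<^sup>2 + \<xi>\<^sup>2 > 0" using True by (intro add_pos_nonneg) auto
          have "1 + (\<xi> * V s)\<^sup>2 = (s\<^sup>2 + \<xi>\<^sup>2) / s\<^sup>2" using True by (simp add: V_def power_divide field_simps)
          then have "1 / (1 + (\<xi> * V s)\<^sup>2) = s\<^sup>2 / (s\<^sup>2 + \<xi>\<^sup>2)" by simp
          also have "\<dots> = 1 - lap_defect \<xi> s"
            using \<open>s\<^sup>2 + \<xi>\<^sup>2 > 0\<close> divide_self[of "s\<^sup>2 + \<xi>\<^sup>2"] unfolding add_divide_distrib by linarith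
          finally have "1 / (1 + (\<xi> * V s)\<^sup>2) = 1 - lap_defect \<xi> s" .
          then show ?thesis using True by (simp add: w_def h_def right_diff_distrib indicator_def ac_simps)
        qed (simp add: V_def h_def \<kappa>0)
      qed
      also have "\<dots> = 1 - p \<xi> n / real (N n)"
        using hw[of n] ph[where n=n and \<xi>=\<xi>] by (simp add: has_bochner_integral_iff p_def)
      finally show ?thesis .
    qed
    with \<mu> show ?thesis by auto
  qed
  have "\<exists>\<mu>. real_distribution \<mu> \<and> (\<forall>\<xi>. char \<mu> \<xi> = of_real ((1 - p \<xi> n / real (N n)) ^ N n))" for n
  proof -
    from char1[of n] obtain \<mu> where \<mu>: "real_distribution \<mu>" "\<And>\<xi>. char \<mu> \<xi> = of_real (1 - p \<xi> n / real (N n))"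
      by blast
    from char_power_exists[OF \<mu>(1), of "N n"] show ?thesis by (simp only: \<mu>(2) of_real_power)
  qed
  then obtain \<mu> where \<mu>: "\<And>n. real_distribution (\<mu> n)"
    "\<And>n \<xi>. char (\<mu> n) \<xi> = of_real ((1 - p \<xi> n / real (N n)) ^ N n)"
    by metis
  show ?thesis
  proof (rule char_limit_exists[OF \<mu>(1) _ \<alpha>])
    have Nlim: "filterlim N at_top sequentially"
      by (rule filterlim_at_top_mono[OF filterlim_ident]) (simp add: N)
    show "(\<lambda>n. char (\<mu> n) \<xi>) \<longlonglongrightarrow> of_real (exp (- \<psi> \<xi>))" for \<xi>
      unfolding \<mu>(2) by (intro tendsto_of_real one_minus_power_tendsto_exp p_lim p0 Nlim)
    \<comment> \<open>Gives \<open>p \<xi> n / N n \<le> 1\<close>, a range in which Bernoulli's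
      inequality applies; the latter turns the bound on \<open>\<psi>\<close> into one for the
      approximants that is uniform in \<open>n\<close>.\<close>
    have pl: "p \<xi> n \<le> l n" for \<xi> n
      unfolding p_def l_def
    proof (intro integral_mono ph int)
      fix s
      have "lap_defect \<xi> s \<le> 1" 
      proof (cases "s\<^sup>2 + \<xi>\<^sup>2 = 0")
        case False
        then have "0 < s\<^sup>2 + \<xi>\<^sup>2" using add_nonneg_nonneg[of "s\<^sup>2" "\<xi>\<^sup>2"] by (simp add: less_le)
        then show ?thesis by (simp add: divide_le_eq_1)
      qed simp
      then have "h \<xi> s \<le> 1 * \<kappa> s" unfolding h_def by (rule mult_right_mono) (rule \<kappa>0)
      then show "indicator {..real n} s * h \<xi> s \<le> indicator {..real n} s * \<kappa> s"
        by (simp add: mult_left_mono)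
    qed
    show "1 - Re (char (\<mu> n) \<xi>) \<le> \<bar>\<xi>\<bar> powr \<alpha>" for n \<xi>
    proof -
      have "1 + real (N n) * (- (p \<xi> n / real (N n))) \<le> (1 + (- (p \<xi> n / real (N n)))) ^ N n"
        using pl[of \<xi> n] N[of n] by (intro Bernoulli_inequality) (auto simp: field_simps)
      then have "1 - p \<xi> n \<le> (1 - p \<xi> n / real (N n)) ^ N n" using N(2)[of n] by simp
      moreover have "Re (char (\<mu> n) \<xi>) = (1 - p \<xi> n / real (N n)) ^ N n" unfolding \<mu>(2) by (rule Re_complex_of_real)
      ultimately show ?thesis using p_le[of \<xi> n] bnd[of \<xi>] by simp
    qed
  qed
qed

text \<open>The stable exponent has weight \<open>s powr (\<alpha> - 1) / c\<close>, the two Laplace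
  laws together \<open>2 * (2 / s)\<close> on \<open>{\<sigma>..}\<close>. Their difference
  \<open>\<kappa>\<close> is nonnegative and hence the weight of a law \<open>\<nu>\<close>. Two
  factors are split off because a second difference consumes one per increment.\<close>

theorem stable_Laplace_factor:
  fixes \<alpha> :: real
  assumes \<alpha>: "1 < \<alpha>" "\<alpha> < 2"
  obtains b \<nu> where "0 < b" "real_distribution \<nu>"
    "\<And>\<xi>. of_real (exp (- (\<bar>\<xi>\<bar> powr \<alpha>))) = char laplace (b * \<xi>) * char laplace (b * \<xi>) * char \<nu> \<xi>"
proof -
  obtain c where c: "0 < c" and J: "\<And>\<xi>. has_bochner_integral lborel
    (\<lambda>s. indicator {0<..} s * (lap_defect \<xi> s * s powr (\<alpha> - 1))) (c * \<bar>\<xi>\<bar> powr \<alpha>)"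
    using stable_exponent[OF \<alpha>] by blast
  \<comment> \<open>Chosen so that \<open>\<sigma> powr \<alpha> = 4 * c\<close>, the point from
    which on \<open>s powr (\<alpha> - 1) / c \<ge> 4 / s\<close>.\<close>
  define \<sigma> where "\<sigma> = (4 * c) powr (1 / \<alpha>)"
  have \<sigma>: "0 < \<sigma>" "\<sigma> powr \<alpha> = 4 * c" using c \<alpha> by (auto simp: \<sigma>_def powr_powr)
  define \<kappa> where "\<kappa> s = indicator {0<..} s * s powr (\<alpha> - 1) / c - 4 * (indicator {\<sigma>..} s / s)" for s :: real
  define \<psi> where "\<psi> \<xi> = \<bar>\<xi>\<bar> powr \<alpha> - 2 * ln (1 + \<xi>\<^sup>2 / \<sigma>\<^sup>2)" for \<xi> :: real
  have [measurable]: "\<kappa> \<in> borel_measurable borel" unfolding \<kappa>_def by measurable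
  have \<kappa>0: "0 \<le> \<kappa> s" for s
  proof (cases "\<sigma> \<le> s")
    case True
    then have s: "s > 0" using \<sigma> by simp
    have "4 * c \<le> s powr \<alpha>" unfolding \<sigma>(2)[symmetric] using True \<sigma> \<alpha> by (intro powr_mono2) auto
    then have "4 / s \<le> s powr (\<alpha> - 1) / c" using s c by (simp add: powr_diff field_simps)
    then show ?thesis using True s by (simp add: \<kappa>_def)
  qed (use c in \<open>auto simp: \<kappa>_def indicator_def\<close>)
  have "\<exists>M. real_distribution M \<and> (\<forall>\<xi>. char M \<xi> = of_real (exp (- \<psi> \<xi>)))"
  proof (rule infinitely_divisible_exists[of \<kappa> \<psi> \<alpha>])
    show "\<kappa> s = 0" if "s \<le> 0" for s using that \<sigma> by (auto simp: \<kappa>_def indicator_def)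
    show "integrable lborel (\<lambda>s. indicator {..real n} s * \<kappa> s)" for n
    proof (rule Bochner_Integration.integrable_bound)
      have "has_bochner_integral lborel (\<lambda>s. indicator {0..real n} s * s powr (\<alpha> - 1)) (real n powr (\<alpha> - 1 + 1) / (\<alpha> - 1 + 1))"
        using \<alpha> by (intro has_bochner_integral_of_has_integral has_integral_powr_from_0) auto
      then show "integrable lborel (\<lambda>s. indicator {0..real n} s * s powr (\<alpha> - 1) / c)"
        by (intro integrable_divide) (rule integrable.intros)
      have "indicator {..real n} s * \<kappa> s \<le> indicator {0..real n} s * s powr (\<alpha> - 1) / c" for s
        using c \<sigma> by (auto simp: \<kappa>_def indicator_def)
      then show "AE s in lborel. norm (indicator {..real n} s * \<kappa> s) \<le> norm (indicator {0..real n} s * s powr (\<alpha> - 1) / c)"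
        using \<kappa>0 c by (intro AE_I2) (auto simp: abs_mult)
    qed measurable
    show "has_bochner_integral lborel (\<lambda>s. lap_defect \<xi> s * \<kappa> s) (\<psi> \<xi>)" for \<xi>
    proof -
      have "has_bochner_integral lborel (\<lambda>s. indicator {0<..} s * (lap_defect \<xi> s * s powr (\<alpha> - 1)) / c
          - 4 * (indicator {\<sigma>..} s * (lap_defect \<xi> s / s))) (c * \<bar>\<xi>\<bar> powr \<alpha> / c - 4 * (ln (1 + \<xi>\<^sup>2 / \<sigma>\<^sup>2) / 2))"
        by (intro has_bochner_integral_diff has_bochner_integral_divide_zero has_bochner_integral_mult_right J log_exponent \<sigma>)
      then show ?thesis using c by (simp add: \<psi>_def \<kappa>_def algebra_simps)
    qed
    show "\<psi> \<xi> \<le> \<bar>\<xi>\<bar> powr \<alpha>" for \<xi> by (simp add: \<psi>_def)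
  qed (use \<alpha> \<kappa>0 in auto)
  then obtain \<nu> where \<nu>: "real_distribution \<nu>" "\<And>\<xi>. char \<nu> \<xi> = of_real (exp (- \<psi> \<xi>))" by blast
  have "exp (- (\<bar>\<xi>\<bar> powr \<alpha>)) = 1 / (1 + (1 / \<sigma> * \<xi>)\<^sup>2) * (1 / (1 + (1 / \<sigma> * \<xi>)\<^sup>2)) * exp (- \<psi> \<xi>)" for \<xi>
  proof -
    have pos: "0 < 1 + \<xi>\<^sup>2 / \<sigma>\<^sup>2" by (intro add_pos_nonneg) auto
    have "exp (- \<psi> \<xi>) = exp (- (\<bar>\<xi>\<bar> powr \<alpha>)) * (exp (ln (1 + \<xi>\<^sup>2 / \<sigma>\<^sup>2)) * exp (ln (1 + \<xi>\<^sup>2 / \<sigma>\<^sup>2)))"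
      by (simp add: \<psi>_def flip: exp_add)
    also have "\<dots> = exp (- (\<bar>\<xi>\<bar> powr \<alpha>)) * ((1 + \<xi>\<^sup>2 / \<sigma>\<^sup>2) * (1 + \<xi>\<^sup>2 / \<sigma>\<^sup>2))" using pos by simp
    finally show ?thesis using pos by (simp add: power_divide)
  qed
  then show ?thesis
    using that[of "1 / \<sigma>" \<nu>] \<sigma> \<nu> by (simp only: char_laplace flip: of_real_mult) simp
qed

section \<open>Averaging over Laplace noise\<close>

definition bdd_cont :: "('a::topological_space \<Rightarrow> real) \<Rightarrow> real \<Rightarrow> bool" where
  "bdd_cont \<phi> K \<longleftrightarrow> continuous_on UNIV \<phi> \<and> (\<forall>x. \<bar>\<phi> x\<bar> \<le> K)"

text \<open>Convolution, up to reflection, with the law of a random multiple of \<open>v\<close>;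
  working along one direction at a time keeps these measures on the real line.\<close>

definition smear :: "real measure \<Rightarrow> 'h::real_normed_vector \<Rightarrow> ('h \<Rightarrow> real) \<Rightarrow> 'h \<Rightarrow> real" where
  "smear \<mu> v \<phi> x = (\<integral>w. \<phi> (x + w *\<^sub>R v) \<partial>\<mu>)"

lemma bdd_cont_nonneg: "bdd_cont \<phi> K \<Longrightarrow> 0 \<le> K"
  unfolding bdd_cont_def by (meson abs_ge_zero order_trans)

lemma bdd_cont_compose:
  "bdd_cont \<phi> K \<Longrightarrow> continuous_on UNIV f \<Longrightarrow> bdd_cont (\<lambda>x. \<phi> (f x)) K"
  unfolding bdd_cont_def by (auto intro: continuous_on_compose2)

lemma bdd_cont_square:
  assumes "bdd_cont \<phi> K"
  shows "bdd_cont (\<lambda>x. (\<phi> x)\<^sup>2) (K\<^sup>2)"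
  unfolding bdd_cont_def
proof (intro conjI allI)
  show "continuous_on UNIV (\<lambda>x. (\<phi> x)\<^sup>2)"
    using assms unfolding bdd_cont_def by (intro continuous_on_power) auto
  have "\<bar>\<phi> x\<bar>\<^sup>2 \<le> K\<^sup>2" for x using assms unfolding bdd_cont_def by (intro power_mono) auto
  then show "\<bar>(\<phi> x)\<^sup>2\<bar> \<le> K\<^sup>2" for x by simp
qed

lemma bdd_cont_measurable:
  "bdd_cont \<phi> K \<Longrightarrow> \<phi> \<in> borel_measurable borel"
  unfolding bdd_cont_def by (auto intro: borel_measurable_continuous_onI)

lemma bdd_cont_integrable:
  assumes "real_distribution \<mu>" "bdd_cont \<phi> K"
  shows "integrable \<mu> \<phi>"
proof -
  interpret real_distribution \<mu> by fact
  show ?thesis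
    using assms(2) bdd_cont_measurable[OF assms(2)]
    by (intro integrable_const_bound[where B=K]) (auto simp: bdd_cont_def)
qed

lemma abs_integral_le_bound:
  assumes "prob_space \<mu>" "\<And>x. \<bar>\<phi> x\<bar> \<le> (K::real)"
  shows "\<bar>\<integral>x. \<phi> x \<partial>\<mu>\<bar> \<le> K"
proof -
  interpret prob_space \<mu> by fact
  have K: "0 \<le> K" using assms(2) by (meson abs_ge_zero order_trans)
  show ?thesis
  \<comment> \<open>In the second case the integral has its default value 0, which also satisfies
    the bound.\<close>
  proof (cases "integrable \<mu> \<phi>")
    case True
    have "\<bar>\<integral>x. \<phi> x \<partial>\<mu>\<bar> \<le> (\<integral>x. \<bar>\<phi> x\<bar> \<partial>\<mu>)" by (rule integral_abs_bound)
    also have "\<dots> \<le> (\<integral>x. K \<partial>\<mu>)" using True assms(2) by (intro integral_mono) auto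
    finally show ?thesis using prob_space by simp
  qed (simp add: not_integrable_integral_eq K)
qed

lemma bdd_cont_smear:
  assumes \<mu>: "real_distribution \<mu>" and \<phi>: "bdd_cont \<phi> K"
  shows "bdd_cont (smear \<mu> v \<phi>) K"
proof -
  interpret real_distribution \<mu> by fact
  have sl: "bdd_cont (\<lambda>w::real. \<phi> (x + w *\<^sub>R v)) K" for x
    by (intro bdd_cont_compose[OF \<phi>] continuous_intros)
  have "continuous_on UNIV (smear \<mu> v \<phi>)"
    unfolding continuous_on_sequentially comp_def
  proof (intro allI ballI impI, elim conjE)
    fix X x assume X: "X \<longlonglongrightarrow> (x::'a)"
    show "(\<lambda>n. smear \<mu> v \<phi> (X n)) \<longlonglongrightarrow> smear \<mu> v \<phi> x"
      unfolding smear_def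
    proof (rule integral_dominated_convergence[where w="\<lambda>_. K"])
      show "AE w in \<mu>. (\<lambda>n. \<phi> (X n + w *\<^sub>R v)) \<longlonglongrightarrow> \<phi> (x + w *\<^sub>R v)"
      proof (rule AE_I2)
        fix w
        have "isCont \<phi> (x + w *\<^sub>R v)" using \<phi> by (simp add: bdd_cont_def continuous_on_eq_continuous_at)
        then show "(\<lambda>n. \<phi> (X n + w *\<^sub>R v)) \<longlonglongrightarrow> \<phi> (x + w *\<^sub>R v)"
          by (rule isCont_tendsto_compose) (intro tendsto_intros X)
      qed
      show "(\<lambda>w. \<phi> (x + w *\<^sub>R v)) \<in> borel_measurable \<mu>" "\<And>n. (\<lambda>w. \<phi> (X n + w *\<^sub>R v)) \<in> borel_measurable \<mu>"
        by (rule borel_measurable_integrable[OF bdd_cont_integrable[OF \<mu> sl]])+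
      show "integrable \<mu> (\<lambda>_. K)" by simp
      show "AE w in \<mu>. norm (\<phi> (X n + w *\<^sub>R v)) \<le> K" for n using \<phi> by (simp add: bdd_cont_def)
    qed
  qed
  moreover have "\<bar>smear \<mu> v \<phi> x\<bar> \<le> K" for x
    unfolding smear_def using \<phi> by (intro abs_integral_le_bound prob_space_axioms) (simp add: bdd_cont_def)
  ultimately show ?thesis by (simp add: bdd_cont_def)
qed

lemma smear_translate: "smear \<mu> v (\<lambda>y. \<phi> (y + a)) = (\<lambda>x. smear \<mu> v \<phi> (x + a))"
  unfolding smear_def by (simp add: ac_simps)

lemma bdd_cont_slice:
  fixes v :: "'h::real_normed_vector"
  shows "bdd_cont \<phi> K \<Longrightarrow> bdd_cont (\<lambda>w::real. \<phi> (x + w *\<^sub>R v)) K"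
  by (erule bdd_cont_compose) (intro continuous_intros)

lemma smear_diff:
  assumes "real_distribution \<mu>" "bdd_cont \<phi> K" "bdd_cont \<psi> L"
  shows "smear \<mu> v (\<lambda>y. \<phi> y - \<psi> y) = (\<lambda>x. smear \<mu> v \<phi> x - smear \<mu> v \<psi> x)"
  unfolding smear_def
  by (intro ext Bochner_Integration.integral_diff bdd_cont_integrable[OF assms(1) bdd_cont_slice[OF assms(2)]]
      bdd_cont_integrable[OF assms(1) bdd_cont_slice[OF assms(3)]])

lemma smear_scale:
  assumes "real_distribution \<mu>" "bdd_cont \<phi> K"
  shows "smear (distr \<mu> borel (\<lambda>x. c * x)) v \<phi> = smear \<mu> (c *\<^sub>R v) \<phi>"
proof -
  interpret real_distribution \<mu> by fact
  show ?thesis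
    unfolding smear_def using bdd_cont_measurable[OF bdd_cont_slice[OF assms(2)]]
    by (subst integral_distr) (auto simp: ac_simps)
qed

lemma bdd_cont_pair_integrable:
  fixes v v' :: "'h::real_normed_vector"
  assumes "real_distribution \<mu>" "real_distribution \<nu>" "bdd_cont \<phi> K"
  shows "integrable (\<mu> \<Otimes>\<^sub>M \<nu>) (\<lambda>(w::real, w'::real). \<phi> (x + w *\<^sub>R v + w' *\<^sub>R v'))"
proof -
  interpret \<mu>: real_distribution \<mu> by fact
  interpret \<nu>: real_distribution \<nu> by fact
  interpret pair_prob_space \<mu> \<nu> ..
  have "bdd_cont (\<lambda>z::real\<times>real. \<phi> (x + fst z *\<^sub>R v + snd z *\<^sub>R v')) K"
    by (intro bdd_cont_compose[OF assms(3)] continuous_intros)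
  then have "(\<lambda>z::real\<times>real. \<phi> (x + fst z *\<^sub>R v + snd z *\<^sub>R v')) \<in> borel_measurable (borel \<Otimes>\<^sub>M borel)"
    unfolding borel_prod by (rule bdd_cont_measurable)
  then have "(\<lambda>z. \<phi> (x + fst z *\<^sub>R v + snd z *\<^sub>R v')) \<in> borel_measurable (\<mu> \<Otimes>\<^sub>M \<nu>)"
    by (subst measurable_cong_sets[OF sets_pair_measure_cong refl, of _ borel _ borel]) simp_all
  then show ?thesis
    using assms(3) by (intro integrable_const_bound[where B=K]) (auto simp: bdd_cont_def case_prod_beta)
qed

lemma smear_commute:
  assumes "real_distribution \<mu>" "real_distribution \<nu>" "bdd_cont \<phi> K"
  shows "smear \<mu> v (smear \<nu> v' \<phi>) = smear \<nu> v' (smear \<mu> v \<phi>)"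
proof
  fix x
  interpret \<mu>: real_distribution \<mu> by fact
  interpret \<nu>: real_distribution \<nu> by fact
  interpret pair_prob_space \<mu> \<nu> ..
  show "smear \<mu> v (smear \<nu> v' \<phi>) x = smear \<nu> v' (smear \<mu> v \<phi>) x"
    using Fubini_integral[OF bdd_cont_pair_integrable[OF assms, of x v v']]
    unfolding smear_def by (simp add: ac_simps)
qed

lemma smear_convolution:
  assumes "real_distribution \<mu>" "real_distribution \<nu>" "bdd_cont \<phi> K"
  shows "smear (\<mu> \<star> \<nu>) v \<phi> = smear \<mu> v (smear \<nu> v \<phi>)"
proof
  fix x
  interpret \<mu>: real_distribution \<mu> by fact
  interpret \<nu>: real_distribution \<nu> by fact
  interpret pair_prob_space \<mu> \<nu> ..
  have "smear (\<mu> \<star> \<nu>) v \<phi> x = (\<integral>z. \<phi> (x + fst z *\<^sub>R v + snd z *\<^sub>R v) \<partial>(\<mu> \<Otimes>\<^sub>M \<nu>))"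
    unfolding smear_def convolution_def
    using bdd_cont_measurable[OF bdd_cont_slice[OF assms(3)]]
    by (subst integral_distr) (auto simp: case_prod_beta scaleR_add_left add.assoc)
  also have "\<dots> = smear \<mu> v (smear \<nu> v \<phi>) x"
    unfolding smear_def
    by (subst integral_fst'[symmetric]) (use bdd_cont_pair_integrable[OF assms, of x v v] in \<open>simp_all add: case_prod_unfold\<close>)
  finally show "smear (\<mu> \<star> \<nu>) v \<phi> x = smear \<mu> v (smear \<nu> v \<phi>) x" .
qed

text \<open>The effect on \<open>\<phi>\<close> of adding \<open>w n *\<^sub>R V n\<close> for all
  \<open>n < N\<close>, the \<open>w n\<close> being independent of law \<open>\<mu>\<close>.
  Iterated integrals replace a product measure and allow induction on the dimension.\<close>

primrec smears :: "real measure \<Rightarrow> (nat \<Rightarrow> 'h::real_normed_vector) \<Rightarrow> nat \<Rightarrow> ('h \<Rightarrow> real) \<Rightarrow> 'h \<Rightarrow> real" where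
  "smears \<mu> V 0 \<phi> = \<phi>"
| "smears \<mu> V (Suc N) \<phi> = smear \<mu> (V N) (smears \<mu> V N \<phi>)"

lemma bdd_cont_smears:
  "real_distribution \<mu> \<Longrightarrow> bdd_cont \<phi> K \<Longrightarrow> bdd_cont (smears \<mu> V N \<phi>) K"
  by (induction N) (auto intro: bdd_cont_smear)

lemma smears_translate: "smears \<mu> V N (\<lambda>y. \<phi> (y + a)) = (\<lambda>x. smears \<mu> V N \<phi> (x + a))"
  by (induction N) (simp_all add: smear_translate)

lemma smears_diff:
  assumes "real_distribution \<mu>" "bdd_cont \<phi> K" "bdd_cont \<psi> L"
  shows "smears \<mu> V N (\<lambda>y. \<phi> y - \<psi> y) = (\<lambda>x. smears \<mu> V N \<phi> x - smears \<mu> V N \<psi> x)"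
  by (induction N)
    (simp_all add: smear_diff[OF assms(1) bdd_cont_smears[OF assms(1,2)] bdd_cont_smears[OF assms(1,3)]])

lemma smear_smears_commute:
  assumes "real_distribution \<mu>" "real_distribution \<nu>" "bdd_cont \<phi> K"
  shows "smear \<mu> v (smears \<nu> V N \<phi>) = smears \<nu> V N (smear \<mu> v \<phi>)"
  by (induction N) (simp_all add: smear_commute[OF assms(1,2) bdd_cont_smears[OF assms(2,3)]])

lemma smears_convolution:
  assumes "real_distribution \<mu>" "real_distribution \<nu>" "bdd_cont \<phi> K"
  shows "smears (\<mu> \<star> \<nu>) V N \<phi> = smears \<mu> V N (smears \<nu> V N \<phi>)"
proof (induction N)
  case (Suc N)
  have "smears (\<mu> \<star> \<nu>) V (Suc N) \<phi> = smear \<mu> (V N) (smear \<nu> (V N) (smears \<mu> V N (smears \<nu> V N \<phi>)))"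
    by (simp add: Suc smear_convolution[OF assms(1,2) bdd_cont_smears[OF assms(1) bdd_cont_smears[OF assms(2,3)]]])
  also have "\<dots> = smears \<mu> V (Suc N) (smears \<nu> V (Suc N) \<phi>)"
    by (simp add: smear_smears_commute[OF assms(2,1) bdd_cont_smears[OF assms(2,3)]])
  finally show ?case .
qed simp

lemma smears_scale:
  assumes "real_distribution \<mu>" "bdd_cont \<phi> K"
  shows "smears (distr \<mu> borel (\<lambda>x. c * x)) V N \<phi> = smears \<mu> (\<lambda>n. c *\<^sub>R V n) N \<phi>"
  by (induction N) (simp_all add: smear_scale[OF assms(1) bdd_cont_smears[OF assms]])

section \<open>Shifted products of Laplace laws: the chi-square estimate\<close>

lemma square_integral_le:
  fixes f G E :: "'a \<Rightarrow> real"
  assumes i: "integrable M f" "integrable M G" "integrable M E"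
    and nn: "\<And>x. 0 \<le> G x" "\<And>x. 0 \<le> E x" and le: "\<And>x. (f x)\<^sup>2 \<le> G x * E x"
  shows "(\<integral>x. f x \<partial>M)\<^sup>2 \<le> (\<integral>x. G x \<partial>M) * (\<integral>x. E x \<partial>M)"
proof -
  define X P Q where "X = (\<integral>x. f x \<partial>M)" and "P = (\<integral>x. G x \<partial>M)" and "Q = (\<integral>x. E x \<partial>M)"
  have PQ: "0 \<le> P" "0 \<le> Q" unfolding P_def Q_def using nn by (auto intro: integral_nonneg_AE)
  \<comment> \<open>Cauchy-Schwarz by the discriminant: this quadratic in \<open>t\<close> is
    nonnegative because its integrand is, by \<open>f^2 \<le> G * E\<close> pointwise.\<close>
  have q: "0 \<le> t\<^sup>2 * P + 2 * t * X + Q" for t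
  proof -
    have "0 \<le> t\<^sup>2 * G x + 2 * t * f x + E x" for x
    proof -
      have "(2 * \<bar>t * f x\<bar>)\<^sup>2 \<le> 4 * ((t\<^sup>2 * G x) * E x)"
        using mult_left_mono[OF le[of x], of "4 * t\<^sup>2"] by (simp add: power_mult_distrib)
      also have "\<dots> \<le> (t\<^sup>2 * G x + E x)\<^sup>2"
        using zero_le_power2[of "t\<^sup>2 * G x - E x"] by (simp add: power2_eq_square algebra_simps)
      finally have "2 * \<bar>t * f x\<bar> \<le> t\<^sup>2 * G x + E x"
        by (rule power2_le_imp_le) (use nn in simp)
      then show ?thesis using abs_ge_minus_self[of "t * f x"] by linarith
    qed
    then have "0 \<le> (\<integral>x. t\<^sup>2 * G x + 2 * t * f x + E x \<partial>M)" by (intro integral_nonneg_AE AE_I2)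
    then show ?thesis using i by (simp add: X_def P_def Q_def)
  qed
  have "X\<^sup>2 \<le> P * Q"
  proof (cases "P = 0")
    case True
    have "X = 0"
    proof (rule ccontr)
      assume "X \<noteq> 0"
      \<comment> \<open>This \<open>t\<close> makes \<open>2 * t * X + Q\<close> equal to
        -1.\<close>
      then show False using q[of "- (Q + 1) / (2 * X)"] True by (simp add: field_simps)
    qed
    then show ?thesis using PQ by simp
  next
    case False
    then show ?thesis using q[of "- X / P"] PQ by (simp add: power2_eq_square field_simps)
  qed
  then show ?thesis by (simp add: X_def P_def Q_def)
qed

text \<open>Density of the Laplace law translated by \<open>h\<close> with respect to the Laplace
  law itself.\<close>

definition lap_ratio :: "real \<Rightarrow> real \<Rightarrow> real" where
  "lap_ratio h w = exp (\<bar>w\<bar> - \<bar>w - h\<bar>)"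

lemma lap_ratio_pos: "0 < lap_ratio h w"
  and lap_ratio_le: "lap_ratio h w \<le> exp \<bar>h\<bar>"
  and lap_ratio_dev: "\<bar>lap_ratio h w - 1\<bar> \<le> exp \<bar>h\<bar> - 1"
  and lap_ratio_cont: "continuous_on UNIV (lap_ratio h)"
proof -
  show "0 < lap_ratio h w" by (simp add: lap_ratio_def)
  show le: "lap_ratio h w \<le> exp \<bar>h\<bar>" unfolding lap_ratio_def exp_le_cancel_iff by linarith
  have "exp (- \<bar>h\<bar>) \<le> lap_ratio h w" unfolding lap_ratio_def exp_le_cancel_iff by linarith
  \<comment> \<open>Makes the deviation below 1, at most \<open>1 - exp (- \<bar>h\<bar>)\<close>,
    no larger than the bound \<open>exp \<bar>h\<bar> - 1\<close> for the one above.\<close>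
  moreover have "2 \<le> exp \<bar>h\<bar> + exp (- \<bar>h\<bar>)"
    using exp_ge_add_one_self[of "\<bar>h\<bar>"] exp_ge_add_one_self[of "- \<bar>h\<bar>"] by linarith
  ultimately show "\<bar>lap_ratio h w - 1\<bar> \<le> exp \<bar>h\<bar> - 1" using le by linarith
  show "continuous_on UNIV (lap_ratio h)" unfolding lap_ratio_def[abs_def] by (intro continuous_intros)
qed

lemma laplace_shift:
  assumes "bdd_cont \<psi> K"
  shows "(\<integral>w. \<psi> (w + h) \<partial>laplace) = (\<integral>w. lap_ratio h w * \<psi> w \<partial>laplace)"
proof -
  have [measurable]: "\<psi> \<in> borel_measurable borel" "lap_ratio h \<in> borel_measurable borel"
    using assms bdd_cont_measurable lap_ratio_cont borel_measurable_continuous_onI by blast+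
  have "(\<integral>w. \<psi> (w + h) \<partial>laplace) = (\<integral>w. exp (- \<bar>w\<bar>) / 2 * \<psi> (w + h) \<partial>lborel)"
    unfolding laplace_def by (subst integral_density) auto
  also have "\<dots> = (\<integral>w. exp (- \<bar>w - h\<bar>) / 2 * \<psi> w \<partial>lborel)"
    by (subst (2) lborel_integral_real_affine[of 1 _ h]) (auto simp: ac_simps)
  also have "\<dots> = (\<integral>w. exp (- \<bar>w\<bar>) / 2 * (lap_ratio h w * \<psi> w) \<partial>lborel)"
    by (intro Bochner_Integration.integral_cong refl) (simp add: lap_ratio_def flip: exp_add mult.assoc)
  also have "\<dots> = (\<integral>w. lap_ratio h w * \<psi> w \<partial>laplace)"
    unfolding laplace_def by (subst integral_density) auto
  finally show ?thesis .
qed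

lemma lap_ratio_moments:
  shows "bdd_cont (lap_ratio h) (exp \<bar>h\<bar>)" "(\<integral>w. lap_ratio h w \<partial>laplace) = 1"
    "integrable laplace (lap_ratio h)" "integrable laplace (\<lambda>w. (lap_ratio h w)\<^sup>2)"
    "(\<integral>w. (lap_ratio h w)\<^sup>2 \<partial>laplace) \<le> 1 + (exp \<bar>h\<bar> - 1)\<^sup>2"
proof -
  interpret L: real_distribution laplace by (rule real_distribution_laplace)
  show b: "bdd_cont (lap_ratio h) (exp \<bar>h\<bar>)"
    using lap_ratio_pos[of h] lap_ratio_le[of h] lap_ratio_cont[of h] by (auto simp: bdd_cont_def abs_of_pos)
  have one: "bdd_cont (\<lambda>_::real. 1) 1" by (simp add: bdd_cont_def)
  show m1: "(\<integral>w. lap_ratio h w \<partial>laplace) = 1"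
    using laplace_shift[OF one, of h] L.prob_space by simp
  show i1: "integrable laplace (lap_ratio h)" by (rule bdd_cont_integrable[OF real_distribution_laplace b])
  have "bdd_cont (\<lambda>w. (lap_ratio h w)\<^sup>2) ((exp \<bar>h\<bar>)\<^sup>2)"
    by (rule bdd_cont_square[OF b])
  then show i2: "integrable laplace (\<lambda>w. (lap_ratio h w)\<^sup>2)" by (rule bdd_cont_integrable[OF real_distribution_laplace])
  \<comment> \<open>From \<open>r^2 = 2 * r - 1 + (r - 1)^2\<close>, where \<open>r\<close> has mean
    1: the excess over 1 is of second order in \<open>h\<close>, so that the product over the
    coordinates is controlled by the sum of squares.\<close>
  have "(\<integral>w. (lap_ratio h w)\<^sup>2 \<partial>laplace) \<le> (\<integral>w. 2 * lap_ratio h w - 1 + (exp \<bar>h\<bar> - 1)\<^sup>2 \<partial>laplace)"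
  proof (rule integral_mono)
    fix w
    have "(lap_ratio h w - 1)\<^sup>2 \<le> (exp \<bar>h\<bar> - 1)\<^sup>2"
      using lap_ratio_dev[of h w] by (subst abs_le_square_iff[symmetric]) auto
    then show "(lap_ratio h w)\<^sup>2 \<le> 2 * lap_ratio h w - 1 + (exp \<bar>h\<bar> - 1)\<^sup>2"
      by (simp add: power2_diff)
  qed (use i1 i2 in auto)
  also have "\<dots> = 1 + (exp \<bar>h\<bar> - 1)\<^sup>2" using i1 m1 L.prob_space by simp
  finally show "(\<integral>w. (lap_ratio h w)\<^sup>2 \<partial>laplace) \<le> 1 + (exp \<bar>h\<bar> - 1)\<^sup>2" .
qed

text \<open>The parameter \<open>s\<close> makes the chi-square bound tensorise: on the right stands the integral of
  \<open>(r + s)\<^sup>2\<close>, \<open>r\<close> being the density of the shifted product law, and the induction applies the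
  hypothesis with \<open>s\<close> divided by the one-dimensional density. Only \<open>s = - 1\<close> is of interest.\<close>

lemma smears_laplace_chi_square:
  fixes V :: "nat \<Rightarrow> 'h::real_normed_vector"
  assumes \<phi>: "bdd_cont \<phi> K"
  shows "(smears laplace V N \<phi> (x + (\<Sum>n<N. h n *\<^sub>R V n)) + s * smears laplace V N \<phi> x)\<^sup>2
    \<le> ((\<Prod>n<N. 1 + (exp \<bar>h n\<bar> - 1)\<^sup>2) + 2 * s + s\<^sup>2) * smears laplace V N (\<lambda>y. (\<phi> y)\<^sup>2) x"
proof (induction N arbitrary: x s)
  case 0
  have "1 + 2 * s + s\<^sup>2 = (1 + s)\<^sup>2" by (simp add: power2_eq_square algebra_simps)
  then show ?case by (simp add: power2_eq_square algebra_simps)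
next
  case (Suc N)
  note L = real_distribution_laplace
  interpret L: real_distribution laplace by (rule L)
  let ?Q = "smears laplace V N" and ?B = "\<Prod>n<N. 1 + (exp \<bar>h n\<bar> - 1)\<^sup>2"
  let ?a = "\<Sum>n<N. h n *\<^sub>R V n" and ?v = "V N" and ?k = "h N"
  let ?r = "lap_ratio ?k"
  have \<phi>2: "bdd_cont (\<lambda>y. (\<phi> y)\<^sup>2) (K\<^sup>2)"
    by (rule bdd_cont_square[OF \<phi>])
  have Q1: "bdd_cont (?Q \<phi>) K" and Q2: "bdd_cont (?Q (\<lambda>y. (\<phi> y)\<^sup>2)) (K\<^sup>2)"
    by (intro bdd_cont_smears L \<phi> \<phi>2)+
  define g where "g w = ?Q \<phi> (x + w *\<^sub>R ?v + ?a)" for w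
  define f where "f w = ?Q \<phi> (x + w *\<^sub>R ?v)" for w
  define E where "E w = ?Q (\<lambda>y. (\<phi> y)\<^sup>2) (x + w *\<^sub>R ?v)" for w
  \<comment> \<open>\<open>(?r w)^2\<close> times the factor of the induction hypothesis at
    \<open>s / ?r w\<close>.\<close>
  define G where "G w = ?B * (?r w)\<^sup>2 + 2 * s * ?r w + s\<^sup>2" for w
  have bg: "bdd_cont g K" and bf: "bdd_cont f K" and bE: "bdd_cont E (K\<^sup>2)"
    unfolding g_def f_def E_def by (intro bdd_cont_compose[OF Q1] bdd_cont_compose[OF Q2] continuous_intros)+
  have B1: "1 \<le> ?B" by (intro prod_ge_1) auto
  have G0: "0 \<le> G w" for w
  proof -
    have "G w = (?B - 1) * (?r w)\<^sup>2 + (?r w + s)\<^sup>2" by (simp add: G_def power2_eq_square algebra_simps)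
    also have "\<dots> \<ge> 0" using B1 by (intro add_nonneg_nonneg mult_nonneg_nonneg) auto
    finally show ?thesis .
  qed
  have E0: "0 \<le> E w" for w
  proof -
    have "0 \<le> ?Q (\<lambda>y. (\<phi> y)\<^sup>2) z" for z
      by (induction N arbitrary: z) (auto simp: smear_def intro!: integral_nonneg_AE)
    then show ?thesis by (simp add: E_def)
  qed
  have pw: "(?r w * g w + s * f w)\<^sup>2 \<le> G w * E w" for w
  proof -
    have "(g w + s / ?r w * f w)\<^sup>2 \<le> (?B + 2 * (s / ?r w) + (s / ?r w)\<^sup>2) * E w"
      unfolding g_def f_def E_def using Suc[of "x + w *\<^sub>R ?v" "s / ?r w"] by simp
    then have "(?r w)\<^sup>2 * (g w + s / ?r w * f w)\<^sup>2 \<le> (?r w)\<^sup>2 * ((?B + 2 * (s / ?r w) + (s / ?r w)\<^sup>2) * E w)"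
      by (intro mult_left_mono) auto
    moreover have "(?r w)\<^sup>2 * (g w + s / ?r w * f w)\<^sup>2 = (?r w * g w + s * f w)\<^sup>2"
      using lap_ratio_pos[of ?k w] by (simp add: distrib_left flip: power_mult_distrib)
    moreover have "(?r w)\<^sup>2 * (?B + 2 * (s / ?r w) + (s / ?r w)\<^sup>2) = G w"
      using lap_ratio_pos[of ?k w] by (simp add: G_def power2_eq_square field_simps)
    ultimately show ?thesis by (simp add: mult.assoc[symmetric])
  qed
  have bg': "bdd_cont (\<lambda>w. ?r w * g w) (exp \<bar>?k\<bar> * K)"
    using lap_ratio_moments(1)[of ?k] bg unfolding bdd_cont_def
    by (auto intro!: continuous_intros simp: abs_mult mult_mono)
  have irg: "integrable laplace (\<lambda>w. ?r w * g w)" and if': "integrable laplace f" and iE: "integrable laplace E"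
    using bdd_cont_integrable[OF L bg'] bdd_cont_integrable[OF L bf] bdd_cont_integrable[OF L bE] by auto
  have iG: "integrable laplace G" unfolding G_def using lap_ratio_moments(3,4) by simp
  have "smears laplace V (Suc N) \<phi> (x + (\<Sum>n<Suc N. h n *\<^sub>R V n)) = (\<integral>w. g (w + ?k) \<partial>laplace)"
    unfolding g_def by (simp add: smear_def scaleR_add_left ac_simps)
  also have "\<dots> = (\<integral>w. ?r w * g w \<partial>laplace)" by (rule laplace_shift[OF bg])
  finally have shifted: "smears laplace V (Suc N) \<phi> (x + (\<Sum>n<Suc N. h n *\<^sub>R V n)) = (\<integral>w. ?r w * g w \<partial>laplace)" .
  have "smears laplace V (Suc N) \<phi> (x + (\<Sum>n<Suc N. h n *\<^sub>R V n)) + s * smears laplace V (Suc N) \<phi> x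
      = (\<integral>w. ?r w * g w + s * f w \<partial>laplace)"
  proof -
    have "smears laplace V (Suc N) \<phi> x = (\<integral>w. f w \<partial>laplace)" by (simp add: smear_def f_def)
    moreover have "(\<integral>w. ?r w * g w + s * f w \<partial>laplace) = (\<integral>w. ?r w * g w \<partial>laplace) + s * (\<integral>w. f w \<partial>laplace)"
      using irg if' by simp
    ultimately show ?thesis unfolding shifted by simp
  qed
  then have "(smears laplace V (Suc N) \<phi> (x + (\<Sum>n<Suc N. h n *\<^sub>R V n)) + s * smears laplace V (Suc N) \<phi> x)\<^sup>2
      \<le> (\<integral>w. G w \<partial>laplace) * (\<integral>w. E w \<partial>laplace)"
    using square_integral_le[of laplace "\<lambda>w. ?r w * g w + s * f w" G E] irg if' iG iE G0 E0 pw by simp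
  also have "(\<integral>w. G w \<partial>laplace) = ?B * (\<integral>w. (?r w)\<^sup>2 \<partial>laplace) + 2 * s + s\<^sup>2"
    unfolding G_def using lap_ratio_moments(2,3,4)[of ?k] L.prob_space by simp
  also have "\<dots> * (\<integral>w. E w \<partial>laplace) \<le> (?B * (1 + (exp \<bar>?k\<bar> - 1)\<^sup>2) + 2 * s + s\<^sup>2) * (\<integral>w. E w \<partial>laplace)"
    using B1 E0 lap_ratio_moments(5)[of ?k]
    by (intro mult_right_mono add_right_mono mult_left_mono integral_nonneg_AE) auto
  finally show ?case by (simp add: E_def smear_def)
qed

text \<open>At \<open>s = - 1\<close> the chi-square factor is the product minus 1. If the sum of
  squares \<open>?S\<close> is at most 1, the factor is at most
  \<open>exp (4 * ?S) - 1 \<le> 4 * exp 4 * ?S\<close>, whose square root produces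
  \<open>2 * exp 2\<close>; otherwise boundedness of \<open>\<phi>\<close> suffices.\<close>

lemma smears_laplace_diff:
  fixes V :: "nat \<Rightarrow> 'h::real_normed_vector"
  assumes \<phi>: "bdd_cont \<phi> K"
  shows "\<bar>smears laplace V N \<phi> (x + (\<Sum>n<N. h n *\<^sub>R V n)) - smears laplace V N \<phi> x\<bar>
    \<le> 2 * exp 2 * K * sqrt (\<Sum>n<N. (h n)\<^sup>2)"
proof -
  let ?Q = "smears laplace V N" and ?S = "\<Sum>n<N. (h n)\<^sup>2"
  let ?d = "?Q \<phi> (x + (\<Sum>n<N. h n *\<^sub>R V n)) - ?Q \<phi> x"
  note L = real_distribution_laplace
  have K: "0 \<le> K" by (rule bdd_cont_nonneg[OF \<phi>])
  have S0: "0 \<le> ?S" by (intro sum_nonneg) auto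
  show ?thesis
  proof (cases "?S \<le> 1")
    case True
    have "(\<Prod>n<N. 1 + (exp \<bar>h n\<bar> - 1)\<^sup>2) \<le> (\<Prod>n<N. exp (4 * (h n)\<^sup>2))"
    proof (rule prod_mono, intro conjI)
      fix n assume n: "n \<in> {..<N}"
      have "(h n)\<^sup>2 \<le> ?S" using n by (intro member_le_sum) auto
      then have "(h n)\<^sup>2 \<le> 1\<^sup>2" using True by simp
      then have h1: "\<bar>h n\<bar> \<le> 1" using abs_le_square_iff[of "h n" 1] by simp
      have "exp \<bar>h n\<bar> \<le> 1 + \<bar>h n\<bar> + \<bar>h n\<bar>\<^sup>2" using h1 by (intro exp_bound) auto
      also have "\<bar>h n\<bar>\<^sup>2 \<le> \<bar>h n\<bar>" unfolding power2_eq_square using h1 by (intro mult_left_le) auto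
      finally have "exp \<bar>h n\<bar> - 1 \<le> 2 * \<bar>h n\<bar>" by simp
      then have "(exp \<bar>h n\<bar> - 1)\<^sup>2 \<le> (2 * \<bar>h n\<bar>)\<^sup>2" by (intro power_mono) auto
      then have "1 + (exp \<bar>h n\<bar> - 1)\<^sup>2 \<le> 1 + 4 * (h n)\<^sup>2" by (simp add: power_mult_distrib)
      also have "\<dots> \<le> exp (4 * (h n)\<^sup>2)" by (rule exp_ge_add_one_self)
      finally show "1 + (exp \<bar>h n\<bar> - 1)\<^sup>2 \<le> exp (4 * (h n)\<^sup>2)" .
    qed auto
    also have "\<dots> = exp (4 * ?S)" by (simp add: exp_sum sum_distrib_left)
    finally have B: "(\<Prod>n<N. 1 + (exp \<bar>h n\<bar> - 1)\<^sup>2) \<le> exp (4 * ?S)" .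
    have "1 - 4 * ?S \<le> exp (- (4 * ?S))" using exp_ge_add_one_self[of "- (4 * ?S)"] by simp
    then have "exp (4 * ?S) * (1 - 4 * ?S) \<le> exp (4 * ?S) * exp (- (4 * ?S))" by (intro mult_left_mono) auto
    then have "exp (4 * ?S) - 1 \<le> 4 * ?S * exp (4 * ?S)" by (simp add: exp_minus algebra_simps)
    also have "\<dots> \<le> 4 * ?S * exp 4" using True S0 by (intro mult_left_mono) auto
    also have "\<dots> = 4 * exp 4 * ?S" by (simp add: ac_simps)
    finally have BB: "(\<Prod>n<N. 1 + (exp \<bar>h n\<bar> - 1)\<^sup>2) - 1 \<le> 4 * exp 4 * ?S" using B by linarith
    have \<phi>2: "bdd_cont (\<lambda>y. (\<phi> y)\<^sup>2) (K\<^sup>2)"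
      by (rule bdd_cont_square[OF \<phi>])
    have Q2: "?Q (\<lambda>y. (\<phi> y)\<^sup>2) x \<le> K\<^sup>2"
      using bdd_cont_smears[OF L \<phi>2, of V N] by (auto simp: bdd_cont_def dest: spec[of _ x])
    have "?d\<^sup>2 \<le> ((\<Prod>n<N. 1 + (exp \<bar>h n\<bar> - 1)\<^sup>2) - 1) * ?Q (\<lambda>y. (\<phi> y)\<^sup>2) x"
      using smears_laplace_chi_square[OF \<phi>, of V N x h "- 1"] by simp
    also have "\<dots> \<le> ((\<Prod>n<N. 1 + (exp \<bar>h n\<bar> - 1)\<^sup>2) - 1) * K\<^sup>2"
      by (intro mult_left_mono Q2) (simp add: prod_ge_1)
    also have "\<dots> \<le> 4 * exp 4 * ?S * K\<^sup>2" by (intro mult_right_mono BB) simp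
    also have "\<dots> = (2 * exp 2 * K * sqrt ?S)\<^sup>2"
    proof -
      have "(exp 2)\<^sup>2 = (exp 4 :: real)" by (simp add: power2_eq_square flip: exp_add)
      then show ?thesis using S0 by (simp add: power_mult_distrib)
    qed
    finally show ?thesis
      using abs_le_square_iff[of ?d "2 * exp 2 * K * sqrt ?S"] K S0 by simp
  next
    case False
    have "\<bar>?Q \<phi> y\<bar> \<le> K" for y using bdd_cont_smears[OF L \<phi>, of V N] by (simp add: bdd_cont_def)
    from this[of x] this[of "x + (\<Sum>n<N. h n *\<^sub>R V n)"] have "\<bar>?d\<bar> \<le> 2 * K * 1" by linarith
    also have "\<dots> \<le> 2 * K * (exp 2 * sqrt ?S)"
    proof (intro mult_left_mono)
      have "1 * 1 \<le> exp 2 * sqrt ?S" using False by (intro mult_mono) auto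
      then show "1 \<le> exp 2 * sqrt ?S" by simp
    qed (use K in auto)
    finally show ?thesis by (simp add: ac_simps)
  qed
qed

abbreviation second_diff :: "('a::ab_semigroup_add \<Rightarrow> real) \<Rightarrow> 'a \<Rightarrow> 'a \<Rightarrow> 'a \<Rightarrow> real" where
  "second_diff f x a b \<equiv> f (x + a + b) - f (x + a) - f (x + b) + f x"

text \<open>Averages commute with translations, so the first difference of \<open>P\<close> along
  \<open>a\<close> is the outer Laplace average of \<open>\<eta>\<close>, the first difference of
  the inner one. The first estimate bounds \<open>\<eta>\<close>; applied once more, with this bound
  in the role of \<open>K\<close>, it produces the product.\<close>

lemma smears_second_diff:
  fixes V :: "nat \<Rightarrow> 'h::real_normed_vector" and \<nu> :: "real measure" and b :: real and N :: nat
  assumes \<phi>: "bdd_cont \<phi> K" and \<nu>: "real_distribution \<nu>"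
  defines "\<mu> \<equiv> distr laplace borel (\<lambda>x. b * x) \<star> (distr laplace borel (\<lambda>x. b * x) \<star> \<nu>)"
  defines "P \<equiv> smears \<mu> V N \<phi>"
  assumes "b \<noteq> 0" and a: "a = (\<Sum>n<N. h n *\<^sub>R V n)" and a': "a' = (\<Sum>n<N. h' n *\<^sub>R V n)"
  defines "c \<equiv> 2 * exp 2 / \<bar>b\<bar>"
  shows "\<bar>P (x + a) - P x\<bar> \<le> c * K * sqrt (\<Sum>n<N. (h n)\<^sup>2)"
    "\<bar>second_diff P x a a'\<bar>
      \<le> c * (c * K * sqrt (\<Sum>n<N. (h n)\<^sup>2)) * sqrt (\<Sum>n<N. (h' n)\<^sup>2)"
proof -
  note L = real_distribution_laplace
  note Lb = char_distr_scale(1)[OF L, of b]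
  let ?Lb = "distr laplace borel (\<lambda>x. b * x)" and ?W = "\<lambda>n. b *\<^sub>R V n"
  let ?Q = "smears laplace ?W N"
  have Q: "smears ?Lb V N \<psi> = ?Q \<psi>" if "bdd_cont \<psi> L" for \<psi> L by (rule smears_scale[OF real_distribution_laplace that])
  have diff: "\<bar>?Q \<psi> (y + (\<Sum>n<N. k n *\<^sub>R V n)) - ?Q \<psi> y\<bar> \<le> c * L * sqrt (\<Sum>n<N. (k n)\<^sup>2)"
    if "bdd_cont \<psi> L" for \<psi> L y k
  proof -
    \<comment> \<open>In units of the rescaled directions \<open>b *\<^sub>R V n\<close> the
      coordinates are divided by \<open>b\<close>; this is the \<open>1 / \<bar>b\<bar>\<close> in
      \<open>c\<close>.\<close>
    have "(\<Sum>n<N. (k n / b) *\<^sub>R ?W n) = (\<Sum>n<N. k n *\<^sub>R V n)" using \<open>b \<noteq> 0\<close> by simp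
    moreover have "sqrt (\<Sum>n<N. (k n / b)\<^sup>2) = sqrt (\<Sum>n<N. (k n)\<^sup>2) / \<bar>b\<bar>"
      by (simp add: power_divide real_sqrt_divide flip: sum_divide_distrib)
    ultimately show ?thesis
      using smears_laplace_diff[OF that, of ?W N y "\<lambda>n. k n / b"] by (simp add: c_def)
  qed
  define \<psi> where "\<psi> = smears \<nu> V N \<phi>"
  have \<psi>: "bdd_cont \<psi> K" unfolding \<psi>_def by (rule bdd_cont_smears[OF \<nu> \<phi>])
  have Q\<psi>: "bdd_cont (?Q \<psi>) K" by (rule bdd_cont_smears[OF L \<psi>])
  have P: "P = ?Q (?Q \<psi>)"
    unfolding P_def \<mu>_def
    by (simp add: smears_convolution[OF Lb char_convolution(1)[OF Lb \<nu>] \<phi>] smears_convolution[OF Lb \<nu> \<phi>]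
        Q[OF \<psi>] Q[OF Q\<psi>] flip: \<psi>_def)
  show "\<bar>P (x + a) - P x\<bar> \<le> c * K * sqrt (\<Sum>n<N. (h n)\<^sup>2)"
    unfolding P a by (rule diff[OF Q\<psi>])
  define \<eta> where "\<eta> y = ?Q \<psi> (y + a) - ?Q \<psi> y" for y
  have sh: "bdd_cont (\<lambda>y. ?Q \<psi> (y + a)) K" by (intro bdd_cont_compose[OF Q\<psi>] continuous_intros)
  have \<eta>: "bdd_cont \<eta> (c * K * sqrt (\<Sum>n<N. (h n)\<^sup>2))"
    using diff[OF \<psi>, of _ h] sh Q\<psi> unfolding bdd_cont_def \<eta>_def a by (auto intro!: continuous_intros)
  have "?Q \<eta> = (\<lambda>y. P (y + a) - P y)"
    unfolding \<eta>_def P smears_diff[OF L sh Q\<psi>] smears_translate ..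
  then show "\<bar>second_diff P x a a'\<bar>
      \<le> c * (c * K * sqrt (\<Sum>n<N. (h n)\<^sup>2)) * sqrt (\<Sum>n<N. (h' n)\<^sup>2)"
    using diff[OF \<eta>, of x h'] by (simp add: a' ac_simps)
qed

section \<open>Stochastic integrals of smooth deterministic integrands\<close>

lemma cadlag_bounded:
  assumes z: "cadlag z" and t: "0 \<le> t"
  obtains B where "\<And>s. 0 \<le> s \<Longrightarrow> s \<le> t \<Longrightarrow> \<bar>z s\<bar> \<le> B"
proof -
  define P where "P a b \<longleftrightarrow> (\<exists>B. \<forall>s. 0 \<le> s \<longrightarrow> a \<le> s \<longrightarrow> s \<le> b \<longrightarrow> \<bar>z s\<bar> \<le> B)" for a b
  have "P 0 t"
    using t
  proof (rule Bolzano)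
    fix a b c assume ab: "P a b" and bc: "P b c"
    then obtain B C where "\<forall>s. 0 \<le> s \<longrightarrow> a \<le> s \<longrightarrow> s \<le> b \<longrightarrow> \<bar>z s\<bar> \<le> B" "\<forall>s. 0 \<le> s \<longrightarrow> b \<le> s \<longrightarrow> s \<le> c \<longrightarrow> \<bar>z s\<bar> \<le> C"
      unfolding P_def by blast
    then show "P a c" unfolding P_def by (intro exI[of _ "max B C"]) (metis le_max_iff_disj linorder_le_cases)
  next
    fix x assume x: "0 \<le> x" "x \<le> t"
    have "\<forall>\<^sub>F s in at_right x. dist (z s) (z x) < 1"
      using z x(1) by (intro tendstoD) (auto simp: cadlag_def)
    then obtain b where b: "b > x" "\<And>s. x < s \<Longrightarrow> s < b \<Longrightarrow> dist (z s) (z x) < 1"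
      unfolding eventually_at_right_field by auto
    obtain a l where a: "a < x" "\<And>s. 0 \<le> s \<Longrightarrow> a < s \<Longrightarrow> s < x \<Longrightarrow> dist (z s) l < 1"
    proof (cases "x = 0")
      case True
      \<comment> \<open>To the left of 0 there are no admissible times, so any \<open>l\<close> will
        do.\<close>
      then show ?thesis using that[of "-1" 0] by auto
    next
      case False
      then obtain l where "(z \<longlongrightarrow> l) (at_left x)" using z x unfolding cadlag_def by force
      then have "\<forall>\<^sub>F s in at_left x. dist (z s) l < 1" by (rule tendstoD) simp
      then show ?thesis using that unfolding eventually_at_left_field by auto
    qed
    show "\<exists>d>0. \<forall>a b. a \<le> x \<and> x \<le> b \<and> b - a < d \<longrightarrow> P a b"
    proof (intro exI[of _ "min (b - x) (x - a)"] conjI allI impI)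
      show "0 < min (b - x) (x - a)" using a b by simp
      fix a' b' assume *: "a' \<le> x \<and> x \<le> b' \<and> b' - a' < min (b - x) (x - a)"
      have "\<bar>z s\<bar> \<le> max (\<bar>z x\<bar> + 1) (\<bar>l\<bar> + 1)" if "0 \<le> s" "a' \<le> s" "s \<le> b'" for s
      proof (cases s x rule: linorder_cases)
        case less
        then show ?thesis using a(2)[of s] that * by (auto simp: dist_real_def)
      next
        case greater
        then show ?thesis using b(2)[of s] that * by (auto simp: dist_real_def)
      qed simp
      then show "P a' b'" unfolding P_def by blast
    qed
  qed
  then show ?thesis using that unfolding P_def by auto
qed

definition left_sum :: "(real \<Rightarrow> real) \<Rightarrow> nat \<Rightarrow> (nat \<Rightarrow> real) \<Rightarrow> (real \<Rightarrow> real) \<Rightarrow> real" where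
  "left_sum f N p z = (\<Sum>i<N. f (p i) * (z (p (Suc i)) - z (p i)))"

text \<open>Summation by parts moves the increments from the path to \<open>f\<close> and leaves the
  path at the right end of each cell. Cells are open on the right, so that this end lies strictly
  after \<open>s\<close> and right continuity applies.\<close>

definition right_step :: "nat \<Rightarrow> (nat \<Rightarrow> real) \<Rightarrow> (real \<Rightarrow> real) \<Rightarrow> real \<Rightarrow> real" where
  "right_step N p z s = (\<Sum>i<N. indicator {p i..<p (Suc i)} s * z (p (Suc i)))"

lemma subdivision_mono:
  assumes "subdivision t N p" "i \<le> j" "j \<le> N"
  shows "p i \<le> p j"
  using assms(2,3)
proof (induction j rule: dec_induct)
  case (step n)
  then show ?case using assms(1) unfolding subdivision_def by (meson Suc_le_eq less_imp_le order_trans)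
qed simp

lemma right_step_inside:
  assumes "subdivision t N p" "0 \<le> s" "s < t"
  obtains i where "i < N" "p i \<le> s" "s < p (Suc i)" "right_step N p z s = z (p (Suc i))"
proof -
  have N: "s < p N" and p0: "p 0 \<le> s" using assms by (auto simp: subdivision_def)
  then obtain i where i: "i < N" "p i \<le> s" "s < p (Suc i)"
    using ex_least_nat_less[of "\<lambda>k. s < p k" N] by (metis leI le_refl lessI less_le_trans not_le)
  have "right_step N p z s = (\<Sum>j<N. if j = i then z (p (Suc i)) else 0)"
    unfolding right_step_def
  proof (intro sum.cong refl)
    fix j assume j: "j \<in> {..<N}"
    consider "j = i" | "Suc j \<le> i" | "Suc i \<le> j" by linarith
    then show "indicator {p j..<p (Suc j)} s * z (p (Suc j)) = (if j = i then z (p (Suc i)) else 0)"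
    proof cases
      case 2
      then show ?thesis using subdivision_mono[OF assms(1), of "Suc j" i] i j by auto
    next
      case 3
      then show ?thesis using subdivision_mono[OF assms(1), of "Suc i" j] i j by auto
    qed (use i in auto)
  qed
  with i show ?thesis using that by simp
qed

lemma right_step_outside:
  assumes "subdivision t N p" "\<not> (0 \<le> s \<and> s < t)"
  shows "right_step N p z s = 0"
  unfolding right_step_def
proof (intro sum.neutral ballI)
  fix i assume i: "i \<in> {..<N}"
  have "0 \<le> p i" "p (Suc i) \<le> t"
    using subdivision_mono[OF assms(1), of 0 i] subdivision_mono[OF assms(1), of "Suc i" N] i assms(1)
    by (auto simp: subdivision_def)
  then show "indicator {p i..<p (Suc i)} s * z (p (Suc i)) = 0" using assms(2) by (auto simp: indicator_def)
qed

lemma left_sum_by_parts: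
  "left_sum f N p z = f (p N) * z (p N) - f (p 0) * z (p 0) - (\<Sum>i<N. z (p (Suc i)) * (f (p (Suc i)) - f (p i)))"
  unfolding left_sum_def by (induction N) (simp_all add: algebra_simps)

lemma FTC_half_open:
  fixes f f' :: "real \<Rightarrow> real"
  assumes "a \<le> b" "\<And>s. (f has_real_derivative f' s) (at s)" "continuous_on UNIV f'"
  shows "has_bochner_integral lborel (\<lambda>s. indicator {a..<b} s * f' s) (f b - f a)"
proof -
  have "has_bochner_integral lborel (\<lambda>s. f' s * indicator {a..b} s) (f b - f a)"
    using assms by (intro has_bochner_integral_FTC_Icc_real)
      (auto simp: continuous_on_eq_continuous_at intro: DERIV_subset)
  moreover have [measurable]: "f' \<in> borel_measurable borel" using assms(3) by (rule borel_measurable_continuous_onI)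
  moreover have "AE s in lborel. f' s * indicator {a..b} s = indicator {a..<b} s * f' s"
    using AE_lborel_singleton[of b] by eventually_elim (auto simp: indicator_def)
  ultimately show ?thesis
    by (subst has_bochner_integral_cong_AE[symmetric, where f="\<lambda>s. f' s * indicator {a..b} s"]) auto
qed

lemma right_step_integral:
  assumes p: "subdivision t N p" and f: "\<And>s. (f has_real_derivative f' s) (at s)" "continuous_on UNIV f'"
  shows "(\<integral>s. right_step N p z s * f' s \<partial>lborel) = (\<Sum>i<N. z (p (Suc i)) * (f (p (Suc i)) - f (p i)))"
proof -
  have "has_bochner_integral lborel (\<lambda>s. \<Sum>i<N. z (p (Suc i)) * (indicator {p i..<p (Suc i)} s * f' s))
      (\<Sum>i<N. z (p (Suc i)) * (f (p (Suc i)) - f (p i)))"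
    using p by (intro has_bochner_integral_sum has_bochner_integral_mult_right FTC_half_open f)
      (auto simp: subdivision_def)
  then have "(\<integral>s. (\<Sum>i<N. z (p (Suc i)) * (indicator {p i..<p (Suc i)} s * f' s)) \<partial>lborel)
      = (\<Sum>i<N. z (p (Suc i)) * (f (p (Suc i)) - f (p i)))"
    by (rule has_bochner_integral_integral_eq)
  moreover have "(\<Sum>i<N. z (p (Suc i)) * (indicator {p i..<p (Suc i)} s * f' s)) = right_step N p z s * f' s" for s
    unfolding right_step_def sum_distrib_right by (intro sum.cong) auto
  ultimately show ?thesis by simp
qed

definition vanishing_mesh :: "real \<Rightarrow> (nat \<Rightarrow> nat) \<Rightarrow> (nat \<Rightarrow> nat \<Rightarrow> real) \<Rightarrow> bool" where
  "vanishing_mesh t N p \<longleftrightarrow> (\<forall>k. subdivision t (N k) (p k)) \<and>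
     (\<forall>\<delta>>0. \<forall>\<^sub>F k in sequentially. \<forall>i<N k. p k (Suc i) - p k i < \<delta>)"

text \<open>For continuously differentiable \<open>f\<close> the sums converge path by path, by
  parts and dominated convergence, \<open>B\<close> bounding the path and \<open>C\<close> the
  derivative. The limit is the same for all subdivisions, as the definition of the integral
  demands.\<close>

lemma left_sum_tendsto:
  assumes z: "cadlag z" and t: "0 \<le> t"
    and f: "\<And>s. (f has_real_derivative f' s) (at s)" "continuous_on UNIV f'"
    and vanishing_mesh: "vanishing_mesh t N p"
  shows "(\<lambda>k. left_sum f (N k) (p k) z) \<longlonglongrightarrow>
    f t * z t - f 0 * z 0 - (\<integral>s. indicator {0..<t} s * z s * f' s \<partial>lborel)"
proof -
  have sub: "\<And>k. subdivision t (N k) (p k)" using vanishing_mesh by (simp add: vanishing_mesh_def)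
  obtain B where B: "\<And>s. 0 \<le> s \<Longrightarrow> s \<le> t \<Longrightarrow> \<bar>z s\<bar> \<le> B" using cadlag_bounded[OF z t] by blast
  have "compact (f' ` {0..t})" by (intro compact_continuous_image continuous_on_subset[OF f(2)]) auto
  then have "bounded (f' ` {0..t})" by (rule compact_imp_bounded)
  then obtain C where "\<forall>s\<in>{0..t}. \<bar>f' s\<bar> \<le> C" by (auto simp: bounded_iff)
  then have C: "\<And>s. 0 \<le> s \<Longrightarrow> s \<le> t \<Longrightarrow> \<bar>f' s\<bar> \<le> C" by simp
  have [measurable]: "f' \<in> borel_measurable borel" using f(2) by (rule borel_measurable_continuous_onI)
  have lim: "(\<lambda>k. right_step (N k) (p k) z s * f' s) \<longlonglongrightarrow> indicator {0..<t} s * z s * f' s" for s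
  proof (cases "0 \<le> s \<and> s < t")
    case True
    have "(\<lambda>k. right_step (N k) (p k) z s) \<longlonglongrightarrow> z s"
    proof (rule tendstoI)
      fix \<epsilon> :: real assume e: "0 < \<epsilon>"
      have "\<forall>\<^sub>F r in at_right s. dist (z r) (z s) < \<epsilon>"
        using z True e by (intro tendstoD) (auto simp: cadlag_def)
      then obtain b where b: "b > s" "\<And>r. s < r \<Longrightarrow> r < b \<Longrightarrow> dist (z r) (z s) < \<epsilon>"
        unfolding eventually_at_right_field by auto
      have "\<forall>\<^sub>F k in sequentially. \<forall>i<N k. p k (Suc i) - p k i < b - s"
        using vanishing_mesh b(1) by (simp add: vanishing_mesh_def)
      then show "\<forall>\<^sub>F k in sequentially. dist (right_step (N k) (p k) z s) (z s) < \<epsilon>"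
      proof eventually_elim
        case (elim k)
        obtain i where i: "i < N k" "p k i \<le> s" "s < p k (Suc i)" "right_step (N k) (p k) z s = z (p k (Suc i))"
          using right_step_inside[OF sub] True by metis
        then show ?case using elim b(2)[of "p k (Suc i)"] by force
      qed
    qed
    then have "(\<lambda>k. right_step (N k) (p k) z s * f' s) \<longlonglongrightarrow> z s * f' s" by (intro tendsto_intros)
    then show ?thesis using True by simp
  qed (auto simp: right_step_outside[OF sub] indicator_def)
  have m: "(\<lambda>s. right_step (N k) (p k) z s * f' s) \<in> borel_measurable lborel" for k
    unfolding right_step_def by measurable
  have "(\<lambda>k. \<integral>s. right_step (N k) (p k) z s * f' s \<partial>lborel) \<longlonglongrightarrow> (\<integral>s. indicator {0..<t} s * z s * f' s \<partial>lborel)"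
  proof (rule integral_dominated_convergence[where w="\<lambda>s. indicator {0..<t} s * (B * C)"])
    show "(\<lambda>s. indicator {0..<t} s * z s * f' s) \<in> borel_measurable lborel"
      by (rule borel_measurable_LIMSEQ_real[OF lim m])
    show "integrable lborel (\<lambda>s. indicator {0..<t} s * (B * C))"
      using t by simp
    show "AE s in lborel. norm (right_step (N k) (p k) z s * f' s) \<le> indicator {0..<t} s * (B * C)" for k
    proof (rule AE_I2)
      fix s
      show "norm (right_step (N k) (p k) z s * f' s) \<le> indicator {0..<t} s * (B * C)"
      proof (cases "0 \<le> s \<and> s < t")
        case True
        obtain i where i: "i < N k" "p k i \<le> s" "s < p k (Suc i)" "right_step (N k) (p k) z s = z (p k (Suc i))"
          using right_step_inside[OF sub] True by metis
        have "p k (Suc i) \<le> t" using subdivision_mono[OF sub[of k], of "Suc i" "N k"] i(1) sub[of k] by (auto simp: subdivision_def)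
        then have "\<bar>z (p k (Suc i))\<bar> * \<bar>f' s\<bar> \<le> B * C"
          using True i B[of "p k (Suc i)"] C[of s] by (intro mult_mono) auto
        then show ?thesis using True i(4) by (simp add: abs_mult)
      qed (auto simp: right_step_outside[OF sub])
    qed
  qed (use lim m in auto)
  then have "(\<lambda>k. f t * z t - f 0 * z 0 - (\<integral>s. right_step (N k) (p k) z s * f' s \<partial>lborel)) \<longlonglongrightarrow>
    f t * z t - f 0 * z 0 - (\<integral>s. indicator {0..<t} s * z s * f' s \<partial>lborel)"
    by (intro tendsto_intros)
  moreover have "f t * z t - f 0 * z 0 - (\<integral>s. right_step (N k) (p k) z s * f' s \<partial>lborel) = left_sum f (N k) (p k) z" for k
    unfolding right_step_integral[OF sub f] left_sum_by_parts using sub[of k] by (simp add: subdivision_def)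
  ultimately show ?thesis by simp
qed

definition unif :: "real \<Rightarrow> nat \<Rightarrow> nat \<Rightarrow> real" where
  "unif t k i = t * real i / real (Suc k)"

lemma vanishing_mesh_unif:
  assumes "0 \<le> t"
  shows "vanishing_mesh t Suc (unif t)"
  unfolding vanishing_mesh_def
proof (intro conjI allI impI)
  show "subdivision t (Suc k) (unif t k)" for k
    using assms by (auto simp: subdivision_def unif_def divide_right_mono mult_left_mono simp del: of_nat_Suc)
  fix \<delta> :: real assume d: "0 < \<delta>"
  have "(\<lambda>k. t / real (Suc k)) \<longlonglongrightarrow> 0"
    by (rule tendsto_divide_0[OF tendsto_const])
      (intro filterlim_at_top_imp_at_infinity filterlim_compose[OF filterlim_real_sequentially filterlim_Suc])
  then have "\<forall>\<^sub>F k in sequentially. t / real (Suc k) < \<delta>" using d by (rule order_tendstoD)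
  then show "\<forall>\<^sub>F k in sequentially. \<forall>i<Suc k. unif t k (Suc i) - unif t k i < \<delta>"
    by eventually_elim (simp add: unif_def algebra_simps flip: diff_divide_distrib)
qed

section \<open>Versions of the stochastic integral\<close>

lemma AE_tendsto_imp_in_probability:
  assumes M: "prob_space M" and [measurable]: "\<And>k. X k \<in> borel_measurable M" "Y \<in> borel_measurable M"
    and lim: "AE \<omega> in M. (\<lambda>k. X k \<omega>) \<longlonglongrightarrow> Y \<omega>"
  shows "tendsto_in_probability M X Y"
  unfolding tendsto_in_probability_def
proof (intro allI impI)
  interpret prob_space M by fact
  fix \<epsilon> :: real assume e: "0 < \<epsilon>"
  let ?A = "\<lambda>k. {\<omega> \<in> space M. \<epsilon> < \<bar>X k \<omega> - Y \<omega>\<bar>}"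
  have "(\<lambda>k. \<integral>\<omega>. indicator (?A k) \<omega> \<partial>M) \<longlonglongrightarrow> (\<integral>\<omega>. (0::real) \<partial>M)"
  proof (rule integral_dominated_convergence[where w="\<lambda>_. 1"])
    show "AE \<omega> in M. (\<lambda>k. indicator (?A k) \<omega> :: real) \<longlonglongrightarrow> 0"
      using lim
    proof eventually_elim
      case (elim \<omega>)
      then have "\<forall>\<^sub>F k in sequentially. dist (X k \<omega>) (Y \<omega>) < \<epsilon>" using e by (rule tendstoD)
      then have "\<forall>\<^sub>F k in sequentially. indicator (?A k) \<omega> = (0::real)"
        by eventually_elim (auto simp: dist_real_def indicator_def)
      then show ?case by (rule tendsto_eventually)
    qed
  qed (auto simp: indicator_def)
  then show "(\<lambda>k. measure M (?A k)) \<longlonglongrightarrow> 0" by simp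
qed

lemma in_probability_limit_unique:
  assumes M: "prob_space M" and [measurable]: "\<And>k. X k \<in> borel_measurable M" "Y \<in> borel_measurable M" "Y' \<in> borel_measurable M"
    and Y: "tendsto_in_probability M X Y" and Y': "tendsto_in_probability M X Y'"
  shows "AE \<omega> in M. Y \<omega> = Y' \<omega>"
proof -
  interpret prob_space M by fact
  have "AE \<omega> in M. \<bar>Y \<omega> - Y' \<omega>\<bar> \<le> 2 * (1 / real (Suc n))" for n
  proof -
    define \<epsilon> where "\<epsilon> = 1 / real (Suc n)"
    have e: "\<epsilon> > 0" by (simp add: \<epsilon>_def)
    let ?A = "\<lambda>k. {\<omega> \<in> space M. \<epsilon> < \<bar>X k \<omega> - Y \<omega>\<bar>}" and ?B = "\<lambda>k. {\<omega> \<in> space M. \<epsilon> < \<bar>X k \<omega> - Y' \<omega>\<bar>}"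
    let ?C = "{\<omega> \<in> space M. 2 * \<epsilon> < \<bar>Y \<omega> - Y' \<omega>\<bar>}"
    have "(\<lambda>k. measure M (?A k) + measure M (?B k)) \<longlonglongrightarrow> 0 + 0"
      using Y Y' e unfolding tendsto_in_probability_def by (intro tendsto_add) auto
    moreover have "measure M ?C \<le> measure M (?A k) + measure M (?B k)" for k
    proof -
      have "measure M ?C \<le> measure M (?A k \<union> ?B k)" by (intro finite_measure_mono) auto
      also have "\<dots> \<le> measure M (?A k) + measure M (?B k)" by (intro measure_Un_le) auto
      finally show ?thesis .
    qed
    ultimately have "measure M ?C \<le> 0 + 0" by (intro LIMSEQ_le_const) auto
    then have "measure M ?C = 0" using measure_nonneg[of M ?C] by simp
    then have "AE \<omega> in M. \<not> 2 * \<epsilon> < \<bar>Y \<omega> - Y' \<omega>\<bar>"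
      by (intro AE_I[where N="?C"]) (auto simp: emeasure_eq_measure)
    then show ?thesis unfolding \<epsilon>_def by (simp add: not_less)
  qed
  then have "AE \<omega> in M. \<forall>n. \<bar>Y \<omega> - Y' \<omega>\<bar> \<le> 2 * (1 / real (Suc n))" by (simp add: AE_all_countable)
  then show ?thesis
  proof eventually_elim
    case (elim \<omega>)
    have "(\<lambda>n. 2 * (1 / real (Suc n))) \<longlonglongrightarrow> 2 * 0"
      by (intro tendsto_mult tendsto_const) (rule LIMSEQ_Suc[OF lim_1_over_n])
    then have "\<bar>Y \<omega> - Y' \<omega>\<bar> \<le> 2 * 0" using elim by (intro LIMSEQ_le_const) auto
    then show ?case by simp
  qed
qed

text \<open>The integral is an arbitrary choice among its versions. The pathwise limit
  \<open>I\<close> is one, so the choice is a version too, and two limits in probability of the same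
  sums agree almost surely.\<close>

lemma stochastic_integral_limit:
  assumes M: "prob_space M" and Z: "\<And>t. 0 \<le> t \<Longrightarrow> Z t \<in> borel_measurable M" "AE \<omega> in M. cadlag (\<lambda>t. Z t \<omega>)"
    and t: "0 \<le> t" and f: "\<And>s. (f has_real_derivative f' s) (at s)" "continuous_on UNIV f'"
  shows "stochastic_integral M f Z t \<in> borel_measurable M"
    "AE \<omega> in M. (\<lambda>k. left_sum f (Suc k) (unif t k) (\<lambda>s. Z s \<omega>)) \<longlonglongrightarrow> stochastic_integral M f Z t \<omega>"
proof -
  have ls: "(\<lambda>\<omega>. left_sum f N p (\<lambda>s. Z s \<omega>)) \<in> borel_measurable M" if "subdivision t N p" for N p
  proof -
    have "0 \<le> p i" if "i \<le> N" for i
      using subdivision_mono[OF \<open>subdivision t N p\<close>, of 0 i] that \<open>subdivision t N p\<close> by (simp add: subdivision_def)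
    then show ?thesis unfolding left_sum_def
      by (intro borel_measurable_sum borel_measurable_times borel_measurable_diff borel_measurable_const Z(1)) auto
  qed
  let ?U = "\<lambda>k \<omega>. left_sum f (Suc k) (unif t k) (\<lambda>s. Z s \<omega>)"
  have sub: "subdivision t (Suc k) (unif t k)" for k using vanishing_mesh_unif[OF t] by (simp add: vanishing_mesh_def)
  note mU = ls[OF sub]
  \<comment> \<open>Where the sums diverge, \<open>lim\<close> has an unspecified value;
    \<open>I\<close> is measurable nevertheless.\<close>
  define I where "I \<omega> = lim (\<lambda>k. ?U k \<omega>)" for \<omega>
  have mI: "I \<in> borel_measurable M" unfolding I_def by (rule borel_measurable_lim_metric[OF mU])
  have lim: "AE \<omega> in M. (\<lambda>k. left_sum f (N k) (p k) (\<lambda>s. Z s \<omega>)) \<longlonglongrightarrow> I \<omega>" if "vanishing_mesh t N p" for N p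
    using Z(2)
  proof eventually_elim
    case (elim \<omega>)
    let ?L = "f t * Z t \<omega> - f 0 * Z 0 \<omega> - (\<integral>s. indicator {0..<t} s * Z s \<omega> * f' s \<partial>lborel)"
    have "(\<lambda>k. ?U k \<omega>) \<longlonglongrightarrow> ?L" by (rule left_sum_tendsto[OF elim t f vanishing_mesh_unif[OF t]])
    then have "I \<omega> = ?L" unfolding I_def by (rule limI)
    then show ?case using left_sum_tendsto[OF elim t f that] by simp
  qed
  have I: "is_stochastic_integral M f Z t I"
    unfolding is_stochastic_integral_def
  proof (intro conjI allI impI mI)
    fix N p assume "(\<forall>k. subdivision t (N k) (p k)) \<and> (\<forall>\<delta>>0. \<forall>\<^sub>F k in sequentially. \<forall>i<N k. p k (Suc i) - p k i < \<delta>)"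
    then have vanishing_mesh: "vanishing_mesh t N p" by (simp add: vanishing_mesh_def)
    then have "tendsto_in_probability M (\<lambda>k \<omega>. left_sum f (N k) (p k) (\<lambda>s. Z s \<omega>)) I"
      by (intro AE_tendsto_imp_in_probability[OF M ls mI lim]) (auto simp: vanishing_mesh_def)
    then show "tendsto_in_probability M (\<lambda>k \<omega>. \<Sum>i<N k. f (p k i) * (Z (p k (Suc i)) \<omega> - Z (p k i) \<omega>)) I"
      by (simp add: left_sum_def)
  qed
  let ?J = "stochastic_integral M f Z t"
  have J: "is_stochastic_integral M f Z t ?J"
    unfolding stochastic_integral_def using I by (rule someI[of "is_stochastic_integral M f Z t"])
  then show mJ: "?J \<in> borel_measurable M" by (simp add: is_stochastic_integral_def)
  have "tendsto_in_probability M ?U J'" if "is_stochastic_integral M f Z t J'" for J'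
    using that vanishing_mesh_unif[OF t] unfolding is_stochastic_integral_def vanishing_mesh_def left_sum_def by blast
  from in_probability_limit_unique[OF M mU mI mJ this[OF I] this[OF J]]
  show "AE \<omega> in M. (\<lambda>k. ?U k \<omega>) \<longlonglongrightarrow> ?J \<omega>"
    using lim[OF vanishing_mesh_unif[OF t]] by eventually_elim simp
qed

section \<open>Law and independence of the Ornstein-Uhlenbeck coordinates\<close>

lemma levy_processD:
  assumes "stochastic_basis M \<F>" "levy_process M \<F> Z"
  shows "prob_space M" "0 \<le> t \<Longrightarrow> Z t \<in> borel_measurable M" "AE \<omega> in M. cadlag (\<lambda>t. Z t \<omega>)"
    "0 \<le> s \<Longrightarrow> s \<le> t \<Longrightarrow> Z s \<in> borel_measurable (\<F> t)"
proof -
  have sub: "\<forall>t\<ge>0. subalgebra M (\<F> t)" and mono: "\<forall>s\<ge>0. \<forall>t\<ge>s. sets (\<F> s) \<subseteq> sets (\<F> t)" and "prob_space M"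
    using assms(1) unfolding stochastic_basis_def by blast+
  have Z: "\<forall>t\<ge>0. Z t \<in> borel_measurable (\<F> t)" and "AE \<omega> in M. cadlag (\<lambda>t. Z t \<omega>)"
    using assms(2) unfolding levy_process_def by blast+
  then show "AE \<omega> in M. cadlag (\<lambda>t. Z t \<omega>)" by blast
  show "prob_space M" by fact
  show "Z t \<in> borel_measurable M" if "0 \<le> t"
    by (rule measurable_from_subalg[OF sub[rule_format, OF that] Z[rule_format, OF that]])
  show "Z s \<in> borel_measurable (\<F> t)" if "0 \<le> s" "s \<le> t"
  proof (rule measurable_from_subalg[OF _ Z[rule_format, OF that(1)]])
    have "space (\<F> s) = space M" "space (\<F> t) = space M"
      using sub that by (simp_all add: subalgebra_def)
    then show "subalgebra (\<F> t) (\<F> s)"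
      unfolding subalgebra_def using mono[rule_format, OF that] by simp
  qed
qed

lemma levy_increment_indep:
  assumes basis: "stochastic_basis M \<F>" and Z: "levy_process M \<F> Z" and st: "0 \<le> s" "s \<le> t"
    and X: "X \<in> borel_measurable (\<F> s)"
  shows "prob_space.indep_var M borel X borel (\<lambda>\<omega>. Z t \<omega> - Z s \<omega>)"
proof -
  interpret prob_space M by (rule levy_processD(1)[OF basis Z])
  have sub: "subalgebra M (\<F> s)" using basis st unfolding stochastic_basis_def by auto
  then have sp: "space (\<F> s) = space M" and se: "sets (\<F> s) \<subseteq> sets M" by (auto simp: subalgebra_def)
  have ind: "indep_set (sets (\<F> s)) (sets (vimage_algebra (space M) (\<lambda>\<omega>. Z t \<omega> - Z s \<omega>) borel))"
    using Z st unfolding levy_process_def by auto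
  have "{X -` A \<inter> space M |A. A \<in> sets borel} \<subseteq> sets (\<F> s)"
    using measurable_sets[OF X] sp by auto
  then have 1: "sigma_sets (space M) {X -` A \<inter> space M |A. A \<in> sets borel} \<subseteq> sets (\<F> s)"
    using sets.sigma_sets_subset[of _ "\<F> s"] sp by simp
  have rX: "random_variable borel X" by (rule measurable_from_subalg[OF sub X])
  have rY: "random_variable borel (\<lambda>\<omega>. Z t \<omega> - Z s \<omega>)"
    using levy_processD(2)[OF basis Z] st by (intro borel_measurable_diff) auto
  have "indep_set (sigma_sets (space M) {X -` A \<inter> space M |A. A \<in> sets borel})
      (sigma_sets (space M) {(\<lambda>\<omega>. Z t \<omega> - Z s \<omega>) -` A \<inter> space M |A. A \<in> sets borel})"
    using ind unfolding indep_set_def sets_vimage_algebra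
  proof (rule indep_sets_mono_sets)
    fix b :: bool
    show "case_bool (sigma_sets (space M) {X -` A \<inter> space M |A. A \<in> sets borel})
      (sigma_sets (space M) {(\<lambda>\<omega>. Z t \<omega> - Z s \<omega>) -` A \<inter> space M |A. A \<in> sets borel}) b
      \<subseteq> case_bool (sets (\<F> s)) (sigma_sets (space M) {(\<lambda>\<omega>. Z t \<omega> - Z s \<omega>) -` A \<inter> space M |A. A \<in> sets borel}) b"
      using 1 by (cases b) simp_all
  qed
  then show ?thesis unfolding indep_var_eq using rX rY by simp
qed

text \<open>Measurability at time \<open>p j\<close> is carried along because it makes the first
  \<open>j\<close> terms independent of the next increment, so that the characteristic functions
  multiply.\<close>

lemma char_left_sum:
  assumes basis: "stochastic_basis M \<F>" and Z: "stable_levy_process M \<F> \<alpha> Z" and p: "subdivision t N p"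
  shows "j \<le> N \<Longrightarrow> (\<lambda>\<omega>. left_sum f j p (\<lambda>s. Z s \<omega>)) \<in> borel_measurable (\<F> (p j)) \<and>
    char (distr M borel (\<lambda>\<omega>. left_sum f j p (\<lambda>s. Z s \<omega>))) \<xi>
      = of_real (exp (- (\<Sum>i<j. \<bar>f (p i) * \<xi>\<bar> powr \<alpha> * (p (Suc i) - p i))))"
proof (induction j)
  case 0
  have L: "levy_process M \<F> Z" using Z by (simp add: stable_levy_process_def)
  interpret prob_space M by (rule levy_processD(1)[OF basis L])
  have "char (distr M borel (\<lambda>\<omega>. 0 :: real)) \<xi> = 1"
    unfolding char_def by (subst integral_distr) (auto simp: prob_space)
  then show ?case by (simp add: left_sum_def)
next
  case (Suc j)
  have L: "levy_process M \<F> Z" using Z by (simp add: stable_levy_process_def)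
  interpret prob_space M by (rule levy_processD(1)[OF basis L])
  have pj: "0 \<le> p j" "p j \<le> p (Suc j)"
    using subdivision_mono[OF p, of 0 j] Suc.prems p by (auto simp: subdivision_def)
  have pi: "0 \<le> p i" "p i \<le> p (Suc j)" if "i \<le> Suc j" for i
    using subdivision_mono[OF p, of 0 i] subdivision_mono[OF p, of i "Suc j"] Suc.prems p that by (auto simp: subdivision_def)
  let ?X = "\<lambda>\<omega>. left_sum f j p (\<lambda>s. Z s \<omega>)" and ?D = "\<lambda>\<omega>. Z (p (Suc j)) \<omega> - Z (p j) \<omega>"
  have X: "?X \<in> borel_measurable (\<F> (p j))"
    and cX: "char (distr M borel ?X) \<xi> = of_real (exp (- (\<Sum>i<j. \<bar>f (p i) * \<xi>\<bar> powr \<alpha> * (p (Suc i) - p i))))"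
    using Suc by auto
  have D[measurable]: "?D \<in> borel_measurable M"
    using levy_processD(2)[OF basis L] pj by (intro borel_measurable_diff) auto
  have "indep_var borel (id \<circ> ?X) borel ((\<lambda>d. f (p j) * d) \<circ> ?D)"
    by (rule indep_var_compose[OF levy_increment_indep[OF basis L pj X]]) auto
  then have ind: "indep_var borel ?X borel (\<lambda>\<omega>. f (p j) * ?D \<omega>)" by (simp add: comp_def)
  have dD: "distr M borel ?D = distr M borel (Z (p (Suc j) - p j))"
    using L pj unfolding levy_process_def by auto
  have "char (distr M borel (\<lambda>\<omega>. f (p j) * ?D \<omega>)) \<xi> = char (distr M borel ?D) (f (p j) * \<xi>)"
    unfolding char_def by (subst (1 2) integral_distr) (auto simp: ac_simps)
  also have "\<dots> = of_real (exp (- (p (Suc j) - p j) * \<bar>f (p j) * \<xi>\<bar> powr \<alpha>))"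
    unfolding dD using Z pj unfolding stable_levy_process_def by (simp add: algebra_simps)
  finally have cD: "char (distr M borel (\<lambda>\<omega>. f (p j) * ?D \<omega>)) \<xi> = of_real (exp (- (p (Suc j) - p j) * \<bar>f (p j) * \<xi>\<bar> powr \<alpha>))" .
  have eq: "left_sum f (Suc j) p (\<lambda>s. Z s \<omega>) = ?X \<omega> + f (p j) * ?D \<omega>" for \<omega>
    by (simp add: left_sum_def)
  have "char (distr M borel (\<lambda>\<omega>. left_sum f (Suc j) p (\<lambda>s. Z s \<omega>))) \<xi>
      = of_real (exp (- (\<Sum>i<Suc j. \<bar>f (p i) * \<xi>\<bar> powr \<alpha> * (p (Suc i) - p i))))"
    unfolding eq char_distr_add[OF ind] cX cD
    by (simp flip: exp_add of_real_mult add: algebra_simps)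
  moreover have "(\<lambda>\<omega>. left_sum f (Suc j) p (\<lambda>s. Z s \<omega>)) \<in> borel_measurable (\<F> (p (Suc j)))"
    unfolding left_sum_def
    by (intro borel_measurable_sum borel_measurable_times borel_measurable_diff borel_measurable_const
        levy_processD(4)[OF basis L] pi) auto
  ultimately show ?case by blast
qed

lemma char_limit_AE:
  assumes M: "prob_space M" and [measurable]: "\<And>k. X k \<in> borel_measurable M" "Y \<in> borel_measurable M"
    and lim: "AE \<omega> in M. (\<lambda>k. X k \<omega>) \<longlonglongrightarrow> (Y \<omega> :: real)"
  shows "(\<lambda>k. char (distr M borel (X k)) \<xi>) \<longlonglongrightarrow> char (distr M borel Y) \<xi>"
proof -
  interpret prob_space M by fact
  have "(\<lambda>k. \<integral>\<omega>. iexp (\<xi> * X k \<omega>) \<partial>M) \<longlonglongrightarrow> (\<integral>\<omega>. iexp (\<xi> * Y \<omega>) \<partial>M)"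
  proof (rule integral_dominated_convergence[where w="\<lambda>_. 1"])
    show "AE \<omega> in M. (\<lambda>k. iexp (\<xi> * X k \<omega>)) \<longlonglongrightarrow> iexp (\<xi> * Y \<omega>)"
      using lim by eventually_elim (intro tendsto_intros)
  qed auto
  then show ?thesis unfolding char_def by (subst (1 2) integral_distr) auto
qed

text \<open>The exponents in \<open>char_left_sum\<close> are Riemann sums, that is, left sums along
  the identity path, which is cadlag; so the convergence theorem for paths evaluates them as
  well.\<close>

lemma exponential_kernel_sum:
  assumes c: "0 < c" and t: "0 \<le> t" and "vanishing_mesh t N p"
  shows "(\<lambda>k. left_sum (\<lambda>s. exp (- c * (t - s))) (N k) (p k) (\<lambda>s. s)) \<longlonglongrightarrow> (1 - exp (- c * t)) / c"
proof -
  let ?f = "\<lambda>s. exp (- c * (t - s))"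
  have cad: "cadlag (\<lambda>s. s)" unfolding cadlag_def by (auto intro: tendsto_ident_at)
  have D: "(?f has_real_derivative c * ?f s) (at s)" for s
    by (auto intro!: derivative_eq_intros)
  have lim: "(\<lambda>k. left_sum ?f (N k) (p k) (\<lambda>s. s)) \<longlonglongrightarrow>
    ?f t * t - ?f 0 * 0 - (\<integral>s. indicator {0..<t} s * s * (c * ?f s) \<partial>lborel)"
    by (rule left_sum_tendsto[OF cad t D _ assms(3)]) (intro continuous_intros)
  have "has_bochner_integral lborel (\<lambda>s. indicator {0..<t} s * (s * (c * ?f s)))
      ((t * ?f t - ?f t / c) - (0 * ?f 0 - ?f 0 / c))"
  proof (rule FTC_half_open[OF t])
    show "((\<lambda>s. s * ?f s - ?f s / c) has_real_derivative s * (c * ?f s)) (at s)" for s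
      using c by (auto intro!: derivative_eq_intros simp: field_simps)
  qed (intro continuous_intros)
  then have "(\<integral>s. indicator {0..<t} s * s * (c * ?f s) \<partial>lborel) = (t * ?f t - ?f t / c) - (0 * ?f 0 - ?f 0 / c)"
    by (simp add: has_bochner_integral_iff mult.assoc)
  then show ?thesis using lim by (simp add: diff_divide_distrib)
qed

lemma OU_component:
  assumes basis: "stochastic_basis M \<F>" and Z: "stable_levy_process M \<F> \<alpha> Z"
    and t: "0 \<le> t" and g: "0 < g" and \<alpha>: "0 < \<alpha>"
  defines "f \<equiv> \<lambda>s. exp (- g * (t - s))"
  shows "stochastic_integral M f Z t \<in> borel_measurable M"
    "AE \<omega> in M. (\<lambda>k. left_sum f (Suc k) (unif t k) (\<lambda>s. Z s \<omega>)) \<longlonglongrightarrow> stochastic_integral M f Z t \<omega>"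
    "char (distr M borel (stochastic_integral M f Z t)) \<xi> = of_real (exp (- ((1 - exp (- (\<alpha> * g) * t)) / (\<alpha> * g) * \<bar>\<xi>\<bar> powr \<alpha>)))"
proof -
  have L: "levy_process M \<F> Z" using Z by (simp add: stable_levy_process_def)
  note M = levy_processD(1)[OF basis L]
  have D: "(f has_real_derivative g * f s) (at s)" for s
    unfolding f_def by (auto intro!: derivative_eq_intros)
  have cont: "continuous_on UNIV (\<lambda>s. g * f s)" unfolding f_def by (intro continuous_intros)
  note SI = stochastic_integral_limit[OF M levy_processD(2)[OF basis L] levy_processD(3)[OF basis L] t D cont]
  show m: "stochastic_integral M f Z t \<in> borel_measurable M" by (rule SI(1))
  show lim: "AE \<omega> in M. (\<lambda>k. left_sum f (Suc k) (unif t k) (\<lambda>s. Z s \<omega>)) \<longlonglongrightarrow> stochastic_integral M f Z t \<omega>"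
    by (rule SI(2))
  let ?U = "\<lambda>k \<omega>. left_sum f (Suc k) (unif t k) (\<lambda>s. Z s \<omega>)"
  have sub: "subdivision t (Suc k) (unif t k)" for k using vanishing_mesh_unif[OF t] by (simp add: vanishing_mesh_def)
  have end_t: "unif t k (Suc k) = t" for k using sub by (simp add: subdivision_def)
  have subM: "subalgebra M (\<F> t)" using basis t unfolding stochastic_basis_def by auto
  have mU: "?U k \<in> borel_measurable M" for k
    using conjunct1[OF char_left_sum[OF basis Z sub[of k] order_refl, of f]] unfolding end_t
    by (rule measurable_from_subalg[OF subM])
  have "(\<lambda>k. char (distr M borel (?U k)) \<xi>) \<longlonglongrightarrow> char (distr M borel (stochastic_integral M f Z t)) \<xi>"
    by (rule char_limit_AE[OF M mU m lim])
  moreover have "(\<lambda>k. char (distr M borel (?U k)) \<xi>) \<longlonglongrightarrow> of_real (exp (- ((1 - exp (- (\<alpha> * g) * t)) / (\<alpha> * g) * \<bar>\<xi>\<bar> powr \<alpha>)))"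
  proof -
    let ?V = "\<lambda>k. left_sum (\<lambda>s. exp (- (\<alpha> * g) * (t - s))) (Suc k) (unif t k) (\<lambda>s. s)"
    have "char (distr M borel (?U k)) \<xi> = of_real (exp (- (?V k * \<bar>\<xi>\<bar> powr \<alpha>)))" for k
    proof -
      \<comment> \<open>The power \<open>\<alpha>\<close> of the kernel is again an exponential
        kernel, with rate \<open>\<alpha> * g\<close>.\<close>
      have "\<bar>f s * \<xi>\<bar> powr \<alpha> = exp (- (\<alpha> * g) * (t - s)) * \<bar>\<xi>\<bar> powr \<alpha>" for s
      proof -
        have "\<bar>f s * \<xi>\<bar> powr \<alpha> = f s powr \<alpha> * \<bar>\<xi>\<bar> powr \<alpha>" unfolding abs_mult f_def by (simp add: powr_mult)
        then show ?thesis by (simp add: f_def powr_def ac_simps)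
      qed
      then have "(\<Sum>i<Suc k. \<bar>f (unif t k i) * \<xi>\<bar> powr \<alpha> * (unif t k (Suc i) - unif t k i)) = ?V k * \<bar>\<xi>\<bar> powr \<alpha>"
        unfolding left_sum_def sum_distrib_right by (intro sum.cong) (auto simp: ac_simps)
      then show ?thesis using char_left_sum[OF basis Z sub[of k], of "Suc k" f \<xi>] by simp
    qed
    moreover have "(\<lambda>k. complex_of_real (exp (- (?V k * \<bar>\<xi>\<bar> powr \<alpha>)))) \<longlonglongrightarrow> of_real (exp (- ((1 - exp (- (\<alpha> * g) * t)) / (\<alpha> * g) * \<bar>\<xi>\<bar> powr \<alpha>)))"
      using g \<alpha> by (intro tendsto_of_real tendsto_exp tendsto_minus tendsto_mult tendsto_const
        exponential_kernel_sum t vanishing_mesh_unif) auto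
    ultimately show ?thesis by simp
  qed
  ultimately show "char (distr M borel (stochastic_integral M f Z t)) \<xi> = of_real (exp (- ((1 - exp (- (\<alpha> * g) * t)) / (\<alpha> * g) * \<bar>\<xi>\<bar> powr \<alpha>)))"
    by (rule LIMSEQ_unique)
qed

text \<open>Stated for the limit of sums and not for \<open>stochastic_integral\<close>: the former
  is a measurable functional of the single path of \<open>Z n\<close>, through countably many times,
  and so inherits independence.\<close>

lemma indep_OU_components:
  assumes ind: "independent_processes M Z" and M: "prob_space M" and t: "0 \<le> t"
  shows "prob_space.indep_vars M (\<lambda>_. borel)
    (\<lambda>n \<omega>. lim (\<lambda>k. left_sum (f n) (Suc k) (unif t k) (\<lambda>s. Z n s \<omega>))) UNIV"
proof -
  interpret prob_space M by fact
  have sub: "subdivision t (Suc k) (unif t k)" for k using vanishing_mesh_unif[OF t] by (simp add: vanishing_mesh_def)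
  have nn: "0 \<le> unif t k i" for k i using t by (simp add: unif_def)
  let ?G = "\<lambda>n z. lim (\<lambda>k. left_sum (f n) (Suc k) (unif t k) z)"
  let ?P = "\<Pi>\<^sub>M t\<in>{0::real..}. (borel :: real measure)"
  have comp: "(\<lambda>z. z (unif t k i)) \<in> borel_measurable ?P" for k i
    by (rule measurable_component_singleton) (simp add: nn)
  have "(\<lambda>z. left_sum (f n) (Suc k) (unif t k) z) \<in> borel_measurable ?P" for n k
    unfolding left_sum_def
    by (intro borel_measurable_sum borel_measurable_times borel_measurable_diff borel_measurable_const comp)
  then have "?G n \<in> borel_measurable ?P" for n by (rule borel_measurable_lim_metric)
  then have "indep_vars (\<lambda>_. borel) (\<lambda>n \<omega>. ?G n (\<lambda>t\<in>{0..}. Z n t \<omega>)) UNIV"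
    using ind unfolding independent_processes_def by (rule indep_vars_compose2[rotated])
  moreover have "left_sum (f n) (Suc k) (unif t k) (\<lambda>t\<in>{0..}. Z n t \<omega>) = left_sum (f n) (Suc k) (unif t k) (\<lambda>s. Z n s \<omega>)" for n k \<omega>
    unfolding left_sum_def by (simp add: nn)
  ultimately show ?thesis by simp
qed

section \<open>Second differences of the transition semigroup\<close>

text \<open>The last coordinate is independent of the sum of the others, so Fubini peels it off; the
  factor \<open>s n\<close> in its law is absorbed by rescaling the direction.\<close>

lemma (in prob_space) expectation_smears:
  fixes e :: "nat \<Rightarrow> 'h::{real_normed_vector, second_countable_topology}"
  assumes ind: "indep_vars (\<lambda>_. borel) \<xi> (UNIV :: nat set)" and \<mu>: "real_distribution \<mu>"
    and law: "\<And>n. distr M borel (\<xi> n) = distr \<mu> borel (\<lambda>x. s n * x)" and \<phi>: "bdd_cont \<phi> K"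
  shows "(\<integral>\<omega>. \<phi> (y + (\<Sum>n<N. \<xi> n \<omega> *\<^sub>R e n)) \<partial>M) = smears \<mu> (\<lambda>n. s n *\<^sub>R e n) N \<phi> y"
proof (induction N arbitrary: y)
  case 0
  then show ?case by (simp add: prob_space)
next
  case (Suc N)
  let ?sm = "smears \<mu> (\<lambda>n. s n *\<^sub>R e n)"
  interpret \<mu>: real_distribution \<mu> by (rule \<mu>)
  have [measurable]: "\<xi> n \<in> borel_measurable M" for n using ind unfolding indep_vars_def by auto
  let ?X = "\<lambda>\<omega>. \<Sum>n<N. \<xi> n \<omega> *\<^sub>R e n"
  let ?Y = "\<lambda>\<omega>. \<xi> N \<omega> *\<^sub>R e N"
  have "indep_var borel ((\<lambda>f. \<Sum>n<N. f n *\<^sub>R e n) \<circ> (\<lambda>\<omega>. restrict (\<lambda>i. \<xi> i \<omega>) {..<N}))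
      borel ((\<lambda>f. f N *\<^sub>R e N) \<circ> (\<lambda>\<omega>. restrict (\<lambda>i. \<xi> i \<omega>) {N}))"
  proof (rule indep_var_compose[OF indep_var_restrict[OF ind]])
    show "(\<lambda>f. \<Sum>n<N. f n *\<^sub>R e n) \<in> borel_measurable (Pi\<^sub>M {..<N} (\<lambda>_. borel))"
      by (intro borel_measurable_sum borel_measurable_scaleR borel_measurable_const measurable_component_singleton)
    show "(\<lambda>f. f N *\<^sub>R e N) \<in> borel_measurable (Pi\<^sub>M {N} (\<lambda>_. borel))"
      by (intro borel_measurable_scaleR borel_measurable_const measurable_component_singleton) simp
  qed auto
  then have ind2: "indep_var borel ?X borel ?Y" by (simp add: comp_def)
  have mX[measurable]: "?X \<in> borel_measurable M" and mY[measurable]: "?Y \<in> borel_measurable M"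
    using indep_var_rv1[OF ind2] indep_var_rv2[OF ind2] by auto
  have pair: "distr M borel ?X \<Otimes>\<^sub>M distr M borel ?Y = distr M (borel \<Otimes>\<^sub>M borel) (\<lambda>\<omega>. (?X \<omega>, ?Y \<omega>))"
    using ind2 unfolding indep_var_distribution_eq by blast
  interpret X: prob_space "distr M borel ?X" by (rule prob_space_distr[OF mX])
  interpret Y: prob_space "distr M borel ?Y" by (rule prob_space_distr[OF mY])
  interpret P: pair_prob_space "distr M borel ?X" "distr M borel ?Y" ..
  have "bdd_cont (\<lambda>z::'h \<times> 'h. \<phi> (y + (fst z + snd z))) K"
    by (intro bdd_cont_compose[OF \<phi>] continuous_intros)
  then have m: "(\<lambda>z. \<phi> (y + (fst z + snd z))) \<in> borel_measurable (borel \<Otimes>\<^sub>M borel)"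
    unfolding borel_prod by (rule bdd_cont_measurable)
  have i: "integrable (distr M borel ?X \<Otimes>\<^sub>M distr M borel ?Y) (\<lambda>(x, w). \<phi> (y + (x + w)))"
  proof -
    have "(\<lambda>z. \<phi> (y + (fst z + snd z))) \<in> borel_measurable (distr M borel ?X \<Otimes>\<^sub>M distr M borel ?Y)"
      unfolding pair using m by simp
    then show ?thesis
      unfolding case_prod_unfold
      by (rule P.integrable_const_bound[where B=K, rotated]) (use \<phi> in \<open>simp add: bdd_cont_def\<close>)
  qed
  have "(\<integral>\<omega>. \<phi> (y + (\<Sum>n<Suc N. \<xi> n \<omega> *\<^sub>R e n)) \<partial>M)
      = (\<integral>z. \<phi> (y + (fst z + snd z)) \<partial>distr M (borel \<Otimes>\<^sub>M borel) (\<lambda>\<omega>. (?X \<omega>, ?Y \<omega>)))"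
    by (subst integral_distr[OF measurable_Pair[OF mX mY] m]) simp
  also have "\<dots> = (\<integral>w. \<integral>x. \<phi> (y + (x + w)) \<partial>distr M borel ?X \<partial>distr M borel ?Y)"
    unfolding pair[symmetric] using P.integral_snd[OF i] by (simp add: case_prod_unfold)
  also have "\<dots> = (\<integral>w. ?sm N \<phi> (y + w) \<partial>distr M borel ?Y)"
  proof (rule Bochner_Integration.integral_cong[OF refl])
    fix w
    have mw: "(\<lambda>x. \<phi> (y + (x + w))) \<in> borel_measurable borel"
      by (rule bdd_cont_measurable[OF bdd_cont_compose[OF \<phi>]]) (intro continuous_intros)
    have "(\<integral>x. \<phi> (y + (x + w)) \<partial>distr M borel ?X) = (\<integral>\<omega>. \<phi> ((y + w) + ?X \<omega>) \<partial>M)"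
      unfolding integral_distr[OF mX mw] by (simp add: ac_simps)
    then show "(\<integral>x. \<phi> (y + (x + w)) \<partial>distr M borel ?X) = ?sm N \<phi> (y + w)"
      unfolding Suc .
  qed
  also have "\<dots> = (\<integral>\<omega>. ?sm N \<phi> (y + \<xi> N \<omega> *\<^sub>R e N) \<partial>M)"
  proof (rule integral_distr[OF mY])
    show "(\<lambda>w. ?sm N \<phi> (y + w)) \<in> borel_measurable borel"
      by (rule bdd_cont_measurable[OF bdd_cont_compose[OF bdd_cont_smears[OF \<mu> \<phi>]]]) (intro continuous_intros)
  qed
  also have "\<dots> = (\<integral>w. ?sm N \<phi> (y + w *\<^sub>R e N) \<partial>distr M borel (\<xi> N))"
    by (rule integral_distr[symmetric]) (simp_all add: bdd_cont_measurable[OF bdd_cont_slice[OF bdd_cont_smears[OF \<mu> \<phi>]]])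
  also have "\<dots> = smear (distr \<mu> borel (\<lambda>x. s N * x)) (e N) (?sm N \<phi>) y"
    unfolding law smear_def ..
  also have "\<dots> = ?sm (Suc N) \<phi> y"
    by (simp add: smear_scale[OF \<mu> bdd_cont_smears[OF \<mu> \<phi>]])
  finally show ?case .
qed

text \<open>Second moments may be infinite. The bounded quantity
  \<open>g n = 1 - exp (- (\<xi> n)^2 / 2)\<close> has mean at most \<open>2 * B n\<close>, so its
  series converges almost surely, and once \<open>g n\<close> is small, \<open>4 * g n\<close>
  dominates \<open>(\<xi> n)^2\<close>.\<close>

lemma (in prob_space) AE_summable_squares:
  assumes [measurable]: "\<And>n. \<xi> n \<in> borel_measurable M" and \<alpha>: "0 \<le> \<alpha>" "\<alpha> \<le> 2"
    and bnd: "\<And>n x. 1 - Re (char (distr M borel (\<xi> n)) x) \<le> B n * \<bar>x\<bar> powr \<alpha>"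
    and B: "\<And>n. 0 \<le> B n" "summable B"
  shows "AE \<omega> in M. summable (\<lambda>n. (\<xi> n \<omega>)\<^sup>2)"
proof -
  define g where "g n \<omega> = 1 - exp (- (\<xi> n \<omega>)\<^sup>2 / 2)" for n \<omega>
  have [measurable]: "g n \<in> borel_measurable M" for n unfolding g_def by measurable
  have g0: "0 \<le> g n \<omega>" for n \<omega> by (simp add: g_def)
  have gi: "(\<integral>\<^sup>+\<omega>. ennreal (g n \<omega>) \<partial>M) \<le> ennreal (2 * B n)" for n
  proof -
    have "real_distribution (distr M borel (\<xi> n))" by (rule real_distribution_distr) simp
    from gaussian_average_bound[OF this \<alpha> B(1) _ bnd, of 1]
    have "(\<integral>x. 1 - exp (- (1 * x)\<^sup>2 / 2) \<partial>distr M borel (\<xi> n)) \<le> 2 * B n" by simp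
    then have "(\<integral>\<omega>. g n \<omega> \<partial>M) \<le> 2 * B n" unfolding g_def by (subst (asm) integral_distr) auto
    moreover have "integrable M (g n)" by (intro integrable_const_bound[where B=1]) (auto simp: g_def)
    ultimately show ?thesis using g0 by (subst nn_integral_eq_integral) (auto simp: ennreal_leI)
  qed
  have "(\<integral>\<^sup>+\<omega>. (\<Sum>n. ennreal (g n \<omega>)) \<partial>M) = (\<Sum>n. \<integral>\<^sup>+\<omega>. ennreal (g n \<omega>) \<partial>M)"
    by (rule nn_integral_suminf) measurable
  also have "\<dots> \<le> (\<Sum>n. ennreal (2 * B n))" by (intro suminf_le gi) auto
  also have "\<dots> = ennreal (\<Sum>n. 2 * B n)" using B by (intro suminf_ennreal2 summable_mult) auto
  also have "\<dots> < \<infinity>" by simp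
  finally have "AE \<omega> in M. (\<Sum>n. ennreal (g n \<omega>)) \<noteq> \<infinity>"
    by (intro nn_integral_PInf_AE) auto
  then show ?thesis
  proof eventually_elim
    case (elim \<omega>)
    have sg: "summable (\<lambda>n. g n \<omega>)" using elim g0 by (intro summable_suminf_not_top) auto
    then have "\<forall>\<^sub>F n in sequentially. g n \<omega> < 1 / 3"
      using summable_LIMSEQ_zero by (intro order_tendstoD(2)) auto
    then have "\<forall>\<^sub>F n in sequentially. norm ((\<xi> n \<omega>)\<^sup>2) \<le> 4 * g n \<omega>"
    proof eventually_elim
      case (elim n)
      define y where "y = (\<xi> n \<omega>)\<^sup>2 / 2"
      have y: "0 \<le> y" "g n \<omega> = 1 - exp (- y)" by (auto simp: y_def g_def)
      have e1: "1 + y \<le> exp y" by (rule exp_ge_add_one_self)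
      then have "exp (- y) \<le> 1 / (1 + y)" using y(1) by (simp add: exp_minus field_simps)
      then have le: "1 - 1 / (1 + y) \<le> g n \<omega>" using y(2) by simp
      \<comment> \<open>The threshold 1 / 3 for \<open>g n\<close> keeps \<open>y\<close> below 1,
        and then \<open>y / (1 + y) \<ge> y / 2\<close>.\<close>
      have "2 / 3 < 1 / (1 + y)" using le elim by linarith
      then have "y \<le> 1" using y(1) by (simp add: field_simps)
      then have "1 - 1 / (1 + y) \<ge> y / 2" using y(1) mult_left_le[of y y] by (simp add: field_simps)
      then show ?case using le by (simp add: y_def)
    qed
    then show ?case by (rule summable_comparison_test_ev) (intro summable_mult sg)
  qed
qed

text \<open>Serves the noise series, which is identified with a measurable limit only almost
  surely.\<close>

lemma (in complete_measure) borel_measurable_AE_eq: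
  assumes f: "f \<in> borel_measurable M" and eq: "AE x in M. f x = g x"
  shows "g \<in> borel_measurable M"
proof (rule measurableI)
  fix A :: "'b set" assume A: "A \<in> sets borel"
  show "g -` A \<inter> space M \<in> sets M"
  proof (rule in_sets_AE)
    show "AE x in M. x \<in> f -` A \<inter> space M \<longleftrightarrow> x \<in> g -` A \<inter> space M"
      using eq by eventually_elim auto
  qed (use measurable_sets[OF f A] in auto)
qed simp

text \<open>The singularity \<open>t\<^sup>-\<^sup>\<gamma>\<close>: with \<open>z = g t\<close> the quotient of the two sides is at most
  \<open>exp (- z) (1 + 2 z) (1 + z) / 4 \<le> 1\<close>.\<close>

lemma smoothing_rate:
  assumes \<alpha>: "1 < \<alpha>" "\<alpha> < 2" and g: "0 < g" and t: "0 < t" and C: "0 < (C::real)"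
    and \<gamma>: "1 / \<alpha> \<le> \<gamma>" "\<gamma> < 1" and \<beta>: "C * g powr (1 / \<alpha> - \<gamma>) \<le> \<beta>"
  shows "exp (- g * t) \<le> 4 / C * t powr (- \<gamma>) * (\<beta> * ((1 - exp (- (\<alpha> * g) * t)) / (\<alpha> * g)) powr (1 / \<alpha>))"
proof -
  define z where "z = g * t"
  have z: "0 < z" using g t by (simp add: z_def)
  \<comment> \<open>\<open>exp (\<alpha> * z) \<ge> q\<close> turns
    \<open>1 - exp (- (\<alpha> * z))\<close> into the rational lower bound
    \<open>\<alpha> * z / q\<close>.\<close>
  define q where "q = 1 + \<alpha> * z"
  have q: "1 < q" using \<alpha> z by (simp add: q_def)
  have "q \<le> exp (\<alpha> * z)" unfolding q_def by (rule exp_ge_add_one_self)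
  then have "exp (- (\<alpha> * z)) \<le> 1 / q" using q by (simp add: exp_minus field_simps)
  then have "1 - 1 / q \<le> 1 - exp (- (\<alpha> * g) * t)" by (simp add: z_def mult.assoc)
  moreover have "1 - 1 / q = \<alpha> * z / q" using q by (simp add: q_def field_simps)
  ultimately have "\<alpha> * z / q / (\<alpha> * g) \<le> (1 - exp (- (\<alpha> * g) * t)) / (\<alpha> * g)"
    using \<alpha> g by (intro divide_right_mono) auto
  moreover have "\<alpha> * z / q / (\<alpha> * g) = t / q" using \<alpha> g by (simp add: z_def)
  ultimately have pm: "(t / q) powr (1 / \<alpha>) \<le> ((1 - exp (- (\<alpha> * g) * t)) / (\<alpha> * g)) powr (1 / \<alpha>)"
    using \<alpha> t q by (intro powr_mono2) auto
  have s: "(C * g powr (1 / \<alpha> - \<gamma>)) * (t / q) powr (1 / \<alpha>) \<le> \<beta> * ((1 - exp (- (\<alpha> * g) * t)) / (\<alpha> * g)) powr (1 / \<alpha>)"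
  proof (intro mult_mono \<beta> pm)
    have "0 \<le> C * g powr (1 / \<alpha> - \<gamma>)" using C by simp
    then show "0 \<le> \<beta>" using \<beta> by (rule order_trans)
    show "0 \<le> (t / q) powr (1 / \<alpha>)" by (rule powr_ge_zero)
  qed
  have "q powr (1 / \<alpha>) \<le> q powr 1" using q \<alpha> by (intro powr_mono) auto
  also have "\<dots> \<le> 1 + 2 * z" using q \<alpha> z by (simp add: q_def)
  finally have 1: "q powr (1 / \<alpha>) \<le> 1 + 2 * z" .
  have 2: "z powr (\<gamma> - 1 / \<alpha>) \<le> 1 + z"
  proof (cases "z \<le> 1")
    case True
    then show ?thesis using z \<gamma> powr_le1[of "\<gamma> - 1 / \<alpha>" z] by simp
  next
    case False
    have "1 / \<alpha> > 0" using \<alpha> by simp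
    then have "\<gamma> - 1 / \<alpha> \<le> 1" using \<gamma> by linarith
    then have "z powr (\<gamma> - 1 / \<alpha>) \<le> z powr 1" using False by (intro powr_mono) auto
    then show ?thesis using z by simp
  qed
  have "q powr (1 / \<alpha>) * z powr (\<gamma> - 1 / \<alpha>) \<le> (1 + 2 * z) * (1 + z)"
    using 1 2 z by (intro mult_mono) auto
  also have "\<dots> \<le> 4 * (1 + z + z\<^sup>2 / 2)" using z by (simp add: power2_eq_square algebra_simps)
  also have "\<dots> \<le> 4 * exp z" using exp_lower_Taylor_quadratic[of z] z by simp
  finally have 3: "exp (- z) * (q powr (1 / \<alpha>) * z powr (\<gamma> - 1 / \<alpha>)) \<le> 4" by (simp add: exp_minus field_simps)
  define E where "E = q powr (1 / \<alpha>) * z powr (\<gamma> - 1 / \<alpha>)"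
  \<comment> \<open>\<open>C * s0\<close> is the lower bound on the noise scale; in
    \<open>s0 * E\<close> all powers of \<open>g\<close> and \<open>q\<close> cancel, leaving
    \<open>t powr \<gamma>\<close>.\<close>
  define s0 where "s0 = g powr (1 / \<alpha> - \<gamma>) * (t / q) powr (1 / \<alpha>)"
  have s0: "0 \<le> s0" by (simp add: s0_def)
  have "s0 * E = (g powr (1 / \<alpha> - \<gamma>) * g powr (\<gamma> - 1 / \<alpha>)) * (t powr (1 / \<alpha>) * t powr (\<gamma> - 1 / \<alpha>))"
    using t q g by (simp add: s0_def E_def z_def powr_mult powr_divide)
  also have "\<dots> = t powr \<gamma>" using t g by (simp flip: powr_add)
  finally have s0E: "s0 * E = t powr \<gamma>" .
  have "exp (- z) = exp (- z) * (t powr (- \<gamma>) * (s0 * E))" unfolding s0E using t by (simp flip: powr_add)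
  also have "\<dots> = t powr (- \<gamma>) * s0 * (exp (- z) * E)" by (simp add: ac_simps)
  also have "\<dots> \<le> t powr (- \<gamma>) * s0 * 4" using 3 s0 by (intro mult_left_mono) (auto simp: E_def)
  also have "\<dots> = 4 / C * t powr (- \<gamma>) * (C * s0)" using C by simp
  also have "\<dots> \<le> 4 / C * t powr (- \<gamma>) * (\<beta> * ((1 - exp (- (\<alpha> * g) * t)) / (\<alpha> * g)) powr (1 / \<alpha>))"
    using s C by (intro mult_left_mono) (auto simp: s0_def mult.assoc)
  finally show ?thesis by (simp add: z_def)
qed

section \<open>The noise series under the standing hypothesis\<close>

locale OU_setting = diagonal_semigroup e D A S \<gamma>n
  for e :: "nat \<Rightarrow> 'h::{real_inner, polish_space}" and D A S \<gamma>n +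
  fixes M :: "'w measure" and \<F> and Z :: "nat \<Rightarrow> real \<Rightarrow> 'w \<Rightarrow> real" and \<alpha> \<gamma> C :: real and \<beta> :: "nat \<Rightarrow> real"
  assumes \<alpha>: "1 < \<alpha>" "\<alpha> < 2" and \<beta>_pos: "\<And>n. 0 < \<beta> n"
    and sbasis: "stochastic_basis M \<F>"
    and stable: "\<And>n. stable_levy_process M \<F> \<alpha> (Z n)"
    and indep: "independent_processes M Z"
    and \<gamma>n_pos: "\<And>n. 0 < \<gamma>n n"
    and \<gamma>: "1 / \<alpha> \<le> \<gamma>" "\<gamma> < 1" and C: "0 < C"
    and \<beta>_lower: "\<And>n. C * \<gamma>n n powr (1 / \<alpha> - \<gamma>) \<le> \<beta> n"
    and \<beta>_sum: "summable (\<lambda>n. \<beta> n powr \<alpha> / \<gamma>n n)"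
begin

sublocale prob_space M
  using sbasis by (simp add: stochastic_basis_def)

sublocale complete_measure M
  using sbasis by (simp add: stochastic_basis_def)

abbreviation P :: "real \<Rightarrow> ('h \<Rightarrow> real) \<Rightarrow> 'h \<Rightarrow> real" where
  "P \<equiv> transition_semigroup M (OU_process M S e \<beta> \<gamma>n Z)"

definition coef :: "real \<Rightarrow> nat \<Rightarrow> 'w \<Rightarrow> real" where
  "coef t n \<omega> = \<beta> n * stochastic_integral M (\<lambda>s. exp (- \<gamma>n n * (t - s))) (Z n) t \<omega>"

text \<open>A version of \<open>coef\<close> that is a functional of the path of \<open>Z n\<close>,
  and hence independent over \<open>n\<close>; \<open>component_facts\<close> shows that the two
  agree almost surely.\<close>

definition coef' :: "real \<Rightarrow> nat \<Rightarrow> 'w \<Rightarrow> real" where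
  "coef' t n \<omega> = \<beta> n * lim (\<lambda>k. left_sum (\<lambda>s. exp (- \<gamma>n n * (t - s))) (Suc k) (unif t k) (\<lambda>s. Z n s \<omega>))"

text \<open>Scale parameter of the stable law of \<open>coef t n\<close>: \<open>\<beta> n\<close>
  times the \<open>L^\<alpha>\<close> norm of the kernel
  \<open>exp (- \<gamma>n n * (t - s))\<close> on \<open>[0, t]\<close>.\<close>

definition scale :: "real \<Rightarrow> nat \<Rightarrow> real" where
  "scale t n = \<beta> n * ((1 - exp (- (\<alpha> * \<gamma>n n) * t)) / (\<alpha> * \<gamma>n n)) powr (1 / \<alpha>)"

lemma component_facts:
  assumes t: "0 \<le> t"
  shows "coef t n \<in> borel_measurable M" "AE \<omega> in M. \<forall>n. coef' t n \<omega> = coef t n \<omega>"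
    "indep_vars (\<lambda>_. borel) (coef' t) UNIV"
proof -
  have \<alpha>0: "0 < \<alpha>" using \<alpha> by simp
  note comp = OU_component[OF sbasis stable t \<gamma>n_pos \<alpha>0]
  show "coef t n \<in> borel_measurable M"
    unfolding coef_def[abs_def] by (intro borel_measurable_times borel_measurable_const comp(1))
  have "AE \<omega> in M. coef' t n \<omega> = coef t n \<omega>" for n
    using comp(2)[of n n]
  proof eventually_elim
    case (elim \<omega>)
    then show ?case unfolding coef_def coef'_def using limI by metis
  qed
  then show "AE \<omega> in M. \<forall>n. coef' t n \<omega> = coef t n \<omega>" by (simp add: AE_all_countable)
  have "indep_vars (\<lambda>_. borel) (\<lambda>n \<omega>. \<beta> n * lim (\<lambda>k. left_sum (\<lambda>s. exp (- \<gamma>n n * (t - s))) (Suc k) (unif t k) (\<lambda>s. Z n s \<omega>))) UNIV"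
    by (rule indep_vars_compose2[OF indep_OU_components[OF indep prob_space_axioms t]]) simp
  then show "indep_vars (\<lambda>_. borel) (coef' t) UNIV" unfolding coef'_def[abs_def] .
qed

lemma coef'_measurable: "0 \<le> t \<Longrightarrow> coef' t n \<in> borel_measurable M"
  using component_facts(3)[of t] unfolding indep_vars_def by auto

lemma scale_pos:
  assumes "0 < t"
  shows "0 < scale t n"
proof -
  have "0 < \<alpha> * \<gamma>n n" using \<alpha> \<gamma>n_pos by simp
  then have "0 < (1 - exp (- (\<alpha> * \<gamma>n n) * t)) / (\<alpha> * \<gamma>n n)"
    using assms by (intro divide_pos_pos) (auto simp: mult_pos_pos)
  then show ?thesis unfolding scale_def using \<beta>_pos[of n] by (intro mult_pos_pos) auto
qed

lemma char_coef:
  assumes t: "0 < t"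
  shows "char (distr M borel (coef' t n)) x = of_real (exp (- (\<bar>scale t n * x\<bar> powr \<alpha>)))"
    "scale t n powr \<alpha> \<le> \<beta> n powr \<alpha> / \<gamma>n n"
proof -
  have t0: "0 \<le> t" and \<alpha>0: "0 < \<alpha>" using t \<alpha> by auto
  let ?V = "(1 - exp (- (\<alpha> * \<gamma>n n) * t)) / (\<alpha> * \<gamma>n n)"
  have ag: "0 < \<alpha> * \<gamma>n n" using \<alpha> \<gamma>n_pos by simp
  then have V: "0 < ?V" using t by (intro divide_pos_pos) (auto simp: mult_pos_pos)
  have sp: "scale t n powr \<alpha> = \<beta> n powr \<alpha> * ?V"
  proof -
    have "(v powr (1 / \<alpha>)) powr \<alpha> = v" if "0 < v" for v :: real using that \<alpha> by (simp add: powr_powr)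
    from this[OF V] show ?thesis unfolding scale_def using \<beta>_pos[of n] by (simp only: powr_mult)
  qed
  have "?V \<le> 1 / (\<alpha> * \<gamma>n n)" using ag by (intro divide_right_mono) auto
  also have "\<dots> \<le> 1 / \<gamma>n n" using \<alpha> \<gamma>n_pos[of n] by (simp add: field_simps)
  finally have "\<beta> n powr \<alpha> * ?V \<le> \<beta> n powr \<alpha> * (1 / \<gamma>n n)" by (intro mult_left_mono) auto
  then show "scale t n powr \<alpha> \<le> \<beta> n powr \<alpha> / \<gamma>n n" unfolding sp by simp
  define I where "I = stochastic_integral M (\<lambda>s. exp (- \<gamma>n n * (t - s))) (Z n) t"
  note comp = OU_component[OF sbasis stable t0 \<gamma>n_pos \<alpha>0]
  have [measurable]: "I \<in> borel_measurable M" unfolding I_def by (rule comp(1))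
  have ae: "AE \<omega> in M. coef' t n \<omega> = \<beta> n * I \<omega>"
    using component_facts(2)[OF t0] by eventually_elim (simp add: coef_def I_def)
  have "distr M borel (coef' t n) = distr M borel (\<lambda>\<omega>. \<beta> n * I \<omega>)"
    by (intro distr_cong_AE refl ae coef'_measurable[OF t0]) simp
  also have "char \<dots> x = char (distr M borel I) (\<beta> n * x)"
    unfolding char_def by (subst (1 2) integral_distr) (auto simp: ac_simps)
  also have "\<dots> = of_real (exp (- (?V * \<bar>\<beta> n * x\<bar> powr \<alpha>)))" unfolding I_def by (rule comp(3))
  also have "?V * \<bar>\<beta> n * x\<bar> powr \<alpha> = \<bar>scale t n * x\<bar> powr \<alpha>"
    using sp \<beta>_pos[of n] scale_pos[OF t, of n] by (simp add: abs_mult powr_mult)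
  finally show "char (distr M borel (coef' t n)) x = of_real (exp (- (\<bar>scale t n * x\<bar> powr \<alpha>)))" .
qed

text \<open>\<open>1 - exp (- y) \<le> y\<close> supplies the bound on the characteristic functions
  with \<open>B n = scale t n powr \<alpha>\<close>, summable since it is at most
  \<open>\<beta> n powr \<alpha> / \<gamma>n n\<close>.\<close>

lemma series_converges:
  assumes t: "0 < t"
  shows "AE \<omega> in M. summable (\<lambda>n. coef t n \<omega> *\<^sub>R e n)"
proof -
  have t0: "0 \<le> t" using t by simp
  have "AE \<omega> in M. summable (\<lambda>n. (coef' t n \<omega>)\<^sup>2)"
  proof (rule AE_summable_squares[OF coef'_measurable[OF t0], where \<alpha>=\<alpha> and B="\<lambda>n. scale t n powr \<alpha>"])
    fix n x
    have "1 - exp (- (\<bar>scale t n * x\<bar> powr \<alpha>)) \<le> \<bar>scale t n * x\<bar> powr \<alpha>"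
      using exp_ge_add_one_self[of "- (\<bar>scale t n * x\<bar> powr \<alpha>)"] by linarith
    also have "\<dots> = scale t n powr \<alpha> * \<bar>x\<bar> powr \<alpha>" using scale_pos[OF t, of n] by (simp add: abs_mult powr_mult)
    finally show "1 - Re (char (distr M borel (coef' t n)) x) \<le> scale t n powr \<alpha> * \<bar>x\<bar> powr \<alpha>"
      unfolding char_coef(1)[OF t] Re_complex_of_real .
  next
    show "summable (\<lambda>n. scale t n powr \<alpha>)"
      by (rule summable_comparison_test'[OF \<beta>_sum, of 0]) (use char_coef(2)[OF t] in auto)
  qed (use \<alpha> in auto)
  then show ?thesis
    using component_facts(2)[OF t0]
  proof eventually_elim
    case (elim \<omega>)
    then have "summable (\<lambda>n. (coef t n \<omega>)\<^sup>2)" by simp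
    then show ?case by (rule summable_orthonormal[OF basis])
  qed
qed

definition noise :: "real \<Rightarrow> 'w \<Rightarrow> 'h" where
  "noise t \<omega> = (\<Sum>n. coef t n \<omega> *\<^sub>R e n)"

lemma P_eq: "P t \<phi> x = (\<integral>\<omega>. \<phi> (S t x + noise t \<omega>) \<partial>M)"
  unfolding transition_semigroup_def OU_process_def noise_def coef_def ..

lemma noise_partial_sums:
  assumes t: "0 < t" and \<phi>: "bdd_cont \<phi> K"
  shows "(\<lambda>\<omega>. \<phi> (y + noise t \<omega>)) \<in> borel_measurable M"
    "(\<lambda>N. \<integral>\<omega>. \<phi> (y + (\<Sum>n<N. coef' t n \<omega> *\<^sub>R e n)) \<partial>M) \<longlonglongrightarrow> (\<integral>\<omega>. \<phi> (y + noise t \<omega>) \<partial>M)"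
proof -
  have t0: "0 \<le> t" using t by simp
  let ?f = "\<lambda>N \<omega>. \<phi> (y + (\<Sum>n<N. coef' t n \<omega> *\<^sub>R e n))"
  have c: "continuous_on UNIV (\<lambda>z. \<phi> (y + z))"
  proof -
    have "bdd_cont (\<lambda>z. \<phi> (y + z)) K" by (rule bdd_cont_compose[OF \<phi>]) (intro continuous_intros)
    then show ?thesis by (simp add: bdd_cont_def)
  qed
  then have "(\<lambda>z. \<phi> (y + z)) \<in> borel_measurable borel" by (rule borel_measurable_continuous_onI)
  moreover have "(\<lambda>\<omega>. \<Sum>n<N. coef' t n \<omega> *\<^sub>R e n) \<in> borel_measurable M" for N
    by (intro borel_measurable_sum borel_measurable_scaleR borel_measurable_const coef'_measurable t0)
  ultimately have mf: "?f N \<in> borel_measurable M" for N by (rule measurable_compose[rotated])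
  have lim: "AE \<omega> in M. (\<lambda>N. ?f N \<omega>) \<longlonglongrightarrow> \<phi> (y + noise t \<omega>)"
    using series_converges[OF t] component_facts(2)[OF t0]
  proof eventually_elim
    case (elim \<omega>)
    then have "(\<lambda>N. \<Sum>n<N. coef' t n \<omega> *\<^sub>R e n) \<longlonglongrightarrow> noise t \<omega>"
      unfolding noise_def using summable_LIMSEQ by force
    moreover have "isCont (\<lambda>z. \<phi> (y + z)) (noise t \<omega>)" using c by (simp add: continuous_on_eq_continuous_at)
    ultimately show ?case by (rule isCont_tendsto_compose[rotated])
  qed
  \<comment> \<open>The series is known to converge only almost surely, so measurability comes from
    the limit of the partial sums and completeness of \<open>M\<close>.\<close>
  show m: "(\<lambda>\<omega>. \<phi> (y + noise t \<omega>)) \<in> borel_measurable M"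
  proof (rule borel_measurable_AE_eq)
    show "(\<lambda>\<omega>. lim (\<lambda>N. ?f N \<omega>)) \<in> borel_measurable M" by (rule borel_measurable_lim_metric[OF mf])
    show "AE \<omega> in M. lim (\<lambda>N. ?f N \<omega>) = \<phi> (y + noise t \<omega>)" using lim by eventually_elim (rule limI)
  qed
  show "(\<lambda>N. \<integral>\<omega>. ?f N \<omega> \<partial>M) \<longlonglongrightarrow> (\<integral>\<omega>. \<phi> (y + noise t \<omega>) \<partial>M)"
    by (rule integral_dominated_convergence[where w="\<lambda>_. K", OF m mf _ lim])
      (use \<phi> in \<open>auto simp: bdd_cont_def\<close>)
qed

lemma noise_average_continuous:
  assumes t: "0 < t" and \<phi>: "bdd_cont \<phi> K" and X: "X \<longlonglongrightarrow> y"
  shows "(\<lambda>m. \<integral>\<omega>. \<phi> (X m + noise t \<omega>) \<partial>M) \<longlonglongrightarrow> (\<integral>\<omega>. \<phi> (y + noise t \<omega>) \<partial>M)"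
proof (rule integral_dominated_convergence[where w="\<lambda>_. K", OF noise_partial_sums(1)[OF t \<phi>] noise_partial_sums(1)[OF t \<phi>]])
  show "AE \<omega> in M. (\<lambda>m. \<phi> (X m + noise t \<omega>)) \<longlonglongrightarrow> \<phi> (y + noise t \<omega>)"
  proof (rule AE_I2)
    fix \<omega>
    have "isCont \<phi> (y + noise t \<omega>)" using \<phi> by (simp add: bdd_cont_def continuous_on_eq_continuous_at)
    then show "(\<lambda>m. \<phi> (X m + noise t \<omega>)) \<longlonglongrightarrow> \<phi> (y + noise t \<omega>)"
      by (rule isCont_tendsto_compose) (intro tendsto_intros X)
  qed
qed (use \<phi> in \<open>auto simp: bdd_cont_def\<close>)

text \<open>\<open>smoothing_rate\<close> bounds the ratio of \<open>exp (- \<gamma>n n * t)\<close>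
  to the noise scale by \<open>4 / C * t powr (- \<gamma>)\<close> for every \<open>n\<close> at
  once, so Bessel's inequality applies. The cut-off \<open>n < m\<close> stands for the projection
  of the increment, whose dimension \<open>m\<close> is separate from the dimension \<open>N\<close>
  of the noise.\<close>

lemma semigroup_coordinates_bound:
  assumes t: "0 < t"
  shows "sqrt (\<Sum>n<N. (if n < m then (S t a \<bullet> e n) / scale t n else 0)\<^sup>2) \<le> 4 / C * t powr (- \<gamma>) * norm a"
proof -
  let ?k = "4 / C * t powr (- \<gamma>)"
  have k: "0 \<le> ?k" using C by simp
  have "(\<Sum>n<N. (if n < m then (S t a \<bullet> e n) / scale t n else 0)\<^sup>2) \<le> (\<Sum>n<N. ?k\<^sup>2 * (a \<bullet> e n)\<^sup>2)"
  proof (rule sum_mono)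
    fix n
    have "exp (- \<gamma>n n * t) \<le> ?k * scale t n"
      unfolding scale_def by (rule smoothing_rate[OF \<alpha> \<gamma>n_pos t C \<gamma> \<beta>_lower])
    then have "exp (- \<gamma>n n * t) / scale t n \<le> ?k" using scale_pos[OF t, of n] by (simp add: field_simps)
    then have "(exp (- \<gamma>n n * t) / scale t n)\<^sup>2 \<le> ?k\<^sup>2"
      using scale_pos[OF t, of n] by (intro power_mono) auto
    then have "(exp (- \<gamma>n n * t) / scale t n)\<^sup>2 * (a \<bullet> e n)\<^sup>2 \<le> ?k\<^sup>2 * (a \<bullet> e n)\<^sup>2" by (rule mult_right_mono) simp
    moreover have "(S t a \<bullet> e n) / scale t n = exp (- \<gamma>n n * t) / scale t n * (a \<bullet> e n)"
      using inner_semigroup[of t a n] t by simp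
    ultimately show "(if n < m then (S t a \<bullet> e n) / scale t n else 0)\<^sup>2 \<le> ?k\<^sup>2 * (a \<bullet> e n)\<^sup>2"
      by (simp only: power_mult_distrib split: if_split) simp
  qed
  also have "\<dots> = ?k\<^sup>2 * (\<Sum>n<N. (a \<bullet> e n)\<^sup>2)" by (rule sum_distrib_left[symmetric])
  also have "\<dots> \<le> ?k\<^sup>2 * (norm a)\<^sup>2" by (intro mult_left_mono bessel_inequality[OF basis]) simp
  also have "\<dots> = (?k * norm a)\<^sup>2" by (rule power_mult_distrib[symmetric])
  finally show ?thesis by (intro real_le_lsqrt mult_nonneg_nonneg[OF k norm_ge_zero])
qed

text \<open>The estimate for finitely many noise coordinates reaches only shifts in their span.
  Hence two limits in this order: \<open>N\<close> tends to infinity in the noise with increments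
  projected to the first \<open>m\<close> coordinates, then \<open>m\<close> to infinity by
  continuity of the average.\<close>

lemma transition_differences:
  obtains c where "0 < c"
    "\<And>t \<phi> K x a. 0 < t \<Longrightarrow> bdd_cont \<phi> K \<Longrightarrow> \<bar>P t \<phi> (x + a) - P t \<phi> x\<bar> \<le> K * (c * t powr (- \<gamma>) * norm a)"
    "\<And>t \<phi> K x a b. 0 < t \<Longrightarrow> bdd_cont \<phi> K \<Longrightarrow>
      \<bar>second_diff (P t \<phi>) x a b\<bar>
        \<le> K * (c * t powr (- \<gamma>) * norm a) * (c * t powr (- \<gamma>) * norm b)"
proof -
  obtain b0 \<nu> where b0: "0 < b0" and \<nu>: "real_distribution \<nu>"
    and fac: "\<And>\<xi>. of_real (exp (- (\<bar>\<xi>\<bar> powr \<alpha>))) = char laplace (b0 * \<xi>) * char laplace (b0 * \<xi>) * char \<nu> \<xi>"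
    using stable_Laplace_factor[OF \<alpha>] by blast
  let ?Lb = "distr laplace borel (\<lambda>x. b0 * x)"
  define \<mu> where "\<mu> = (?Lb \<star> (?Lb \<star> \<nu>))"
  note Lb = char_distr_scale[OF real_distribution_laplace, of b0]
  note c1 = char_convolution[OF Lb(1) \<nu>]
  note c2 = char_convolution[OF Lb(1) c1(1)]
  have \<mu>: "real_distribution \<mu>" unfolding \<mu>_def by (rule c2(1))
  have char_\<mu>: "char \<mu> \<xi> = of_real (exp (- (\<bar>\<xi>\<bar> powr \<alpha>)))" for \<xi>
    unfolding \<mu>_def c2(2) c1(2) Lb(2) fac by (simp only: mult.assoc)
  define c0 where "c0 = 2 * exp 2 / \<bar>b0\<bar>"
  have c0: "0 < c0" using b0 by (simp add: c0_def)
  define c where "c = c0 * (4 / C)"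
  have c: "0 < c" using c0 C by (simp add: c_def)
  have main: "\<bar>P t \<phi> (x + a) - P t \<phi> x\<bar> \<le> K * (c * t powr (- \<gamma>) * norm a) \<and>
      \<bar>second_diff (P t \<phi>) x a b\<bar>
        \<le> K * (c * t powr (- \<gamma>) * norm a) * (c * t powr (- \<gamma>) * norm b)"
    if t: "0 < t" and \<phi>: "bdd_cont \<phi> K" for t \<phi> K x a b
  proof -
    have t0: "0 \<le> t" using t by simp
    have K: "0 \<le> K" by (rule bdd_cont_nonneg[OF \<phi>])
    let ?V = "\<lambda>n. scale t n *\<^sub>R e n"
    define Q where "Q N = smears \<mu> ?V N \<phi>" for N
    define E where "E y = (\<integral>\<omega>. \<phi> (y + noise t \<omega>) \<partial>M)" for y
    \<comment> \<open>Both sides have the characteristic function of a stable law of scale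
      \<open>scale t n\<close>; this is where the Laplace factors enter the process.\<close>
    have law: "distr M borel (coef' t n) = distr \<mu> borel (\<lambda>x. scale t n * x)" for n
    proof (rule Levy_uniqueness)
      show "real_distribution (distr M borel (coef' t n))"
        by (rule real_distribution_distr[OF coef'_measurable[OF t0]])
      show "real_distribution (distr \<mu> borel (\<lambda>x. scale t n * x))" by (rule char_distr_scale(1)[OF \<mu>])
      show "char (distr M borel (coef' t n)) = char (distr \<mu> borel (\<lambda>x. scale t n * x))"
        by (rule ext) (simp only: char_coef(1)[OF t] char_distr_scale(2)[OF \<mu>] char_\<mu>)
    qed
    have Q_lim: "(\<lambda>N. Q N y) \<longlonglongrightarrow> E y" for y
      unfolding Q_def E_def expectation_smears[OF component_facts(3)[OF t0] \<mu> law \<phi>, symmetric]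
      by (rule noise_partial_sums(2)[OF t \<phi>])
    have E_lim: "(\<lambda>m. E (X m)) \<longlonglongrightarrow> E y" if "X \<longlonglongrightarrow> y" for X y
      unfolding E_def by (rule noise_average_continuous[OF t \<phi> that])
    let ?a = "\<lambda>m. basis_proj e m (S t a)" and ?b = "\<lambda>m. basis_proj e m (S t b)" and ?x = "S t x"
    have proj: "basis_proj e m z = (\<Sum>n<N. (if n < m then (z \<bullet> e n) / scale t n else 0) *\<^sub>R ?V n)" if "m \<le> N" for m N z
    proof -
      have "(\<Sum>n<N. (if n < m then (z \<bullet> e n) / scale t n else 0) *\<^sub>R ?V n) = (\<Sum>n<N. if n < m then (z \<bullet> e n) *\<^sub>R e n else 0)"
        using less_imp_neq[OF scale_pos[OF t]] by (intro sum.cong refl) (auto simp: scaleR_scaleR)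
      also have "\<dots> = (\<Sum>n\<in>{..<N} \<inter> {n. n < m}. (z \<bullet> e n) *\<^sub>R e n)" by (simp add: sum.inter_restrict)
      also have "{..<N} \<inter> {n. n < m} = {..<m}" using that by auto
      finally show ?thesis by (simp add: basis_proj_def)
    qed
    let ?ka = "c * t powr (- \<gamma>) * norm a" and ?kb = "c * t powr (- \<gamma>) * norm b"
    have kk: "c0 * sqrt (\<Sum>n<N. (if n < m then (S t z \<bullet> e n) / scale t n else 0)\<^sup>2) \<le> c * t powr (- \<gamma>) * norm z" for N m z
      using mult_left_mono[OF semigroup_coordinates_bound[OF t, where m=m and N=N and a=z], of c0] c0
      by (simp add: c_def mult.assoc)
    have QN: "\<bar>Q N (?x + ?a m) - Q N ?x\<bar> \<le> K * ?ka \<and>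
        \<bar>second_diff (Q N) ?x (?a m) (?b m)\<bar> \<le> K * ?ka * ?kb" if "m \<le> N" for m N
    proof -
      note sd = smears_second_diff[OF \<phi> \<nu> _ proj[OF that] proj[OF that], where b=b0 and x="?x", folded \<mu>_def c0_def]
      let ?s = "\<lambda>z. sqrt (\<Sum>n<N. (if n < m then (S t z \<bullet> e n) / scale t n else 0)\<^sup>2)"
      have s0: "0 \<le> ?s z" for z by (simp add: sum_nonneg)
      have ka: "c0 * ?s a \<le> ?ka" and kb: "c0 * ?s b \<le> ?kb" by (rule kk)+
      have 1: "c0 * K * ?s a \<le> K * ?ka" using mult_left_mono[OF ka K] by (simp add: ac_simps)
      have "\<bar>Q N (?x + ?a m) - Q N ?x\<bar> \<le> c0 * K * ?s a" unfolding Q_def using b0 by (intro sd(1)) simp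
      moreover have "\<bar>second_diff (Q N) ?x (?a m) (?b m)\<bar>
          \<le> c0 * (c0 * K * ?s a) * ?s b" unfolding Q_def using b0 by (intro sd(2)) simp
      moreover have "c0 * (c0 * K * ?s a) * ?s b = (c0 * K * ?s a) * (c0 * ?s b)" by (simp add: ac_simps)
      moreover have "\<dots> \<le> (K * ?ka) * ?kb" 
      proof (rule mult_mono[OF 1 kb])
        show "0 \<le> K * ?ka" using K c by simp
        show "0 \<le> c0 * ?s b" using c0 s0[of b] by (intro mult_nonneg_nonneg) auto
      qed
      ultimately show ?thesis using 1 by linarith
    qed
    have Em: "\<bar>E (?x + ?a m) - E ?x\<bar> \<le> K * ?ka \<and>
        \<bar>second_diff E ?x (?a m) (?b m)\<bar> \<le> K * ?ka * ?kb" for m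
    proof
      have "(\<lambda>N. \<bar>Q N (?x + ?a m) - Q N ?x\<bar>) \<longlonglongrightarrow> \<bar>E (?x + ?a m) - E ?x\<bar>"
        by (intro tendsto_intros Q_lim)
      then show "\<bar>E (?x + ?a m) - E ?x\<bar> \<le> K * ?ka" using QN by (intro LIMSEQ_le_const2) auto
      have "(\<lambda>N. \<bar>second_diff (Q N) ?x (?a m) (?b m)\<bar>)
          \<longlonglongrightarrow> \<bar>second_diff E ?x (?a m) (?b m)\<bar>"
        by (intro tendsto_intros Q_lim)
      then show "\<bar>second_diff E ?x (?a m) (?b m)\<bar> \<le> K * ?ka * ?kb"
        using QN by (intro LIMSEQ_le_const2) auto
    qed
    interpret St: bounded_linear "S t" by (rule C0_semigroupD(1)[OF C0 t0])
    note pt = basis_proj_tendsto[OF basis]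
    have "(\<lambda>m. \<bar>E (?x + ?a m) - E ?x\<bar>) \<longlonglongrightarrow> \<bar>E (?x + S t a) - E ?x\<bar>"
      by (intro tendsto_intros E_lim pt)
    then have "\<bar>E (?x + S t a) - E ?x\<bar> \<le> K * ?ka" using Em by (intro LIMSEQ_le_const2) auto
    moreover have "(\<lambda>m. \<bar>second_diff E ?x (?a m) (?b m)\<bar>)
        \<longlonglongrightarrow> \<bar>second_diff E ?x (S t a) (S t b)\<bar>"
      by (intro tendsto_intros E_lim pt)
    then have "\<bar>second_diff E ?x (S t a) (S t b)\<bar> \<le> K * ?ka * ?kb"
      using Em by (intro LIMSEQ_le_const2) auto
    ultimately show ?thesis unfolding P_eq E_def by (simp add: St.add)
  qed
  show ?thesis by (rule that[OF c]) (use main in blast)+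
qed

end

section \<open>Hoelder continuity of the gradient of the solution\<close>

context OU_setting
begin

lemma transition_second_diff_holder:
  assumes \<theta>: "0 < \<theta>" "\<theta> < 1"
  obtains L where "0 < L" "\<And>t \<phi> K x a b. 0 < t \<Longrightarrow> bdd_cont \<phi> K \<Longrightarrow>
      \<bar>second_diff (P t \<phi>) x a b\<bar>
        \<le> L * K * t powr (- (\<gamma> + \<gamma> * \<theta>)) * (norm a * norm b powr \<theta>)"
proof -
  obtain c where c: "0 < c"
    and d1: "\<And>t \<phi> K x a. 0 < t \<Longrightarrow> bdd_cont \<phi> K \<Longrightarrow> \<bar>P t \<phi> (x + a) - P t \<phi> x\<bar> \<le> K * (c * t powr (- \<gamma>) * norm a)"
    and d2: "\<And>t \<phi> K x a b. 0 < t \<Longrightarrow> bdd_cont \<phi> K \<Longrightarrow>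
      \<bar>second_diff (P t \<phi>) x a b\<bar>
        \<le> K * (c * t powr (- \<gamma>) * norm a) * (c * t powr (- \<gamma>) * norm b)"
    using transition_differences by blast
  have "\<bar>second_diff (P t \<phi>) x a b\<bar>
        \<le> (2 * c powr (1 + \<theta>)) * K * t powr (- (\<gamma> + \<gamma> * \<theta>)) * (norm a * norm b powr \<theta>)"
    if t: "0 < t" and \<phi>: "bdd_cont \<phi> K" for t \<phi> K x a b
  proof -
    have K: "0 \<le> K" by (rule bdd_cont_nonneg[OF \<phi>])
    define A y where "A = K * (c * t powr (- \<gamma>) * norm a)" and "y = c * t powr (- \<gamma>) * norm b"
    have A: "0 \<le> A" and y: "0 \<le> y" using K c by (auto simp: A_def y_def)
    let ?d = "\<bar>second_diff (P t \<phi>) x a b\<bar>"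
    have "?d \<le> A * y" unfolding A_def y_def by (rule d2[OF t \<phi>])
    \<comment> \<open>Grouped as two first differences along \<open>a\<close>, based at
      \<open>x + b\<close> and at \<open>x\<close>, so that the factor \<open>norm a\<close> is
      kept.\<close>
    moreover have "?d \<le> A * 2"
      using d1[OF t \<phi>, of "x + b" a] d1[OF t \<phi>, of x a] unfolding A_def by (simp add: ac_simps)
    ultimately have "?d \<le> A * min y 2" by (simp add: min_def)
    \<comment> \<open>\<open>y \<le> y powr \<theta>\<close> up to 1, and
      \<open>2 \<le> 2 * y powr \<theta>\<close> beyond.\<close>
    also have "min y 2 \<le> 2 * y powr \<theta>"
    proof (cases "y \<le> 1")
      case True
      have "y powr 1 \<le> y powr \<theta>" using True y \<theta> by (intro powr_mono') auto
      then have "y \<le> y powr \<theta>" using y by simp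
      then show ?thesis using y by (simp add: min_def)
    next
      case False
      then show ?thesis using \<theta> ge_one_powr_ge_zero[of y \<theta>] by simp
    qed
    then have "A * min y 2 \<le> A * (2 * y powr \<theta>)" using A by (rule mult_left_mono)
    also have "A * (2 * y powr \<theta>) = (2 * c powr (1 + \<theta>)) * K * t powr (- (\<gamma> + \<gamma> * \<theta>)) * (norm a * norm b powr \<theta>)"
    proof -
      have "y powr \<theta> = c powr \<theta> * t powr (- \<gamma> * \<theta>) * norm b powr \<theta>"
        using c t by (simp add: y_def powr_mult powr_powr)
      moreover have "c powr (1 + \<theta>) = c * c powr \<theta>" using c by (simp add: powr_add)
      moreover have "t powr (- (\<gamma> + \<gamma> * \<theta>)) = t powr (- \<gamma>) * t powr (- \<gamma> * \<theta>)" by (simp flip: powr_add)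
      ultimately show ?thesis by (simp only: A_def ac_simps)
    qed
    finally show ?thesis by (simp add: A_def)
  qed
  then show ?thesis using that[of "2 * c powr (1 + \<theta>)"] c by simp
qed

end

section \<open>Growth and continuity of the Hamiltonian\<close>

lemma inf_hamiltonian_bounds:
  fixes p q :: "'h::real_inner"
  assumes R: "0 < R"
  defines "m \<equiv> \<lambda>p. INF l\<in>{l. norm l \<le> R}. l \<bullet> p + (norm l)\<^sup>2 / 2"
  shows "m p \<le> 0" "- (R * norm p) \<le> m p" "\<bar>m p - m q\<bar> \<le> R * norm (p - q)"
proof -
  have ne: "{l::'h. norm l \<le> R} \<noteq> {}" using R by (auto intro!: exI[of _ 0])
  have inner_le: "\<bar>l \<bullet> p\<bar> \<le> R * norm p" if "norm l \<le> R" for l p :: 'h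
    using Cauchy_Schwarz_ineq2[of l p] mult_right_mono[OF that norm_ge_zero[of p]] by linarith
  have low: "- (R * norm p) \<le> l \<bullet> p + (norm l)\<^sup>2 / 2" if "norm l \<le> R" for l p :: 'h
    using inner_le[OF that, of p] zero_le_power2[of "norm l"] by linarith
  have bdd: "bdd_below ((\<lambda>l. l \<bullet> p + (norm l)\<^sup>2 / 2) ` {l. norm l \<le> R})" for p :: 'h
    using low by (intro bdd_belowI2) auto
  show "m p \<le> 0" unfolding m_def using cINF_lower[OF bdd[of p], of 0] R by simp
  show "- (R * norm p) \<le> m p" unfolding m_def by (rule cINF_greatest[OF ne]) (simp add: low)
  \<comment> \<open>Each \<open>l\<close> gives a function of \<open>p\<close> with Lipschitz
    constant at most \<open>R\<close>, and infima preserve this; exchanging \<open>p\<close> and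
    \<open>q\<close> gives the other direction.\<close>
  have "m p - R * norm (p - q) \<le> m q" for p q :: 'h
    unfolding m_def
  proof (rule cINF_greatest[OF ne])
    fix l :: 'h assume l: "l \<in> {l. norm l \<le> R}"
    have "m p \<le> l \<bullet> p + (norm l)\<^sup>2 / 2" unfolding m_def by (rule cINF_lower[OF bdd l])
    moreover have "l \<bullet> p - l \<bullet> q \<le> R * norm (p - q)"
      using inner_le[of l "p - q"] l by (simp add: inner_diff_right)
    ultimately show "(INF l\<in>{l. norm l \<le> R}. l \<bullet> p + (norm l)\<^sup>2 / 2) - R * norm (p - q) \<le> l \<bullet> q + (norm l)\<^sup>2 / 2"
      unfolding m_def by linarith
  qed
  from this[of p q] this[of q p] show "\<bar>m p - m q\<bar> \<le> R * norm (p - q)" by (simp add: norm_minus_commute abs_le_iff)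
qed

text \<open>The bound is affine in \<open>BG\<close>, so a gradient of order
  \<open>s powr (- \<gamma>)\<close> leads to a source term of the same order in the integral
  equation.\<close>

lemma bdd_cont_hamiltonian:
  fixes F :: "'h::real_inner \<Rightarrow> 'h" and G :: "'h \<Rightarrow> 'h"
  assumes R: "0 < R" and F: "continuous_on UNIV F" "\<And>x. norm (F x) \<le> BF"
    and g: "bdd_cont g Bg" and G: "continuous_on UNIV G" "\<And>x. norm (G x) \<le> BG"
  shows "bdd_cont (\<lambda>y. hamiltonian R F g y (G y)) ((R + BF) * BG + Bg)"
proof -
  define m where "m p = (INF l\<in>{l. norm l \<le> R}. l \<bullet> p + (norm l)\<^sup>2 / 2)" for p :: 'h
  have b: "m p \<le> 0" "- (R * norm p) \<le> m p" "\<bar>m p - m q\<bar> \<le> R * norm (p - q)" for p q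
    unfolding m_def by (rule inf_hamiltonian_bounds[OF R])+
  have "R-lipschitz_on UNIV m" using b(3) R by (intro lipschitz_onI) (auto simp: dist_norm)
  then have "continuous_on UNIV m" by (rule lipschitz_on_continuous_on)
  then have "continuous_on UNIV (\<lambda>y. m (G y))" using G(1) by (rule continuous_on_compose2) auto
  then have "continuous_on UNIV (\<lambda>y. hamiltonian R F g y (G y))"
    unfolding hamiltonian_def m_def[symmetric] using F G g by (intro continuous_intros) (auto simp: bdd_cont_def)
  moreover have "\<bar>hamiltonian R F g y (G y)\<bar> \<le> (R + BF) * BG + Bg" for y
  proof -
    have "\<bar>m (G y)\<bar> \<le> R * norm (G y)" using b(1,2)[of "G y"] by simp
    also have "\<dots> \<le> R * BG" using R G(2) by (intro mult_left_mono) auto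
    finally have 1: "\<bar>m (G y)\<bar> \<le> R * BG" .
    have "\<bar>F y \<bullet> G y\<bar> \<le> norm (F y) * norm (G y)" by (rule Cauchy_Schwarz_ineq2)
    also have "\<dots> \<le> BF * BG" using F(2)[of y] G(2)[of y] by (intro mult_mono) (auto intro: order_trans[OF norm_ge_zero])
    finally have 2: "\<bar>F y \<bullet> G y\<bar> \<le> BF * BG" .
    have 3: "\<bar>g y\<bar> \<le> Bg" using g by (simp add: bdd_cont_def)
    show ?thesis unfolding hamiltonian_def m_def[symmetric] using 1 2 3 by (simp add: distrib_right abs_le_iff)
  qed
  ultimately show ?thesis by (simp add: bdd_cont_def)
qed

section \<open>From second differences to the gradient\<close>

lemma GDERIV_grad:
  assumes "f \<in> C1b"
  shows "GDERIV f x :> grad f x"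
proof -
  obtain d where d: "GDERIV f x :> d" using assms unfolding C1b_def by blast
  have "d' = d" if "GDERIV f x :> d'" for d'
  proof -
    have "(\<lambda>h. h \<bullet> d') = (\<lambda>h. h \<bullet> d)"
      using that d unfolding gderiv_def by (rule has_derivative_unique)
    then have "\<forall>h. h \<bullet> d' = h \<bullet> d" by (simp add: fun_eq_iff)
    then show "d' = d" by (simp only: vector_eq_ldot)
  qed
  with d show ?thesis unfolding grad_def by (rule theI[of "\<lambda>d. GDERIV f x :> d"])
qed

lemma GDERIV_directional:
  assumes "GDERIV f x :> d"
  shows "((\<lambda>\<epsilon>. (f (x + \<epsilon> *\<^sub>R v) - f x) / \<epsilon>) \<longlongrightarrow> v \<bullet> d) (at_right 0)"
proof -
  have f: "(f has_derivative (\<lambda>h. h \<bullet> d)) (at (x + 0 *\<^sub>R v))" using assms by (simp add: gderiv_def)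
  have "((\<lambda>\<epsilon>. x + \<epsilon> *\<^sub>R v) has_derivative (\<lambda>\<epsilon>. \<epsilon> *\<^sub>R v)) (at (0::real))"
    by (auto intro!: derivative_eq_intros)
  from has_derivative_compose[OF this f]
  have "((\<lambda>\<epsilon>. f (x + \<epsilon> *\<^sub>R v)) has_derivative (\<lambda>\<epsilon>. \<epsilon> *\<^sub>R v \<bullet> d)) (at 0)" .
  then have "((\<lambda>\<epsilon>. f (x + \<epsilon> *\<^sub>R v)) has_real_derivative v \<bullet> d) (at 0)"
    unfolding has_field_derivative_def by (rule has_derivative_eq_rhs) (auto simp: fun_eq_iff)
  then have "((\<lambda>\<epsilon>. (f (x + \<epsilon> *\<^sub>R v) - f x) / \<epsilon>) \<longlongrightarrow> v \<bullet> d) (at 0)"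
    unfolding has_field_derivative_iff by simp
  then show ?thesis by (rule filterlim_mono[OF _ order_refl at_le]) simp
qed

text \<open>For \<open>v = grad f x - grad f y\<close> the second difference at \<open>y\<close>
  along \<open>\<epsilon> *\<^sub>R v\<close> and \<open>x - y\<close>, divided by
  \<open>\<epsilon>\<close>, tends to \<open>v \<bullet> v\<close>; one factor \<open>norm v\<close>
  then cancels.\<close>

lemma grad_holder_of_second_diff:
  assumes f: "f \<in> C1b" and L: "0 \<le> L"
    and diff: "\<And>x a b. \<bar>second_diff f x a b\<bar> \<le> L * (norm a * norm b powr \<theta>)"
  shows "norm (grad f x - grad f y) \<le> L * norm (x - y) powr \<theta>"
proof -
  let ?v = "grad f x - grad f y" and ?b = "x - y"
  have "((\<lambda>\<epsilon>. (f (x + \<epsilon> *\<^sub>R ?v) - f x) / \<epsilon> - (f (y + \<epsilon> *\<^sub>R ?v) - f y) / \<epsilon>) \<longlongrightarrow> ?v \<bullet> grad f x - ?v \<bullet> grad f y) (at_right 0)"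
    by (intro tendsto_diff GDERIV_directional GDERIV_grad f)
  moreover have "\<forall>\<^sub>F \<epsilon> in at_right 0. (f (x + \<epsilon> *\<^sub>R ?v) - f x) / \<epsilon> - (f (y + \<epsilon> *\<^sub>R ?v) - f y) / \<epsilon>
      \<le> L * (norm ?v * norm ?b powr \<theta>)"
    using eventually_at_right_less[of 0]
  proof eventually_elim
    case (elim \<epsilon>)
    have "second_diff f y (\<epsilon> *\<^sub>R ?v) ?b \<le> L * (norm (\<epsilon> *\<^sub>R ?v) * norm ?b powr \<theta>)"
      using diff[of y "\<epsilon> *\<^sub>R ?v" ?b] by linarith
    moreover have "y + \<epsilon> *\<^sub>R ?v + ?b = x + \<epsilon> *\<^sub>R ?v" "y + ?b = x" by simp_all
    ultimately have "f (x + \<epsilon> *\<^sub>R ?v) - f (y + \<epsilon> *\<^sub>R ?v) - f x + f y \<le> \<epsilon> * (L * (norm ?v * norm ?b powr \<theta>))"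
      using elim by (simp add: ac_simps)
    then have "(f (x + \<epsilon> *\<^sub>R ?v) - f (y + \<epsilon> *\<^sub>R ?v) - f x + f y) / \<epsilon> \<le> L * (norm ?v * norm ?b powr \<theta>)"
      using elim by (simp add: field_simps)
    then show ?case by (simp add: diff_divide_distrib add_divide_distrib)
  qed
  ultimately have "?v \<bullet> grad f x - ?v \<bullet> grad f y \<le> L * (norm ?v * norm ?b powr \<theta>)"
    by (intro tendsto_upperbound) auto
  then have "norm ?v * norm ?v \<le> norm ?v * (L * norm ?b powr \<theta>)"
    by (simp add: inner_diff_right[symmetric] dot_square_norm power2_eq_square ac_simps)
  then show ?thesis
    using L by (cases "norm ?v = 0") (simp_all add: mult_le_cancel_left)
qed

text \<open>On each half of \<open>[0, t]\<close> one factor is regular and at most its value at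
  \<open>t / 2\<close>, so a sum of two power functions is a majorant, which suffices in place of
  the Beta integral. \<open>t powr (1 - \<gamma>)\<close> is kept apart because it will be bounded
  by \<open>T powr (1 - \<gamma>)\<close>.\<close>

lemma singular_kernel_integral:
  assumes \<gamma>: "0 < \<gamma>" "\<gamma> < 1" and \<delta>: "0 < \<delta>" "\<delta> < (1::real)"
  obtains k where "0 < k" "\<And>t. 0 < t \<Longrightarrow> \<exists>w. integrable lborel w \<and>
    (\<forall>s. 0 \<le> w s) \<and> (\<forall>s. 0 < s \<longrightarrow> s < t \<longrightarrow> s powr (- \<gamma>) * (t - s) powr (- \<delta>) \<le> w s) \<and>
    (\<integral>s. w s \<partial>lborel) = k * t powr (1 - \<gamma>) * t powr (- \<delta>)"
proof -
  define k where "k = (1 / 2) powr (- \<delta>) / (1 - \<gamma>) + (1 / 2) powr (- \<gamma>) / (1 - \<delta>)"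
  have k: "0 < k" unfolding k_def using \<gamma> \<delta> by (intro add_pos_pos divide_pos_pos) auto
  have "\<exists>w. integrable lborel w \<and>
    (\<forall>s. 0 \<le> w s) \<and> (\<forall>s. 0 < s \<longrightarrow> s < t \<longrightarrow> s powr (- \<gamma>) * (t - s) powr (- \<delta>) \<le> w s) \<and>
    (\<integral>s. w s \<partial>lborel) = k * t powr (1 - \<gamma>) * t powr (- \<delta>)" if t: "0 < t" for t
  proof -
    have base: "has_bochner_integral lborel (\<lambda>s. indicator {0..t} s * s powr (- \<eta>)) (t powr (1 - \<eta>) / (1 - \<eta>))"
      if "\<eta> < 1" for \<eta>
    proof -
      have "has_bochner_integral lborel (\<lambda>s. indicator {0..t} s * s powr (- \<eta>)) (t powr (- \<eta> + 1) / (- \<eta> + 1))"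
        using that t by (intro has_bochner_integral_of_has_integral has_integral_powr_from_0) auto
      then show ?thesis by (simp add: add.commute)
    qed
    have refl: "has_bochner_integral lborel (\<lambda>s. indicator {0..t} s * (t - s) powr (- \<delta>)) (t powr (1 - \<delta>) / (1 - \<delta>))"
    proof -
      have "has_bochner_integral lborel (\<lambda>s. indicator {0..t} (t + - 1 * s) * (t + - 1 * s) powr (- \<delta>)) (t powr (1 - \<delta>) / (1 - \<delta>) /\<^sub>R \<bar>- 1\<bar>)"
        by (rule lborel_has_bochner_integral_real_affine_iff[THEN iffD1, OF _ base[OF \<delta>(2)]]) simp
      moreover have "(\<lambda>s. indicator {0..t} (t + - 1 * s) * (t + - 1 * s) powr (- \<delta>)) = (\<lambda>s. indicator {0..t} s * (t - s) powr (- \<delta>))"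
        by (auto simp: indicator_def)
      moreover have "t powr (1 - \<delta>) / (1 - \<delta>) /\<^sub>R \<bar>- 1\<bar> = t powr (1 - \<delta>) / (1 - \<delta>)" by simp
      ultimately show ?thesis by (simp only:)
    qed
    let ?w = "\<lambda>s. (t / 2) powr (- \<delta>) * (indicator {0..t} s * s powr (- \<gamma>)) + (t / 2) powr (- \<gamma>) * (indicator {0..t} s * (t - s) powr (- \<delta>))"
    have w: "has_bochner_integral lborel ?w
        ((t / 2) powr (- \<delta>) * (t powr (1 - \<gamma>) / (1 - \<gamma>)) + (t / 2) powr (- \<gamma>) * (t powr (1 - \<delta>) / (1 - \<delta>)))"
      by (intro has_bochner_integral_add has_bochner_integral_mult_right base \<gamma> refl)
    have half: "(t / 2) powr (- \<eta>) = (1 / 2) powr (- \<eta>) * t powr (- \<eta>)" for \<eta>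
      using t powr_mult[of "1 / 2" t "- \<eta>"] by simp
    have "t powr (- \<gamma>) * t powr (1 - \<delta>) = t powr (1 - \<gamma>) * t powr (- \<delta>)"
      by (simp flip: powr_add add: algebra_simps)
    then have "(t / 2) powr (- \<delta>) * (t powr (1 - \<gamma>) / (1 - \<gamma>)) + (t / 2) powr (- \<gamma>) * (t powr (1 - \<delta>) / (1 - \<delta>))
        = k * t powr (1 - \<gamma>) * t powr (- \<delta>)"
      unfolding half k_def by (simp add: algebra_simps)
    with w have "(\<integral>s. ?w s \<partial>lborel) = k * t powr (1 - \<gamma>) * t powr (- \<delta>)" by (simp add: has_bochner_integral_iff)
    moreover have "s powr (- \<gamma>) * (t - s) powr (- \<delta>) \<le> ?w s" if s: "0 < s" "s < t" for s
    proof (cases "s \<le> t / 2")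
      case True
      then have "(t - s) powr (- \<delta>) \<le> (t / 2) powr (- \<delta>)" using t \<delta> by (intro powr_mono2') auto
      then have "s powr (- \<gamma>) * (t - s) powr (- \<delta>) \<le> (t / 2) powr (- \<delta>) * s powr (- \<gamma>)"
        by (subst mult.commute) (rule mult_right_mono, auto)
      then show ?thesis using s by (simp add: add_increasing2)
    next
      case False
      then have "s powr (- \<gamma>) \<le> (t / 2) powr (- \<gamma>)" using t \<gamma> by (intro powr_mono2') auto
      then have "s powr (- \<gamma>) * (t - s) powr (- \<delta>) \<le> (t / 2) powr (- \<gamma>) * (t - s) powr (- \<delta>)"
        by (rule mult_right_mono) auto
      then show ?thesis using s by (simp add: add_increasing)
    qed
    ultimately show ?thesis using w by (intro exI[of _ ?w]) (auto simp: has_bochner_integral_iff)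
  qed
  then show ?thesis using that k by blast
qed

lemma C1_gamma_grad_bound:
  assumes "u \<in> C1_gamma T \<gamma>"
  obtains N where "0 \<le> N" "\<And>t x. t \<in> {0<..T} \<Longrightarrow> norm (grad (u t) x) \<le> N * t powr (- \<gamma>)"
proof -
  have "bdd_above ((\<lambda>t. t powr \<gamma> * sup_norm (grad (u t))) ` {0<..T})"
    using assms unfolding C1_gamma_def mem_Collect_eq by (elim conjE)
  then obtain N where N: "\<forall>x\<in>(\<lambda>t. t powr \<gamma> * sup_norm (grad (u t))) ` {0<..T}. x \<le> N"
    unfolding bdd_above_def by blast
  have "norm (grad (u t) x) \<le> max N 0 * t powr (- \<gamma>)" if t: "t \<in> {0<..T}" for t x
  proof -
    \<comment> \<open>\<open>sup_norm\<close> is a real supremum, so it is known to be an upper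
      bound only after boundedness has been established.\<close>
    have "bounded (range (grad (u t)))" using assms t unfolding C1_gamma_def C1b_def Cb_def by blast
    then obtain B where "\<And>x. norm (grad (u t) x) \<le> B" unfolding bounded_iff by auto
    then have "bdd_above (range (\<lambda>x. norm (grad (u t) x)))" by (intro bdd_aboveI2) auto
    then have "norm (grad (u t) x) \<le> sup_norm (grad (u t))" unfolding sup_norm_def by (intro cSUP_upper) auto
    also have "\<dots> = t powr \<gamma> * sup_norm (grad (u t)) * t powr (- \<gamma>)" using t by (simp add: powr_minus field_simps)
    also have "\<dots> \<le> max N 0 * t powr (- \<gamma>)" using N t by (intro mult_right_mono) (auto simp: le_max_iff_disj)
    finally show ?thesis .
  qed
  then show ?thesis using that[of "max N 0"] by simp
qed

context OU_setting
begin

text \<open>The source \<open>\<phi> s\<close> is of order \<open>s powr (- \<gamma>)\<close>, and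
  \<open>P (t - s)\<close> costs \<open>(t - s) powr (- \<delta>)\<close> with
  \<open>\<delta> = \<gamma> + \<gamma> * \<theta>\<close>. Both exponents being below 1, the time
  integral is at most a multiple of \<open>t powr (1 - \<gamma>) * t powr (- \<delta>)\<close>, no
  more singular than the bound for the term with \<open>h\<close>.\<close>

lemma solution_second_diff:
  assumes T: "0 < T" and R: "0 < R" and F: "\<exists>L. L-lipschitz_on UNIV F" "bounded (range F)"
    and g: "g \<in> Cb" and h: "h \<in> Cb" and u: "u \<in> C1_gamma T \<gamma>"
    and sol: "solves_integral_equation P T (hamiltonian R F g) h u"
    and \<theta>: "0 < \<theta>" "\<theta> < 1" "\<gamma> + \<theta> * \<gamma> < 1"
  obtains L where "0 < L" "\<And>t x a b. t \<in> {0<..T} \<Longrightarrow>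
    \<bar>second_diff (u t) x a b\<bar> \<le> L * t powr (- (\<gamma> + \<gamma> * \<theta>)) * (norm a * norm b powr \<theta>)"
proof -
  have Cb: "\<exists>K. bdd_cont f K" if "f \<in> Cb" for f :: "'h \<Rightarrow> real"
    using that unfolding Cb_def bdd_cont_def bounded_iff by auto
  obtain Bg Bh where Bg: "bdd_cont g Bg" and Bh: "bdd_cont h Bh" using Cb g h by blast
  obtain BF where BF: "\<And>x. norm (F x) \<le> BF" using F(2) unfolding bounded_iff by auto
  have contF: "continuous_on UNIV F" using F(1) lipschitz_on_continuous_on by blast
  obtain N where N: "0 \<le> N" "\<And>t x. t \<in> {0<..T} \<Longrightarrow> norm (grad (u t) x) \<le> N * t powr (- \<gamma>)"
    using C1_gamma_grad_bound[OF u] by blast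
  have \<gamma>0: "0 < \<gamma>" using \<gamma> \<alpha> by (smt (verit) zero_less_divide_1_iff)
  define \<delta> where "\<delta> = \<gamma> + \<gamma> * \<theta>"
  have \<delta>: "0 < \<delta>" "\<delta> < 1" using \<gamma>0 \<theta> by (auto simp: \<delta>_def mult.commute add_pos_pos)
  define \<phi> where "\<phi> s y = hamiltonian R F g y (grad (u s) y)" for s y
  \<comment> \<open>The bounded part \<open>g\<close> is absorbed into the singular bound by
    \<open>1 \<le> T powr \<gamma> * s powr (- \<gamma>)\<close>.\<close>
  define K where "K = (R + BF) * N + Bg * T powr \<gamma>"
  have BF0: "0 \<le> BF" using BF norm_ge_zero order_trans by blast
  have Bg0: "0 \<le> Bg" and Bh0: "0 \<le> Bh" using Bg Bh bdd_cont_nonneg by auto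
  have K0: "0 \<le> K" using R BF0 N(1) Bg0 by (simp add: K_def)
  have \<phi>: "bdd_cont (\<phi> s) (K * s powr (- \<gamma>))" if s: "s \<in> {0<..T}" for s
  proof -
    have "continuous_on UNIV (grad (u s))" using u s unfolding C1_gamma_def C1b_def Cb_def by blast
    from bdd_cont_hamiltonian[OF R contF BF Bg this N(2)[OF s]]
    have b: "bdd_cont (\<phi> s) ((R + BF) * (N * s powr (- \<gamma>)) + Bg)" unfolding \<phi>_def[abs_def] .
    have "1 \<le> T powr \<gamma> * s powr (- \<gamma>)"
    proof -
      have "s powr \<gamma> \<le> T powr \<gamma>" using s \<gamma>0 by (intro powr_mono2) auto
      then show ?thesis using s by (simp add: powr_minus field_simps)
    qed
    then have "Bg * 1 \<le> Bg * (T powr \<gamma> * s powr (- \<gamma>))" using Bg0 by (rule mult_left_mono)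
    then have "(R + BF) * (N * s powr (- \<gamma>)) + Bg \<le> K * s powr (- \<gamma>)"
      by (simp add: K_def algebra_simps)
    then show ?thesis using b unfolding bdd_cont_def by (meson order_trans)
  qed
  obtain L0 where L0: "0 < L0" and P2: "\<And>t \<phi> K x a b. 0 < t \<Longrightarrow> bdd_cont \<phi> K \<Longrightarrow>
      \<bar>second_diff (P t \<phi>) x a b\<bar>
        \<le> L0 * K * t powr (- \<delta>) * (norm a * norm b powr \<theta>)"
    unfolding \<delta>_def using transition_second_diff_holder[OF \<theta>(1,2)] by blast
  obtain k where k: "0 < k" and ker: "\<And>t. 0 < t \<Longrightarrow> \<exists>w. integrable lborel w \<and>
    (\<forall>s. 0 \<le> w s) \<and> (\<forall>s. 0 < s \<longrightarrow> s < t \<longrightarrow> s powr (- \<gamma>) * (t - s) powr (- \<delta>) \<le> w s) \<and>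
    (\<integral>s. w s \<partial>lborel) = k * t powr (1 - \<gamma>) * t powr (- \<delta>)"
    using singular_kernel_integral[OF \<gamma>0 \<gamma>(2) \<delta>] by blast
  \<comment> \<open>The final 1 makes \<open>L\<close> positive even if \<open>Bh\<close> and
    \<open>K\<close> vanish.\<close>
  define L where "L = L0 * Bh + L0 * K * (k * T powr (1 - \<gamma>)) + 1"
  have L: "0 < L" unfolding L_def using L0 Bh0 K0 k by (intro add_nonneg_pos add_nonneg_nonneg mult_nonneg_nonneg) auto
  have "\<bar>second_diff (u t) x a b\<bar> \<le> L * t powr (- \<delta>) * (norm a * norm b powr \<theta>)"
    if t: "t \<in> {0<..T}" for t x a b
  proof -
    have tt: "0 < t" "t \<le> T" using t by auto
    let ?n = "norm a * norm b powr \<theta>"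
    obtain w where w: "integrable lborel w" "\<And>s. 0 \<le> w s"
      "\<And>s. 0 < s \<Longrightarrow> s < t \<Longrightarrow> s powr (- \<gamma>) * (t - s) powr (- \<delta>) \<le> w s"
      "(\<integral>s. w s \<partial>lborel) = k * t powr (1 - \<gamma>) * t powr (- \<delta>)"
      using ker[OF tt(1)] by blast
    define f where "f z s = indicator {0..t} s *\<^sub>R P (t - s) (\<phi> s) z" for z s
    have fi: "integrable lborel (f z)" and uz: "u t z = P t h z + (\<integral>s. f z s \<partial>lborel)" for z
      using sol tt unfolding solves_integral_equation_def set_integrable_def set_lebesgue_integral_def f_def[abs_def] \<phi>_def[abs_def]
      by auto
    define \<Delta> where "\<Delta> s = f (x + a + b) s - f (x + a) s - f (x + b) s + f x s" for s
    have \<Delta>i: "integrable lborel \<Delta>" unfolding \<Delta>_def[abs_def] by (intro Bochner_Integration.integrable_add Bochner_Integration.integrable_diff fi)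
    have int\<Delta>: "(\<integral>s. \<Delta> s \<partial>lborel) = (\<integral>s. f (x + a + b) s \<partial>lborel) - (\<integral>s. f (x + a) s \<partial>lborel) - (\<integral>s. f (x + b) s \<partial>lborel) + (\<integral>s. f x s \<partial>lborel)"
      unfolding \<Delta>_def by (simp add: fi)
    have "\<bar>\<integral>s. \<Delta> s \<partial>lborel\<bar> \<le> (\<integral>s. \<bar>\<Delta> s\<bar> \<partial>lborel)" by (rule integral_abs_bound)
    also have "\<dots> \<le> (\<integral>s. L0 * K * ?n * w s \<partial>lborel)"
    proof (rule integral_mono_AE)
      show "integrable lborel (\<lambda>s. \<bar>\<Delta> s\<bar>)" using \<Delta>i by simp
      show "integrable lborel (\<lambda>s. L0 * K * ?n * w s)" using w(1) by simp
      \<comment> \<open>Both ends are excluded: there is no gradient bound at \<open>s = 0\<close>,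
        and \<open>P 0\<close> does not smooth.\<close>
      show "AE s in lborel. \<bar>\<Delta> s\<bar> \<le> L0 * K * ?n * w s"
        using AE_lborel_singleton[of 0] AE_lborel_singleton[of t]
      proof eventually_elim
        case (elim s)
        show ?case
        proof (cases "0 < s \<and> s < t")
          case True
          then have "\<bar>\<Delta> s\<bar> \<le> L0 * (K * s powr (- \<gamma>)) * (t - s) powr (- \<delta>) * ?n"
            using P2[of "t - s" "\<phi> s" "K * s powr (- \<gamma>)" x a b] \<phi>[of s] tt by (simp add: \<Delta>_def f_def)
          also have "\<dots> = L0 * K * ?n * (s powr (- \<gamma>) * (t - s) powr (- \<delta>))" by (simp add: ac_simps)
          also have "\<dots> \<le> L0 * K * ?n * w s" using w(3) True L0 K0 by (intro mult_left_mono) auto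
          finally show ?thesis .
        next
          case False
          then have "\<Delta> s = 0" using elim by (auto simp: \<Delta>_def f_def indicator_def)
          then show ?thesis using L0 K0 w(2)[of s] by simp
        qed
      qed
    qed
    also have "\<dots> = L0 * K * ?n * (k * t powr (1 - \<gamma>) * t powr (- \<delta>))" using w(4) by simp
    also have "\<dots> \<le> L0 * K * ?n * (k * T powr (1 - \<gamma>) * t powr (- \<delta>))"
      using L0 K0 k tt \<gamma>(2) by (intro mult_left_mono mult_right_mono powr_mono2) auto
    finally have 1: "\<bar>\<integral>s. \<Delta> s \<partial>lborel\<bar> \<le> L0 * K * (k * T powr (1 - \<gamma>)) * t powr (- \<delta>) * ?n" by (simp add: ac_simps)
    have 2: "\<bar>second_diff (P t h) x a b\<bar> \<le> L0 * Bh * t powr (- \<delta>) * ?n"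
      by (rule P2[OF tt(1) Bh])
    have "second_diff (u t) x a b
        = (second_diff (P t h) x a b) + (\<integral>s. \<Delta> s \<partial>lborel)"
      unfolding uz int\<Delta> by simp
    then have "\<bar>second_diff (u t) x a b\<bar>
        \<le> L0 * Bh * t powr (- \<delta>) * ?n + L0 * K * (k * T powr (1 - \<gamma>)) * t powr (- \<delta>) * ?n"
      using 1 2 by linarith
    also have "\<dots> \<le> L * t powr (- \<delta>) * ?n" unfolding L_def by (simp add: algebra_simps)
    finally show ?thesis .
  qed
  then show ?thesis using that[OF L] unfolding \<delta>_def by blast
qed

end

theorem theorem4p3:
  fixes e :: "nat \<Rightarrow> 'h::{real_inner, polish_space}"
    and D :: "'h set" and A :: "'h \<Rightarrow> 'h" and S :: "real \<Rightarrow> 'h \<Rightarrow> 'h"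
    and M :: "'w measure" and \<F> :: "real \<Rightarrow> 'w measure"
    and Z :: "nat \<Rightarrow> real \<Rightarrow> 'w \<Rightarrow> real"
    and \<alpha> \<gamma> C T R :: real and \<beta> \<gamma>n :: "nat \<Rightarrow> real"
    and F :: "'h \<Rightarrow> 'h" and g h :: "'h \<Rightarrow> real" and u :: "real \<Rightarrow> 'h \<Rightarrow> real"
  assumes "orthonormal_basis e"
    and "1 < \<alpha>" "\<alpha> < 2" and "\<And>n. 0 < \<beta> n"
    and "stochastic_basis M \<F>"
    and "\<And>n. stable_levy_process M \<F> \<alpha> (Z n)"
    and "independent_processes M Z"
    and "self_adjoint_operator D A"
    and "range e \<subseteq> D" and "\<And>n. 0 < \<gamma>n n" and "filterlim \<gamma>n at_top sequentially"
    and "\<And>n. A (e n) = - \<gamma>n n *\<^sub>R e n"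
    and "1 / \<alpha> \<le> \<gamma>" "\<gamma> < 1" "0 < C" and "\<And>n. C * \<gamma>n n powr (1 / \<alpha> - \<gamma>) \<le> \<beta> n"
    and "summable (\<lambda>n. \<beta> n powr \<alpha> / \<gamma>n n)"
    and "semigroup_generated_by S D A"
    and "0 < T" "0 < R"
    and "\<exists>L. L-lipschitz_on UNIV F" and "bounded (range F)"
    and "g \<in> Cb" "h \<in> Cb"
    and "u \<in> C1_gamma T \<gamma>"
    and "solves_integral_equation (transition_semigroup M (OU_process M S e \<beta> \<gamma>n Z)) T
           (hamiltonian R F g) h u"
  shows "\<forall>\<theta>. 0 < \<theta> \<and> \<theta> < 1 \<and> \<gamma> + \<theta> * \<gamma> < 1 \<longrightarrow>
           (\<forall>t\<in>{0<..T}. u t \<in> C1b_holder \<theta>) \<and>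
           (\<exists>L>0. \<forall>t\<in>{0<..T}.
              holder_seminorm \<theta> (grad (u t)) \<le> ennreal (L / t powr (\<gamma> + \<gamma> * \<theta>)))"
proof (intro allI impI, elim conjE)
  fix \<theta> :: real assume \<theta>: "0 < \<theta>" "\<theta> < 1" "\<gamma> + \<theta> * \<gamma> < 1"
  interpret OU_setting e D A S \<gamma>n M \<F> Z \<alpha> \<gamma> C \<beta>
    by unfold_locales (use assms in auto)
  obtain L where L: "0 < L" and diff: "\<And>t x a b. t \<in> {0<..T} \<Longrightarrow>
      \<bar>second_diff (u t) x a b\<bar> \<le> L * t powr (- (\<gamma> + \<gamma> * \<theta>)) * (norm a * norm b powr \<theta>)"
    using solution_second_diff[of T R F g h u \<theta>] assms \<theta> by blast
  have C1: "u t \<in> C1b" if "t \<in> {0<..T}" for t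
    using \<open>u \<in> C1_gamma T \<gamma>\<close> that unfolding C1_gamma_def by blast
  have holder: "holder_seminorm \<theta> (grad (u t)) \<le> ennreal (L / t powr (\<gamma> + \<gamma> * \<theta>))" if t: "t \<in> {0<..T}" for t
    unfolding holder_seminorm_def
  proof (rule SUP_least, clarify)
    fix x y :: 'h assume "x \<noteq> y"
    have "L * t powr (- (\<gamma> + \<gamma> * \<theta>)) = L / t powr (\<gamma> + \<gamma> * \<theta>)"
      by (simp only: powr_minus divide_inverse)
    then have "norm (grad (u t) x - grad (u t) y) \<le> L / t powr (\<gamma> + \<gamma> * \<theta>) * norm (x - y) powr \<theta>"
      using grad_holder_of_second_diff[OF C1[OF t] _ diff[OF t]] L by simp
    then show "ennreal (norm (grad (u t) x - grad (u t) y) / norm (x - y) powr \<theta>) \<le> ennreal (L / t powr (\<gamma> + \<gamma> * \<theta>))"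
      using \<open>x \<noteq> y\<close> by (intro ennreal_leI) (simp add: pos_divide_le_eq)
  qed
  moreover have "u t \<in> C1b_holder \<theta>" if "t \<in> {0<..T}" for t
    unfolding C1b_holder_def using C1[OF that] le_less_trans[OF holder[OF that]] by simp
  ultimately show "(\<forall>t\<in>{0<..T}. u t \<in> C1b_holder \<theta>) \<and>
           (\<exists>L>0. \<forall>t\<in>{0<..T}.
              holder_seminorm \<theta> (grad (u t)) \<le> ennreal (L / t powr (\<gamma> + \<gamma> * \<theta>)))"
    using L by blast
qed

end
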